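(* Let $N\ge 1$ and let $K$ be an $N$-stranded braid in $S^3$ with $n\ge 1$ components. Then there exist $n$ properly immersed Lagrangian disks $L_1,\dots,L_n$ in $(\mathbb{C}^2,\omega)$, one for each component of $K$, such that the immersed Lagrangian $L=\bigcup_{j=1}^n L_j$ intersects every 3-sphere about the origin of sufficiently large radius transversely, and this intersection, after rescaling the sphere to the unit sphere, is an $N$-stranded braid that is braid isotopic to $K$. In particular, if $K$ is connected ($n=1$), then $L$ is a single properly immersed Lagrangian disk.
   Context: Let $(z_1,z_2)$ be the standard complex coordinates on $\mathbb{C}^2$ and $\omega=\frac{i}{2}(dz_1\wedge d\bar z_1+dz_2\wedge d\bar z_2)$. Introduce the rotated complex coordinates $a_1=2^{-1/2}(z_1-\bar z_2)$, $a_2=2^{-1/2}(z_2+\bar z_1)$; in these coordinates the metric is still the standard one and $\omega=\frac{i}{2}(da_1\wedge da_2-d\bar a_1\wedge d\bar a_2)$. A surface is Lagrangian if $\omega$ pulls back to $0$ on it. All manifolds and maps are smooth. Let $S^1\subset\mathbb{C}$ be the unit circle. An $N$-stranded braid in $S^1\times\mathbb{C}$ means a closed braid: a compact embedded 1-dimensional submanifold whose projection to $S^1$ is an $N$-fold covering map. If it is connected, it is the image of $\theta\mapsto(e^{i\theta},\gamma(\theta))$ for a $2\pi N$-periodic function $\gamma:\mathbb{R}\to\mathbb{C}$ such that the $N$ values $\{\gamma(\theta+2\pi k)\}_{0\le k<N}$ are distinct for every $\theta$. If it has $n$ components, these are given by functions $\gamma_1,\dots,\gamma_n$ with $\gamma_j$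 periodic of period $2\pi N_j$ and $\sum_j N_j=N$. An $N$-stranded braid in $S^3$ is the image of such a braid under the embedding $S^1\times\mathbb{C}\to S^3$, $(\zeta,z)\mapsto(\zeta,z)/(1+|z|^2)^{1/2}$, where $S^3$ is the unit sphere of $\mathbb{C}^2$ with coordinates $(a_1,a_2)$. Two braids are braid isotopic if they are isotopic through a 1-parameter family of braids. *)

theory Defs
  imports "HOL-Analysis.Analysis"
begin

section \<open>Smooth maps, diffeomorphisms, embedded curves\<close>

text \<open>Intended for open \<open>S\<close> in a Euclidean space: there it says that \<open>f\<close> is of class \<open>C\<^sup>k\<close>,
  stated through iterated directional derivatives.\<close>

fun Ck_on :: "nat \<Rightarrow> 'a::euclidean_space set \<Rightarrow> ('a \<Rightarrow> 'b::euclidean_space) \<Rightarrow> bool" where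
  "Ck_on 0 S f \<longleftrightarrow> continuous_on S f"
| "Ck_on (Suc k) S f \<longleftrightarrow>
     (\<forall>x\<in>S. f differentiable (at x)) \<and> (\<forall>v. Ck_on k S (\<lambda>x. frechet_derivative f (at x) v))"

definition smooth_on :: "'a::euclidean_space set \<Rightarrow> ('a \<Rightarrow> 'b::euclidean_space) \<Rightarrow> bool" where
  "smooth_on S f \<longleftrightarrow> (\<forall>k. Ck_on k S f)"

text \<open>Smoothness on an arbitrary subset of a Euclidean space (in particular on an embedded
  submanifold, or on such a submanifold times \<open>[0,1]\<close>): local extendability to smooth maps on open
  sets of the ambient space.\<close>

definition smooth_map :: "'a::euclidean_space set \<Rightarrow> ('a \<Rightarrow> 'b::euclidean_space) \<Rightarrow> bool" where
  "smooth_map X f \<longleftrightarrow>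
     (\<forall>x\<in>X. \<exists>U F. open U \<and> x \<in> U \<and> smooth_on U F \<and> (\<forall>y\<in>X \<inter> U. F y = f y))"

definition diffeomorphism ::
  "'a::euclidean_space set \<Rightarrow> 'b::euclidean_space set \<Rightarrow> ('a \<Rightarrow> 'b) \<Rightarrow> ('b \<Rightarrow> 'a) \<Rightarrow> bool" where
  "diffeomorphism S T f g \<longleftrightarrow>
     smooth_map S f \<and> f ` S = T \<and> (\<forall>x\<in>S. g (f x) = x) \<and>
     smooth_map T g \<and> g ` T = S \<and> (\<forall>y\<in>T. f (g y) = y)"

definition embedded_1_submanifold :: "'a::euclidean_space set \<Rightarrow> bool" where
  "embedded_1_submanifold M \<longleftrightarrow>
     (\<forall>x\<in>M. \<exists>U. openin (top_of_set M) U \<and> x \<in> U \<and>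
        (\<exists>(I::real set) f g. open I \<and> diffeomorphism U I f g))"

text \<open>The smooth analogue of the library's \<open>covering_space\<close>, with \<open>N\<close> sheets.\<close>

definition smooth_covering ::
  "nat \<Rightarrow> 'a::euclidean_space set \<Rightarrow> ('a \<Rightarrow> 'b::euclidean_space) \<Rightarrow> 'b set \<Rightarrow> bool" where
  "smooth_covering N E p B \<longleftrightarrow>
     smooth_map E p \<and> p ` E \<subseteq> B \<and>
     (\<forall>x\<in>B. \<exists>T. x \<in> T \<and> openin (top_of_set B) T \<and>
        (\<exists>\<V>. finite \<V> \<and> card \<V> = N \<and> \<Union>\<V> = E \<inter> p -` T \<and>
             (\<forall>u\<in>\<V>. openin (top_of_set E) u) \<and> pairwise disjnt \<V> \<and>
             (\<forall>u\<in>\<V>. \<exists>q. diffeomorphism u T p q)))"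


section \<open>Closed braids and braid isotopy\<close>

definition solid_torus_braid :: "nat \<Rightarrow> (complex \<times> complex) set \<Rightarrow> bool" where
  "solid_torus_braid N K \<longleftrightarrow>
     K \<subseteq> sphere 0 1 \<times> UNIV \<and> compact K \<and> embedded_1_submanifold K \<and>
     smooth_covering N K fst (sphere 0 1)"

definition torus_to_S3 :: "complex \<times> complex \<Rightarrow> complex \<times> complex" where
  "torus_to_S3 = (\<lambda>(\<zeta>, z). (1 / sqrt (1 + (norm z)\<^sup>2)) *\<^sub>R (\<zeta>, z))"

definition S3_braid :: "nat \<Rightarrow> (complex \<times> complex) set \<Rightarrow> bool" where
  "S3_braid N K \<longleftrightarrow> (\<exists>B. solid_torus_braid N B \<and> K = torus_to_S3 ` B)"

text \<open>A smooth isotopy of embeddings of \<open>K0\<close>, starting at the inclusion and ending on \<open>K1\<close>, all of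
  whose images are braids.\<close>

definition braid_isotopy ::
  "nat \<Rightarrow> (real \<Rightarrow> complex \<times> complex \<Rightarrow> complex \<times> complex) \<Rightarrow>
   (complex \<times> complex) set \<Rightarrow> (complex \<times> complex) set \<Rightarrow> bool" where
  "braid_isotopy N \<Phi> K0 K1 \<longleftrightarrow>
     smooth_map ({0..1} \<times> K0) (\<lambda>(t, x). \<Phi> t x) \<and>
     (\<forall>x\<in>K0. \<Phi> 0 x = x) \<and> \<Phi> 1 ` K0 = K1 \<and>
     (\<forall>t\<in>{0..1}. S3_braid N (\<Phi> t ` K0) \<and> (\<exists>\<Psi>. diffeomorphism K0 (\<Phi> t ` K0) (\<Phi> t) \<Psi>))"


section \<open>The symplectic plane and Lagrangian disks\<close>

text \<open>Pairs are the coordinates \<open>(z\<^sub>1, z\<^sub>2)\<close>, unless they are obtained by \<open>rotated_coords\<close>, which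
  computes \<open>(a\<^sub>1, a\<^sub>2)\<close>. The convention is
  \<open>(\<alpha> \<and> \<beta>)(u, v) = \<alpha>(u) \<beta>(v) - \<alpha>(v) \<beta>(u)\<close>.\<close>

definition omega :: "complex \<times> complex \<Rightarrow> complex \<times> complex \<Rightarrow> complex" where
  "omega u v = \<i> / 2 * ((fst u * cnj (fst v) - fst v * cnj (fst u)) +
                        (snd u * cnj (snd v) - snd v * cnj (snd u)))"

definition rotated_coords :: "complex \<times> complex \<Rightarrow> complex \<times> complex" where
  "rotated_coords = (\<lambda>(z1, z2). ((z1 - cnj z2) / sqrt 2, (z2 + cnj z1) / sqrt 2))"

lemma rotated_coords_isometry: "norm (rotated_coords z) = norm z"
proof (cases z)
  case (Pair a b)
  have "(cmod (a - cnj b))\<^sup>2 + (cmod (b + cnj a))\<^sup>2 = 2 * ((cmod a)\<^sup>2 + (cmod b)\<^sup>2)"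
    unfolding cmod_power2 by (simp add: power2_eq_square algebra_simps)
  then have "((cmod (a - cnj b))\<^sup>2 + (cmod (b + cnj a))\<^sup>2) / 2 = (cmod a)\<^sup>2 + (cmod b)\<^sup>2"
    by simp
  then show ?thesis
    by (simp add: Pair rotated_coords_def norm_prod_def norm_divide power_divide
        flip: add_divide_distrib)
qed

lemma omega_rotated_coords:
  fixes u v :: "complex \<times> complex"
  defines "a \<equiv> rotated_coords u" and "b \<equiv> rotated_coords v"
  shows "omega u v = \<i> / 2 * ((fst a * snd b - fst b * snd a) - cnj (fst a * snd b - fst b * snd a))"
proof -
  have s: "complex_of_real (sqrt 2) * complex_of_real (sqrt 2) = 2"
    by (simp flip: of_real_mult)
  show ?thesis
    unfolding a_def b_def
    by (cases u, cases v) (simp add: omega_def rotated_coords_def s field_simps)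
qed

abbreviation unit_disk :: "complex set" where
  "unit_disk \<equiv> ball 0 1"

definition immersion_on :: "'a::euclidean_space set \<Rightarrow> ('a \<Rightarrow> 'b::euclidean_space) \<Rightarrow> bool" where
  "immersion_on S f \<longleftrightarrow> smooth_on S f \<and> (\<forall>p\<in>S. inj (frechet_derivative f (at p)))"

definition lagrangian_on :: "complex set \<Rightarrow> (complex \<Rightarrow> complex \<times> complex) \<Rightarrow> bool" where
  "lagrangian_on S f \<longleftrightarrow>
     (\<forall>p\<in>S. \<forall>u v. omega (frechet_derivative f (at p) u) (frechet_derivative f (at p) v) = 0)"

definition proper_lagrangian_disk :: "(complex \<Rightarrow> complex \<times> complex) \<Rightarrow> bool" where
  "proper_lagrangian_disk f \<longleftrightarrow>
     immersion_on unit_disk f \<and> proper_map (top_of_set unit_disk) euclidean f \<and>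
     lagrangian_on unit_disk f"

text \<open>The tangent space of the sphere of radius \<open>R > 0\<close> at \<open>x\<close> is the orthogonal complement
  of \<open>x\<close>.\<close>

definition transverse_to_sphere :: "(complex \<Rightarrow> complex \<times> complex) \<Rightarrow> real \<Rightarrow> bool" where
  "transverse_to_sphere f R \<longleftrightarrow>
     (\<forall>p\<in>unit_disk. f p \<in> sphere 0 R \<longrightarrow>
        {frechet_derivative f (at p) v + w | v w. w \<bullet> f p = 0} = UNIV)"

definition rescaled_slice :: "(complex \<times> complex) set \<Rightarrow> real \<Rightarrow> (complex \<times> complex) set" where
  "rescaled_slice L R = (\<lambda>x. (1 / R) *\<^sub>R rotated_coords x) ` (L \<inter> sphere 0 R)"

end

(* In the coordinates (a1, a2) a surface is Lagrangian iff Im (da1 wedge da2) vanishes on it. Over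
   a1 = w^m this means a2 m w^(m-1) = i (H_x - i H_y) for a real potential H. With rho = |a1| and
   phi = arg a1 one gets a2 = e^(-i phi) (H_phi + i rho H_rho) / rho, so the slices of the surface
   are described by the two derivatives of H. A potential g(phi) - c(phi) / rho^2 yields
   a2 / |a1| ~ rho^(-2) e^(-i phi) (g' + 2 i c / rho^2): here c is arbitrary and g' is arbitrary
   except for its mean, which must vanish. The different decay of the two parts does not matter,
   because a contraction of the fibres in two fixed directions is isotopic to the identity by
   linear interpolation, which also absorbs small errors.

   It remains to make the mean of Re (e^(i phi) z) small along each component of the given braid,
   so that it can be removed by a small perturbation. Moving the base circle by Moebius
   transformations concentrates all the braiding near one point of the circle; elsewhere the
   strands are almost constant, and e^(i phi) has mean zero. Approximating by polynomials
   (Stone-Weierstrass) makes g' and c smooth without any regularity of the parametrization of the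
   braid. *)

theory Submission
  imports Defs "HOL-Real_Asymp.Real_Asymp"
begin

section \<open>Iterated differentiability\<close>

text \<open>The obstacle is exactness: \<open>Im (a2 da1)\<close> is closed on a Lagrangian, hence
  exact on a disk, so the angular derivative of its potential must have mean zero, while no such
  condition restricts the radial derivative. With m the number of strands of a component, a1 = w^m
  makes circles in w cover the base circle m times; near the branch point the potential is changed
  so that a2 is an immersion there. The disks are built independently and may meet one another; only
  their slices at large radius must be disjoint. Disjointness is uniform: distinct strands over one
  base point have distance at least d, and one Moebius parameter b serves all components, so that
  strands over a common base point stay over a common base point during the isotopy. The rotation of
  the fibre by e^(i phi), made before real and imaginary parts are taken, depends on the base point
  alone and is thus the same for all strands over it. With epsilon = d / 20, errors of 5 epsilon in
  each of the two fibre directions cannot make strands collide.\<close>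

lemma Ck_on_subset: "Ck_on k S f \<Longrightarrow> T \<subseteq> S \<Longrightarrow> Ck_on k T f"
  by (induction k arbitrary: f) (auto intro: continuous_on_subset)

lemma Ck_on_Suc_imp: "Ck_on (Suc k) S f \<Longrightarrow> Ck_on k S f"
proof (induction k arbitrary: f)
  case 0
  then show ?case
    by (auto intro!: continuous_at_imp_continuous_on differentiable_imp_continuous_within)
next
  case (Suc k)
  from Suc.prems have "f differentiable at x" if "x \<in> S" for x
    using that by simp
  moreover have "Ck_on k S (\<lambda>x. frechet_derivative f (at x) v)" for v
    using Suc.prems by (intro Suc.IH) simp
  ultimately show ?case by simp
qed

lemma Ck_on_continuous: "Ck_on k S f \<Longrightarrow> continuous_on S f"
  by (induction k) (auto dest: Ck_on_Suc_imp simp del: Ck_on.simps(2))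

lemma Ck_on_cong:
  assumes "open S" "\<And>x. x \<in> S \<Longrightarrow> f x = g x"
  shows "Ck_on k S f \<longleftrightarrow> Ck_on k S g"
proof -
  have "Ck_on k S g" if "Ck_on k S f" "\<And>x. x \<in> S \<Longrightarrow> f x = g x" for f g :: "'a \<Rightarrow> 'b"
    using that
  proof (induction k arbitrary: f g)
    case 0
    then show ?case by (simp cong: continuous_on_cong)
  next
    case (Suc k)
    have D: "(g has_derivative frechet_derivative f (at x)) (at x)" if "x \<in> S" for x
    proof -
      have "(f has_derivative frechet_derivative f (at x)) (at x)"
        using Suc.prems(1) that frechet_derivative_works by auto
      then show ?thesis
        using has_derivative_transform_within_open[OF _ \<open>open S\<close> that] Suc.prems(2) by blast
    qed
    have "Ck_on k S (\<lambda>x. frechet_derivative g (at x) v)" for v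
    proof (rule Suc.IH)
      show "Ck_on k S (\<lambda>x. frechet_derivative f (at x) v)" using Suc.prems(1) by simp
      show "frechet_derivative f (at x) v = frechet_derivative g (at x) v" if "x \<in> S" for x
        using frechet_derivative_at[OF D[OF that]] by simp
    qed
    moreover have "g differentiable at x" if "x \<in> S" for x
      using D[OF that] differentiable_def by blast
    ultimately show ?case by simp
  qed
  from this[of f g] this[of g f] assms(2) show ?thesis by auto
qed

lemma Ck_on_local:
  assumes "\<And>x. x \<in> S \<Longrightarrow> \<exists>U. open U \<and> x \<in> U \<and> Ck_on k U f"
  shows "Ck_on k S f"
  using assms
proof (induction k arbitrary: f)
  case 0
  show ?case
    unfolding Ck_on.simps
  proof (rule continuous_at_imp_continuous_on, rule ballI)
    fix x assume "x \<in> S"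
    then obtain U where "open U" "x \<in> U" "continuous_on U f" using 0 by auto
    then show "isCont f x" by (simp add: continuous_on_eq_continuous_at)
  qed
next
  case (Suc k)
  have "f differentiable at x" if "x \<in> S" for x
    using Suc.prems[OF that] by auto
  moreover have "Ck_on k S (\<lambda>x. frechet_derivative f (at x) v)" for v
  proof (rule Suc.IH)
    fix x assume "x \<in> S"
    from Suc.prems[OF this] obtain U where "open U" "x \<in> U" "Ck_on (Suc k) U f" by blast
    then show "\<exists>U. open U \<and> x \<in> U \<and> Ck_on k U (\<lambda>x. frechet_derivative f (at x) v)" by auto
  qed
  ultimately show ?case by simp
qed

lemma Ck_on_SucI:
  assumes "open S" "\<And>x. x \<in> S \<Longrightarrow> (f has_derivative D x) (at x)"
    "\<And>v. Ck_on k S (\<lambda>x. D x v)"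
  shows "Ck_on (Suc k) S f"
proof -
  have "f differentiable at x" if "x \<in> S" for x
    using assms(2)[OF that] differentiable_def by blast
  moreover have "Ck_on k S (\<lambda>x. frechet_derivative f (at x) v)" for v
  proof -
    have "D x v = frechet_derivative f (at x) v" if "x \<in> S" for x
      using frechet_derivative_at[OF assms(2)[OF that]] by simp
    with Ck_on_cong[OF assms(1), of "\<lambda>x. D x v" "\<lambda>x. frechet_derivative f (at x) v" k] assms(3)[of v]
    show ?thesis by blast
  qed
  ultimately show ?thesis by simp
qed

lemma Ck_on_SucD:
  assumes "Ck_on (Suc k) S f"
  shows "\<And>x. x \<in> S \<Longrightarrow> (f has_derivative frechet_derivative f (at x)) (at x)"
    "\<And>v. Ck_on k S (\<lambda>x. frechet_derivative f (at x) v)"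
  using assms frechet_derivative_works by auto

lemma Ck_on_const: "Ck_on k S (\<lambda>x. c)"
  by (induction k arbitrary: c) auto

lemma Ck_on_bounded_linear_comp:
  assumes "open S" "bounded_linear L" "Ck_on k S f"
  shows "Ck_on k S (\<lambda>x. L (f x))"
  using assms(3)
proof (induction k arbitrary: f)
  case 0
  then show ?case
    by (simp add: bounded_linear.continuous_on[OF assms(2)])
next
  case (Suc k)
  note D = Ck_on_SucD[OF Suc.prems]
  show ?case
    by (rule Ck_on_SucI[where D = "\<lambda>x v. L (frechet_derivative f (at x) v)"])
      (use D assms Suc.IH in \<open>auto intro!: bounded_linear.has_derivative[OF assms(2)]\<close>)
qed

lemma Ck_on_id: "open S \<Longrightarrow> Ck_on k S (\<lambda>x. x)"
proof (cases k)
  case (Suc k)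
  then show "open S \<Longrightarrow> ?thesis"
    by (simp only:, intro Ck_on_SucI[where D = "\<lambda>x v. v"]) (auto simp: Ck_on_const)
qed auto

lemma Ck_on_add:
  assumes "open S" "Ck_on k S f" "Ck_on k S g"
  shows "Ck_on k S (\<lambda>x. f x + g x)"
  using assms(2,3)
proof (induction k arbitrary: f g)
  case 0
  then show ?case by (simp add: continuous_on_add)
next
  case (Suc k)
  show ?case
    by (rule Ck_on_SucI[OF assms(1), where D = "\<lambda>x v. frechet_derivative f (at x) v + frechet_derivative g (at x) v"])
      (use Ck_on_SucD[OF Suc.prems(1)] Ck_on_SucD[OF Suc.prems(2)] Suc.IH
        in \<open>auto intro!: has_derivative_add\<close>)
qed

lemma Ck_on_bilinear:
  assumes "open S" "bounded_bilinear B" "Ck_on k S f" "Ck_on k S g"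
  shows "Ck_on k S (\<lambda>x. B (f x) (g x))"
  using assms(3,4)
proof (induction k arbitrary: f g)
  case 0
  then show ?case by (simp add: bounded_bilinear.continuous_on[OF assms(2)])
next
  case (Suc k)
  show ?case
  proof (rule Ck_on_SucI[OF assms(1), where D = "\<lambda>x v. B (f x) (frechet_derivative g (at x) v) + B (frechet_derivative f (at x) v) (g x)"])
    fix x assume "x \<in> S"
    then show "((\<lambda>x. B (f x) (g x)) has_derivative (\<lambda>v. B (f x) (frechet_derivative g (at x) v) + B (frechet_derivative f (at x) v) (g x))) (at x)"
      using bounded_bilinear.FDERIV[OF assms(2) Ck_on_SucD(1)[OF Suc.prems(1)] Ck_on_SucD(1)[OF Suc.prems(2)]] by simp
  next
    fix v
    show "Ck_on k S (\<lambda>x. B (f x) (frechet_derivative g (at x) v) + B (frechet_derivative f (at x) v) (g x))"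
      by (intro Ck_on_add assms(1) Suc.IH Ck_on_SucD(2) Suc.prems Ck_on_Suc_imp[OF Suc.prems(1)] Ck_on_Suc_imp[OF Suc.prems(2)])
  qed
qed

lemma Ck_on_sum:
  assumes "open S" "finite I" "\<And>i. i \<in> I \<Longrightarrow> Ck_on k S (f i)"
  shows "Ck_on k S (\<lambda>x. \<Sum>i\<in>I. f i x)"
  using assms(2,3) by (induction I) (auto simp: Ck_on_const intro!: Ck_on_add assms(1))

lemma Ck_on_compose:
  assumes "open S" "open T" "g ` S \<subseteq> T" "Ck_on k T f" "Ck_on k S g"
  shows "Ck_on k S (\<lambda>x. f (g x))"
  using assms(4,5)
proof (induction k arbitrary: f)
  case 0
  then show ?case using assms(3) by (auto intro: continuous_on_compose2)
next
  case (Suc k)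
  note Df = Ck_on_SucD[OF Suc.prems(1)] and Dg = Ck_on_SucD[OF Suc.prems(2)]
  let ?g = "\<lambda>x. frechet_derivative g (at x)"
  let ?f = "\<lambda>x. frechet_derivative f (at x)"
  show ?case
  \<comment> \<open>The chain rule evaluates the derivative of \<open>f\<close> in the moving
    direction \<open>?g x v\<close>, while \<open>Ck_on\<close> controls fixed directions. Expanding
    that direction in \<open>Basis\<close> turns the derivative into a sum of products of C^k
    functions.\<close>
  proof (rule Ck_on_SucI[OF assms(1), where D = "\<lambda>x v. \<Sum>b\<in>Basis. (?g x v \<bullet> b) *\<^sub>R ?f (g x) b"])
    fix x assume x: "x \<in> S"
    then have gx: "g x \<in> T" using assms(3) by auto
    have "((\<lambda>x. f (g x)) has_derivative (\<lambda>v. ?f (g x) (?g x v))) (at x)"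
      using diff_chain_at[OF Dg(1)[OF x] Df(1)[OF gx]] by (simp add: o_def)
    moreover have "?f (g x) (?g x v) = (\<Sum>b\<in>Basis. (?g x v \<bullet> b) *\<^sub>R ?f (g x) b)" for v
    proof -
      have lin: "linear (?f (g x))" using Df(1)[OF gx] has_derivative_linear by blast
      have "?f (g x) (\<Sum>b\<in>Basis. (?g x v \<bullet> b) *\<^sub>R b) = (\<Sum>b\<in>Basis. (?g x v \<bullet> b) *\<^sub>R ?f (g x) b)"
        by (simp add: linear_sum[OF lin] linear_cmul[OF lin])
      then show ?thesis by (simp add: euclidean_representation)
    qed
    ultimately show "((\<lambda>x. f (g x)) has_derivative (\<lambda>v. \<Sum>b\<in>Basis. (?g x v \<bullet> b) *\<^sub>R ?f (g x) b)) (at x)"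
      by simp
  next
    fix v
    show "Ck_on k S (\<lambda>x. \<Sum>b\<in>Basis. (?g x v \<bullet> b) *\<^sub>R ?f (g x) b)"
      by (intro Ck_on_sum Ck_on_bilinear[OF _ bounded_bilinear_scaleR] assms(1) finite_Basis
          Ck_on_bounded_linear_comp[OF _ bounded_linear_inner_left] Dg Suc.IH Df Ck_on_Suc_imp[OF Suc.prems(2)])
  qed
qed

lemma Ck_on_Pair:
  assumes "open S" "Ck_on k S f" "Ck_on k S g"
  shows "Ck_on k S (\<lambda>x. (f x, g x))"
proof -
  have "Ck_on k S (\<lambda>x. (f x, 0) + (0, g x))"
    by (intro Ck_on_add assms Ck_on_bounded_linear_comp[where L = "\<lambda>x. (x, 0)"]
        Ck_on_bounded_linear_comp[where L = "\<lambda>x. (0, x)"] bounded_linear_Pair bounded_linear_ident bounded_linear_zero)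
  then show ?thesis by simp
qed

lemma Ck_on_inverse:
  fixes f :: "'a::euclidean_space \<Rightarrow> 'b::{euclidean_space, real_normed_field}"
  assumes "open S" "Ck_on k S f" "\<And>x. x \<in> S \<Longrightarrow> f x \<noteq> 0"
  shows "Ck_on k S (\<lambda>x. inverse (f x))"
  using assms(2)
proof (induction k)
  case 0
  then show ?case using assms(3) by (auto intro!: continuous_on_inverse)
next
  case (Suc k)
  let ?f = "\<lambda>x. frechet_derivative f (at x)"
  note D = Ck_on_SucD[OF Suc.prems]
  note IH = Suc.IH[OF Ck_on_Suc_imp[OF Suc.prems]]
  show ?case
  \<comment> \<open>The derivative contains \<open>inverse (f x)\<close> again, which is C^k by the
    induction hypothesis; this closes the induction.\<close>
  proof (rule Ck_on_SucI[OF assms(1), where D = "\<lambda>x v. - (inverse (f x) * ?f x v * inverse (f x))"])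
    show "((\<lambda>x. inverse (f x)) has_derivative (\<lambda>v. - (inverse (f x) * ?f x v * inverse (f x)))) (at x)"
      if "x \<in> S" for x
      using diff_chain_at[OF D(1)[OF that] has_derivative_inverse'[OF assms(3)[OF that]]] by (simp add: o_def)
    show "Ck_on k S (\<lambda>x. - (inverse (f x) * ?f x v * inverse (f x)))" for v
      by (intro Ck_on_bounded_linear_comp[OF assms(1) bounded_linear_minus[OF bounded_linear_ident]]
          Ck_on_bilinear[OF assms(1) bounded_bilinear_mult] IH D)
  qed
qed

section \<open>Smooth functions on open sets\<close>

lemma smooth_on_subset: "smooth_on S f \<Longrightarrow> T \<subseteq> S \<Longrightarrow> smooth_on T f"
  by (auto simp: smooth_on_def intro: Ck_on_subset)

lemma smooth_on_continuous: "smooth_on S f \<Longrightarrow> continuous_on S f"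
  by (auto simp: smooth_on_def dest: Ck_on_continuous)

lemma smooth_on_cong: "open S \<Longrightarrow> (\<And>x. x \<in> S \<Longrightarrow> f x = g x) \<Longrightarrow> smooth_on S f \<longleftrightarrow> smooth_on S g"
  using Ck_on_cong[of S f g] by (simp add: smooth_on_def)

lemma smooth_on_local:
  "(\<And>x. x \<in> S \<Longrightarrow> \<exists>U. open U \<and> x \<in> U \<and> smooth_on U f) \<Longrightarrow> smooth_on S f"
  unfolding smooth_on_def by (rule allI, rule Ck_on_local) blast

lemma smooth_on_const: "smooth_on S (\<lambda>x. c)"
  by (simp add: smooth_on_def Ck_on_const)

lemma smooth_on_id: "open S \<Longrightarrow> smooth_on S (\<lambda>x. x)"
  by (simp add: smooth_on_def Ck_on_id)

lemma smooth_on_bounded_linear_comp: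
  "open S \<Longrightarrow> bounded_linear L \<Longrightarrow> smooth_on S f \<Longrightarrow> smooth_on S (\<lambda>x. L (f x))"
  by (simp add: smooth_on_def Ck_on_bounded_linear_comp)

lemma smooth_on_add: "open S \<Longrightarrow> smooth_on S f \<Longrightarrow> smooth_on S g \<Longrightarrow> smooth_on S (\<lambda>x. f x + g x)"
  by (simp add: smooth_on_def Ck_on_add)

lemma smooth_on_minus: "open S \<Longrightarrow> smooth_on S f \<Longrightarrow> smooth_on S (\<lambda>x. - f x)"
  by (rule smooth_on_bounded_linear_comp[OF _ bounded_linear_minus[OF bounded_linear_ident]])

lemma smooth_on_diff: "open S \<Longrightarrow> smooth_on S f \<Longrightarrow> smooth_on S g \<Longrightarrow> smooth_on S (\<lambda>x. f x - g x)"
  using smooth_on_add[of S f "\<lambda>x. - g x"] smooth_on_minus by auto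

lemma smooth_on_bilinear:
  "open S \<Longrightarrow> bounded_bilinear B \<Longrightarrow> smooth_on S f \<Longrightarrow> smooth_on S g \<Longrightarrow> smooth_on S (\<lambda>x. B (f x) (g x))"
  by (simp add: smooth_on_def Ck_on_bilinear)

lemma smooth_on_mult:
  fixes f g :: "'a::euclidean_space \<Rightarrow> 'b::{euclidean_space, real_normed_algebra}"
  shows "open S \<Longrightarrow> smooth_on S f \<Longrightarrow> smooth_on S g \<Longrightarrow> smooth_on S (\<lambda>x. f x * g x)"
  by (rule smooth_on_bilinear[OF _ bounded_bilinear_mult])

lemma smooth_on_scaleR:
  "open S \<Longrightarrow> smooth_on S f \<Longrightarrow> smooth_on S g \<Longrightarrow> smooth_on S (\<lambda>x. f x *\<^sub>R g x)"
  by (rule smooth_on_bilinear[OF _ bounded_bilinear_scaleR])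

lemma smooth_on_inner:
  "open S \<Longrightarrow> smooth_on S f \<Longrightarrow> smooth_on S g \<Longrightarrow> smooth_on S (\<lambda>x. f x \<bullet> g x)"
  by (rule smooth_on_bilinear[OF _ bounded_bilinear_inner])

lemma smooth_on_power:
  fixes f :: "'a::euclidean_space \<Rightarrow> 'b::{euclidean_space, real_normed_algebra_1}"
  shows "open S \<Longrightarrow> smooth_on S f \<Longrightarrow> smooth_on S (\<lambda>x. f x ^ n)"
  by (induction n) (auto intro: smooth_on_const smooth_on_mult)

lemma smooth_on_inverse:
  fixes f :: "'a::euclidean_space \<Rightarrow> 'b::{euclidean_space, real_normed_field}"
  shows "open S \<Longrightarrow> smooth_on S f \<Longrightarrow> (\<And>x. x \<in> S \<Longrightarrow> f x \<noteq> 0) \<Longrightarrow> smooth_on S (\<lambda>x. inverse (f x))"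
  by (simp add: smooth_on_def Ck_on_inverse)

lemma smooth_on_divide:
  fixes f g :: "'a::euclidean_space \<Rightarrow> 'b::{euclidean_space, real_normed_field}"
  shows "open S \<Longrightarrow> smooth_on S f \<Longrightarrow> smooth_on S g \<Longrightarrow> (\<And>x. x \<in> S \<Longrightarrow> g x \<noteq> 0) \<Longrightarrow> smooth_on S (\<lambda>x. f x / g x)"
  unfolding divide_inverse by (intro smooth_on_mult smooth_on_inverse)

lemma smooth_on_compose:
  "open S \<Longrightarrow> open T \<Longrightarrow> g ` S \<subseteq> T \<Longrightarrow> smooth_on T f \<Longrightarrow> smooth_on S g \<Longrightarrow> smooth_on S (\<lambda>x. f (g x))"
  by (simp add: smooth_on_def Ck_on_compose)

lemma smooth_on_Pair:
  "open S \<Longrightarrow> smooth_on S f \<Longrightarrow> smooth_on S g \<Longrightarrow> smooth_on S (\<lambda>x. (f x, g x))"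
  by (simp add: smooth_on_def Ck_on_Pair)

lemma smooth_on_derivative:
  assumes "smooth_on S f"
  shows "\<And>x. x \<in> S \<Longrightarrow> (f has_derivative frechet_derivative f (at x)) (at x)"
    "\<And>v. smooth_on S (\<lambda>x. frechet_derivative f (at x) v)"
proof -
  have *: "Ck_on (Suc k) S f" for k using assms unfolding smooth_on_def by blast
  show "\<And>x. x \<in> S \<Longrightarrow> (f has_derivative frechet_derivative f (at x)) (at x)"
    using Ck_on_SucD(1)[OF *[of 0]] .
  show "\<And>v. smooth_on S (\<lambda>x. frechet_derivative f (at x) v)"
    unfolding smooth_on_def using Ck_on_SucD(2)[OF *] by blast
qed

lemma smooth_onI:
  assumes "open S" "\<And>x. x \<in> S \<Longrightarrow> (f has_derivative D x) (at x)" "\<And>v. smooth_on S (\<lambda>x. D x v)"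
  shows "smooth_on S f"
proof -
  have "Ck_on (Suc k) S f" for k
    by (rule Ck_on_SucI[OF assms(1,2)]) (use assms(3) in \<open>auto simp: smooth_on_def\<close>)
  then show ?thesis unfolding smooth_on_def using Ck_on_Suc_imp by blast
qed

lemmas smooth_on_intros = smooth_on_const smooth_on_id smooth_on_add smooth_on_minus smooth_on_diff
  smooth_on_mult smooth_on_scaleR smooth_on_inner smooth_on_power smooth_on_inverse smooth_on_divide smooth_on_Pair

section \<open>Smoothness of projections and elementary functions\<close>

lemma smooth_on_fst: "open S \<Longrightarrow> smooth_on S f \<Longrightarrow> smooth_on S (\<lambda>x. fst (f x))"
  by (rule smooth_on_bounded_linear_comp[OF _ bounded_linear_fst])

lemma smooth_on_snd: "open S \<Longrightarrow> smooth_on S f \<Longrightarrow> smooth_on S (\<lambda>x. snd (f x))"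
  by (rule smooth_on_bounded_linear_comp[OF _ bounded_linear_snd])

lemma smooth_on_Re: "open S \<Longrightarrow> smooth_on S f \<Longrightarrow> smooth_on S (\<lambda>x. Re (f x))"
  by (rule smooth_on_bounded_linear_comp[OF _ bounded_linear_Re])

lemma smooth_on_Im: "open S \<Longrightarrow> smooth_on S f \<Longrightarrow> smooth_on S (\<lambda>x. Im (f x))"
  by (rule smooth_on_bounded_linear_comp[OF _ bounded_linear_Im])

lemma smooth_on_cnj: "open S \<Longrightarrow> smooth_on S f \<Longrightarrow> smooth_on S (\<lambda>x. cnj (f x))"
  by (rule smooth_on_bounded_linear_comp[OF _ bounded_linear_cnj])

lemma smooth_on_of_real: "open S \<Longrightarrow> smooth_on S f \<Longrightarrow> smooth_on S (\<lambda>x. complex_of_real (f x))"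
  by (rule smooth_on_bounded_linear_comp[OF _ bounded_linear_of_real])

lemma smooth_on_powr: "smooth_on {0<..} (\<lambda>x::real. x powr a)"
proof -
  have "Ck_on k {0<..} (\<lambda>x::real. x powr a)" for k
  proof (induction k arbitrary: a)
    case 0
    then show ?case by (auto intro!: continuous_intros)
  next
    case (Suc k)
    show ?case
    proof (rule Ck_on_SucI[where D = "\<lambda>x v. (a * v) * (x powr (a - 1))"])
      fix x :: real assume "x \<in> {0<..}"
      then show "((\<lambda>x. x powr a) has_derivative (\<lambda>v. (a * v) * (x powr (a - 1)))) (at x)"
        using has_real_derivative_powr[of x a] unfolding has_field_derivative_def
        by (auto elim!: has_derivative_eq_rhs)
    next
      show "Ck_on k {0<..} (\<lambda>x. (a * v) * (x powr (a - 1)))" for v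
        by (rule Ck_on_bounded_linear_comp[OF _ bounded_linear_mult_right Suc.IH]) simp
    qed simp
  qed
  then show ?thesis by (simp add: smooth_on_def)
qed

lemma smooth_on_powr': "open S \<Longrightarrow> smooth_on S f \<Longrightarrow> (\<And>x. x \<in> S \<Longrightarrow> 0 < f x) \<Longrightarrow> smooth_on S (\<lambda>x. f x powr (a::real))"
  by (rule smooth_on_compose[OF _ _ _ smooth_on_powr]) auto

lemma smooth_on_sqrt: "open S \<Longrightarrow> smooth_on S f \<Longrightarrow> (\<And>x. x \<in> S \<Longrightarrow> 0 < f x) \<Longrightarrow> smooth_on S (\<lambda>x. sqrt (f x))"
  using smooth_on_powr'[of S f "1/2"] smooth_on_cong[of S "\<lambda>x. f x powr (1/2)" "\<lambda>x. sqrt (f x)"]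
  by (simp add: powr_half_sqrt less_imp_le)

lemma smooth_on_norm:
  assumes "open S" "smooth_on S f" "\<And>x. x \<in> S \<Longrightarrow> f x \<noteq> 0"
  shows "smooth_on S (\<lambda>x. norm (f x))"
  unfolding norm_eq_sqrt_inner
  by (intro smooth_on_sqrt smooth_on_inner assms) (use assms(3) in auto)

lemma smooth_on_exp: "smooth_on UNIV (exp :: 'a::{euclidean_space, real_normed_field, banach} \<Rightarrow> 'a)"
proof -
  have "Ck_on k UNIV (exp :: 'a \<Rightarrow> 'a)" for k
  proof (induction k)
    case 0
    then show ?case by (simp add: continuous_on_exp continuous_on_id)
  next
    case (Suc k)
    show ?case
    proof (rule Ck_on_SucI[where D = "\<lambda>x v. v * exp x"])
      show "(exp has_derivative (\<lambda>v. v * exp x)) (at x)" for x :: 'a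
        using DERIV_exp[of x] unfolding has_field_derivative_def by (auto elim!: has_derivative_eq_rhs)
      show "Ck_on k UNIV (\<lambda>x::'a. v * exp x)" for v
        by (rule Ck_on_bounded_linear_comp[OF _ bounded_linear_mult_right Suc.IH]) simp
    qed simp
  qed
  then show ?thesis by (simp add: smooth_on_def)
qed

lemma smooth_on_exp': "open S \<Longrightarrow> smooth_on S f \<Longrightarrow> smooth_on S (\<lambda>x. exp (f x :: 'a::{euclidean_space, real_normed_field, banach}))"
  by (rule smooth_on_compose[OF _ open_UNIV _ smooth_on_exp]) auto

lemma smooth_on_Ln: "smooth_on (- \<real>\<^sub>\<le>\<^sub>0) Ln"
proof (rule smooth_onI[where D = "\<lambda>x v. v * inverse x"])
  show "open (- \<real>\<^sub>\<le>\<^sub>0 :: complex set)" by (simp add: open_Compl)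
  show "(Ln has_derivative (\<lambda>v. v * inverse x)) (at x)" if "x \<in> - \<real>\<^sub>\<le>\<^sub>0" for x
    using has_field_derivative_Ln[of x] that unfolding has_field_derivative_def by (auto elim!: has_derivative_eq_rhs)
  show "smooth_on (- \<real>\<^sub>\<le>\<^sub>0) (\<lambda>x::complex. v * inverse x)" for v
    by (intro smooth_on_intros) (auto simp: open_Compl)
qed

section \<open>A smooth step function\<close>

text \<open>\<open>exp (- 1 / x)\<close> extended by \<open>0\<close>; the factors \<open>x\<^sup>-\<^sup>n\<close> make the family closed under differentiation.\<close>

definition flat :: "nat \<Rightarrow> real \<Rightarrow> real" where
  "flat n x = (if 0 < x then inverse x ^ n * exp (- inverse x) else 0)"

text \<open>Only one term of the exponential series is kept:
  \<open>t ^ (n + 2) / fact (n + 2) \<le> exp t\<close> at \<open>t = 1 / x\<close>. The two extra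
  powers leave a quadratic bound, which makes the difference quotient at 0 tend to 0 for every
  \<open>n\<close>.\<close>

lemma flat_bound: "\<bar>flat n x\<bar> \<le> fact (n + 2) * x\<^sup>2"
proof (cases "0 < x")
  case True
  let ?t = "inverse x"
  have t: "?t > 0" using True by simp
  have "?t ^ (n + 2) / fact (n + 2) \<le> exp ?t"
  proof -
    have "(\<Sum>k\<in>{n + 2}. ?t ^ k /\<^sub>R fact k) \<le> (\<Sum>k. ?t ^ k /\<^sub>R fact k)"
      by (rule sum_le_suminf) (use t exp_converges[of ?t] in \<open>auto simp: sums_iff\<close>)
    then show ?thesis using exp_converges[of ?t] by (simp add: sums_iff field_simps)
  qed
  then have "?t ^ (n + 2) \<le> fact (n + 2) * exp ?t"
    unfolding pos_divide_le_eq[OF fact_gt_zero] by (simp only: mult.commute)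
  then have "?t ^ (n + 2) * exp (- ?t) \<le> fact (n + 2)"
    using mult_right_mono[of "?t ^ (n + 2)" "fact (n + 2) * exp ?t" "exp (- ?t)"]
    by (simp add: mult.assoc mult_exp_exp del: fact_Suc)
  then have "?t ^ (n + 2) * exp (- ?t) * x\<^sup>2 \<le> fact (n + 2) * x\<^sup>2"
    by (rule mult_right_mono) simp
  moreover have "?t ^ (n + 2) * exp (- ?t) * x\<^sup>2 = flat n x"
    using True by (simp add: flat_def power_add field_simps power2_eq_square)
  moreover have "0 \<le> flat n x" using True by (simp add: flat_def)
  ultimately show ?thesis by simp
qed (simp add: flat_def)

lemma has_real_derivative_flat:
  "(flat n has_real_derivative flat (n + 2) x - real n * flat (n + 1) x) (at x)"
proof -
  consider "x < 0" | "x = 0" | "0 < x" by linarith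
  then show ?thesis
  proof cases
    case 1
    have "((\<lambda>_. 0) has_real_derivative 0) (at x)" by simp
    then have "(flat n has_real_derivative 0) (at x)"
      by (rule has_field_derivative_transform_within_open[where S = "{..<0}"]) (use 1 in \<open>auto simp: flat_def\<close>)
    then show ?thesis using 1 by (simp add: flat_def)
  next
    case 2
    have "((\<lambda>h. (flat n h - flat n 0) / h) \<longlongrightarrow> 0) (at 0)"
    proof (rule Lim_null_comparison)
      show "\<forall>\<^sub>F h in at 0. norm ((flat n h - flat n 0) / h) \<le> fact (n + 2) * \<bar>h\<bar>"
      proof (rule eventually_at_ball'[of 1, THEN eventually_mono])
        fix h :: real assume "h \<in> ball 0 1 \<and> h \<noteq> 0 \<and> h \<in> UNIV"
        then show "norm ((flat n h - flat n 0) / h) \<le> fact (n + 2) * \<bar>h\<bar>"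
          using flat_bound[of n h] by (simp add: flat_def abs_divide divide_le_eq power2_eq_square mult.assoc)
      qed simp
      show "((\<lambda>h. fact (n + 2) * \<bar>h\<bar>) \<longlongrightarrow> (0::real)) (at 0)"
        by (auto intro!: tendsto_eq_intros)
    qed
    then show ?thesis using 2 by (simp add: has_field_derivative_iff flat_def)
  next
    case 3
    have "((\<lambda>x. inverse x ^ n * exp (- inverse x)) has_real_derivative
        inverse x ^ n * (exp (- inverse x) * (inverse x * inverse x)) +
        (real n * (- (inverse x * inverse x) * inverse x ^ (n - 1))) * exp (- inverse x)) (at x)"
      using 3 by (auto intro!: derivative_eq_intros simp: mult_ac)
    also have "inverse x ^ n * (exp (- inverse x) * (inverse x * inverse x)) +
        (real n * (- (inverse x * inverse x) * inverse x ^ (n - 1))) * exp (- inverse x) =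
        flat (n + 2) x - real n * flat (n + 1) x"
      using 3 by (cases n) (simp_all add: flat_def mult_ac)
    finally have "((\<lambda>x. inverse x ^ n * exp (- inverse x)) has_real_derivative
        flat (n + 2) x - real n * flat (n + 1) x) (at x)" .
    then show ?thesis
      by (rule has_field_derivative_transform_within_open[where S = "{0<..}"]) (use 3 in \<open>auto simp: flat_def\<close>)
  qed
qed

lemma smooth_on_flat: "smooth_on UNIV (flat n)"
proof -
  have "Ck_on k UNIV (flat n)" for k
  proof (induction k arbitrary: n)
    case 0
    show ?case
      using has_real_derivative_flat by (auto intro!: DERIV_continuous_on)
  next
    case (Suc k)
    show ?case
    proof (rule Ck_on_SucI[where D = "\<lambda>x v. v * flat (n + 2) x + (- v * real n) * flat (n + 1) x"])
      show "(flat n has_derivative (\<lambda>v. v * flat (n + 2) x + (- v * real n) * flat (n + 1) x)) (at x)" for x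
        using has_real_derivative_flat[of n x] unfolding has_field_derivative_def
        by (rule has_derivative_eq_rhs) (simp add: fun_eq_iff algebra_simps)
      show "Ck_on k UNIV (\<lambda>x. v * flat (n + 2) x + (- v * real n) * flat (n + 1) x)" for v
        by (intro Ck_on_add Ck_on_bounded_linear_comp[OF _ bounded_linear_mult_right] Suc.IH open_UNIV)
    qed simp
  qed
  then show ?thesis by (simp add: smooth_on_def)
qed

definition smooth_step :: "real \<Rightarrow> real" where
  "smooth_step x = flat 0 x / (flat 0 x + flat 0 (1 - x))"

lemma smooth_step_0: "x \<le> 0 \<Longrightarrow> smooth_step x = 0"
  by (simp add: smooth_step_def flat_def)

lemma smooth_step_1: "1 \<le> x \<Longrightarrow> smooth_step x = 1"
  by (simp add: smooth_step_def flat_def)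

lemma smooth_on_smooth_step: "smooth_on UNIV smooth_step"
proof -
  have "smooth_on UNIV (\<lambda>x. flat 0 (1 - x))"
    by (rule smooth_on_compose[OF _ open_UNIV _ smooth_on_flat]) (auto intro!: smooth_on_intros)
  \<comment> \<open>\<open>x\<close> and \<open>1 - x\<close> are never both nonpositive, so at
    least one of the two nonnegative summands is positive.\<close>
  moreover have "flat 0 x + flat 0 (1 - x) \<noteq> 0" for x
    by (smt (verit) flat_def exp_gt_zero mult_pos_pos power_0 zero_less_one)
  ultimately show ?thesis
    unfolding smooth_step_def[abs_def] by (intro smooth_on_intros smooth_on_flat) auto
qed

section \<open>Symmetry of second derivatives\<close>

text \<open>The second difference over a parallelogram is symmetric in \<open>u\<close> and
  \<open>v\<close>, and two applications of the mean value theorem turn it into \<open>h * h\<close>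
  times a mixed derivative at some point of the parallelogram. Comparing the two orders as
  \<open>h\<close> shrinks gives the symmetry of mixed derivatives.\<close>

lemma second_difference_mvt:
  fixes f :: "'a::euclidean_space \<Rightarrow> real"
  assumes S: "smooth_on S f" and h: "0 < h"
    and sub: "\<And>s t. 0 \<le> s \<Longrightarrow> s \<le> h \<Longrightarrow> 0 \<le> t \<Longrightarrow> t \<le> h \<Longrightarrow> x + s *\<^sub>R u + t *\<^sub>R v \<in> S"
  shows "\<exists>s t. 0 \<le> s \<and> s \<le> h \<and> 0 \<le> t \<and> t \<le> h \<and>
    f (x + h *\<^sub>R u + h *\<^sub>R v) - f (x + h *\<^sub>R u) - f (x + h *\<^sub>R v) + f x =
    h * (h * frechet_derivative (\<lambda>y. frechet_derivative f (at y) u) (at (x + s *\<^sub>R u + t *\<^sub>R v)) v)"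
proof -
  let ?A = "\<lambda>y. frechet_derivative f (at y) u"
  have SA: "smooth_on S ?A" using smooth_on_derivative(2)[OF S] .
  have dir: "((\<lambda>s. F (a + s *\<^sub>R w)) has_real_derivative frechet_derivative F (at (a + s *\<^sub>R w)) w) (at s)"
    if "smooth_on S F" "a + s *\<^sub>R w \<in> S" for F :: "'a \<Rightarrow> real" and a w s
  proof -
    have "((\<lambda>s. F (a + s *\<^sub>R w)) has_derivative (\<lambda>r. frechet_derivative F (at (a + s *\<^sub>R w)) (r *\<^sub>R w))) (at s)"
    proof -
      have "((\<lambda>s. a + s *\<^sub>R w) has_derivative (\<lambda>r. r *\<^sub>R w)) (at s)"
        by (auto intro!: derivative_eq_intros)
      from diff_chain_at[OF this smooth_on_derivative(1)[OF that]] show ?thesis by (simp add: o_def)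
    qed
    moreover have "frechet_derivative F (at (a + s *\<^sub>R w)) (r *\<^sub>R w) = r * frechet_derivative F (at (a + s *\<^sub>R w)) w" for r
      using linear_cmul[OF has_derivative_linear[OF smooth_on_derivative(1)[OF that]]] by simp
    ultimately show ?thesis
      unfolding has_field_derivative_def by (auto elim!: has_derivative_eq_rhs)
  qed
  have "\<exists>s>0. s < h \<and> (f (x + h *\<^sub>R v + h *\<^sub>R u) - f (x + h *\<^sub>R u)) - (f (x + h *\<^sub>R v + 0 *\<^sub>R u) - f (x + 0 *\<^sub>R u)) =
      (h - 0) * (?A (x + h *\<^sub>R v + s *\<^sub>R u) - ?A (x + s *\<^sub>R u))"
  proof (rule MVT2[OF h])
    fix s assume "0 \<le> s" "s \<le> h"
    then have "x + h *\<^sub>R v + s *\<^sub>R u \<in> S" "x + s *\<^sub>R u \<in> S"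
      using sub[of s h] sub[of s 0] h by (auto simp: algebra_simps)
    then show "((\<lambda>s. f (x + h *\<^sub>R v + s *\<^sub>R u) - f (x + s *\<^sub>R u)) has_real_derivative
        ?A (x + h *\<^sub>R v + s *\<^sub>R u) - ?A (x + s *\<^sub>R u)) (at s)"
      by (intro DERIV_diff dir S)
  qed
  then obtain s where s: "0 < s" "s < h" and
    1: "(f (x + h *\<^sub>R v + h *\<^sub>R u) - f (x + h *\<^sub>R u)) - (f (x + h *\<^sub>R v) - f x) =
      h * (?A (x + h *\<^sub>R v + s *\<^sub>R u) - ?A (x + s *\<^sub>R u))" by auto
  have "\<exists>t>0. t < h \<and> ?A (x + s *\<^sub>R u + h *\<^sub>R v) - ?A (x + s *\<^sub>R u + 0 *\<^sub>R v) =
      (h - 0) * frechet_derivative ?A (at (x + s *\<^sub>R u + t *\<^sub>R v)) v"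
    using sub s by (intro MVT2[OF h] dir SA) auto
  then obtain t where "0 < t" "t < h" and
    2: "?A (x + s *\<^sub>R u + h *\<^sub>R v) - ?A (x + s *\<^sub>R u) =
      h * frechet_derivative ?A (at (x + s *\<^sub>R u + t *\<^sub>R v)) v" by auto
  show ?thesis
  proof (intro exI conjI)
    show "f (x + h *\<^sub>R u + h *\<^sub>R v) - f (x + h *\<^sub>R u) - f (x + h *\<^sub>R v) + f x =
      h * (h * frechet_derivative (\<lambda>y. frechet_derivative f (at y) u) (at (x + s *\<^sub>R u + t *\<^sub>R v)) v)"
      using 1 unfolding 2[symmetric] by (simp add: add.commute add.left_commute add.assoc)
  qed (use s \<open>0 < t\<close> \<open>t < h\<close> in auto)
qed

lemma frechet_derivative_commute:
  fixes f :: "'a::euclidean_space \<Rightarrow> real"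
  assumes S: "smooth_on S f" "open S" "x \<in> S"
  shows "frechet_derivative (\<lambda>y. frechet_derivative f (at y) u) (at x) v =
    frechet_derivative (\<lambda>y. frechet_derivative f (at y) v) (at x) u"
proof -
  let ?D = "\<lambda>u v x. frechet_derivative (\<lambda>y. frechet_derivative f (at y) u) (at x) v"
  have cont: "continuous (at x) (?D u v)" for u v
    using smooth_on_continuous[OF smooth_on_derivative(2)[OF smooth_on_derivative(2)[OF S(1)]]] S
    by (simp add: continuous_on_eq_continuous_at)
  have "\<bar>?D u v x - ?D v u x\<bar> < e" if "e > 0" for e
  proof -
    obtain d1 where d1: "d1 > 0" "\<And>y. dist y x < d1 \<Longrightarrow> dist (?D u v y) (?D u v x) < e / 2"
      using cont[of u v] \<open>e > 0\<close> unfolding continuous_at_eps_delta dist_norm by (meson half_gt_zero)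
    obtain d2 where d2: "d2 > 0" "\<And>y. dist y x < d2 \<Longrightarrow> dist (?D v u y) (?D v u x) < e / 2"
      using cont[of v u] \<open>e > 0\<close> unfolding continuous_at_eps_delta dist_norm by (meson half_gt_zero)
    obtain d3 where d3: "d3 > 0" "\<And>y. dist y x < d3 \<Longrightarrow> y \<in> S"
      using S(2,3) unfolding open_dist by metis
    define d where "d = min d1 (min d2 d3)"
    \<comment> \<open>The parallelogram spanned by \<open>h *\<^sub>R u\<close> and
      \<open>h *\<^sub>R v\<close> stays within \<open>d / 2\<close> of \<open>x\<close>; the
      summand 1 keeps the denominator positive when \<open>u\<close> and \<open>v\<close>
      vanish.\<close>
    define h where "h = d / (2 * (1 + norm u + norm v))"
    have pos: "1 + norm u + norm v > 0" by (smt (verit) norm_ge_zero)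
    have d: "d > 0" using d1 d2 d3 by (simp add: d_def)
    then have h: "h > 0" using pos by (simp add: h_def)
    have near: "dist (x + s *\<^sub>R u + t *\<^sub>R v) x < d" if "0 \<le> s" "s \<le> h" "0 \<le> t" "t \<le> h" for s t
    proof -
      have "norm (s *\<^sub>R u + t *\<^sub>R v) \<le> s * norm u + t * norm v"
        using norm_triangle_ineq[of "s *\<^sub>R u" "t *\<^sub>R v"] that by simp
      also have "\<dots> \<le> h * norm u + h * norm v" using that by (intro add_mono mult_right_mono) auto
      also have "\<dots> \<le> h * (1 + norm u + norm v)" using h by (simp add: algebra_simps)
      also have "\<dots> = d / 2" using pos by (simp add: h_def field_simps)
      also have "\<dots> < d" using d by simp
      finally show ?thesis by (simp add: dist_norm add.assoc)
    qed
    have near': "dist (x + t *\<^sub>R v + s *\<^sub>R u) x < d" if "0 \<le> s" "s \<le> h" "0 \<le> t" "t \<le> h" for s t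
      using near[OF that] by (simp add: algebra_simps)
    have S1: "x + s *\<^sub>R u + t *\<^sub>R v \<in> S" "x + t *\<^sub>R v + s *\<^sub>R u \<in> S" if "0 \<le> s" "s \<le> h" "0 \<le> t" "t \<le> h" for s t
      using near[OF that] near'[OF that] by (auto intro!: d3 simp: d_def)
    obtain s t where 1: "0 \<le> s" "s \<le> h" "0 \<le> t" "t \<le> h" and
      e1: "f (x + h *\<^sub>R u + h *\<^sub>R v) - f (x + h *\<^sub>R u) - f (x + h *\<^sub>R v) + f x = h * (h * ?D u v (x + s *\<^sub>R u + t *\<^sub>R v))"
      using second_difference_mvt[OF S(1) h, of x u v] S1 by blast
    obtain s' t' where 2: "0 \<le> s'" "s' \<le> h" "0 \<le> t'" "t' \<le> h" and
      e2: "f (x + h *\<^sub>R v + h *\<^sub>R u) - f (x + h *\<^sub>R v) - f (x + h *\<^sub>R u) + f x = h * (h * ?D v u (x + s' *\<^sub>R v + t' *\<^sub>R u))"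
      using second_difference_mvt[OF S(1) h, of x v u] S1 by blast
    have "x + h *\<^sub>R v + h *\<^sub>R u = x + h *\<^sub>R u + h *\<^sub>R v" by (simp add: algebra_simps)
    then have "h * (h * ?D u v (x + s *\<^sub>R u + t *\<^sub>R v)) = h * (h * ?D v u (x + s' *\<^sub>R v + t' *\<^sub>R u))"
      using e1 e2 by (simp only:)
    then have eq: "?D u v (x + s *\<^sub>R u + t *\<^sub>R v) = ?D v u (x + s' *\<^sub>R v + t' *\<^sub>R u)" using h by simp
    have d1': "dist (?D u v (x + s *\<^sub>R u + t *\<^sub>R v)) (?D u v x) < e / 2"
      using near[OF 1] by (intro d1) (simp add: d_def)
    have d2': "dist (?D v u (x + s' *\<^sub>R v + t' *\<^sub>R u)) (?D v u x) < e / 2"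
      using near'[OF 2(3,4,1,2)] by (intro d2) (simp add: d_def)
    show ?thesis
      using d1' d2' unfolding eq dist_real_def by linarith
  qed
  \<comment> \<open>With the gap itself as the tolerance, a positive gap would be smaller than
    itself.\<close>
  from this[of "\<bar>?D u v x - ?D v u x\<bar>"] show ?thesis by force
qed

section \<open>Smooth inverse functions\<close>

text \<open>Openness of the image is invariance of domain. Cramer's rule writes the derivative of
  the inverse through the columns \<open>p\<close> and \<open>q\<close>, as a smooth function
  composed with the inverse itself; hence C^k for the inverse yields C^(k+1).\<close>

lemma smooth_on_inverse_function:
  fixes T :: "complex \<Rightarrow> complex"
  assumes U: "open U" and T: "smooth_on U T" and inj: "inj_on T U"
    and D: "\<And>x. x \<in> U \<Longrightarrow> inj (frechet_derivative T (at x))"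
  shows "open (T ` U)" "smooth_on (T ` U) (inv_into U T)"
proof -
  show op: "open (T ` U)"
    using invariance_of_domain[OF smooth_on_continuous[OF T] U inj] .
  let ?g = "inv_into U T"
  define p q where "p x = frechet_derivative T (at x) 1" and "q x = frechet_derivative T (at x) \<i>" for x
  let ?d = "\<lambda>x. Re (p x) * Im (q x) - Im (p x) * Re (q x)"
  let ?E = "\<lambda>x u. complex_of_real ((Re u * Im (q x) - Im u * Re (q x)) / ?d x) +
    \<i> * complex_of_real ((Re (p x) * Im u - Im (p x) * Re u) / ?d x)"
  have form: "frechet_derivative T (at x) v = of_real (Re v) * p x + of_real (Im v) * q x" if "x \<in> U" for x v
  proof -
    have l: "linear (frechet_derivative T (at x))"
      using has_derivative_linear[OF smooth_on_derivative(1)[OF T that]] .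
    have "frechet_derivative T (at x) (Re v *\<^sub>R 1 + Im v *\<^sub>R \<i>) = Re v *\<^sub>R p x + Im v *\<^sub>R q x"
      by (simp add: linear_add[OF l] linear_cmul[OF l] p_def q_def del: scaleR_conv_of_real)
    moreover have "Re v *\<^sub>R 1 + Im v *\<^sub>R \<i> = v" by (simp add: complex_eq_iff)
    ultimately show ?thesis by (simp add: scaleR_conv_of_real)
  qed
  have det: "?d x \<noteq> 0" if x: "x \<in> U" for x
  proof
    assume 0: "?d x = 0"
    let ?D = "frechet_derivative T (at x)"
    have D0: "?D v = 0 \<Longrightarrow> v = 0" for v
      using injD[OF D[OF x], of v 0] form[OF x, of 0] by simp
    \<comment> \<open>When the determinant vanishes, the columns of the adjugate matrix (up to sign)
      lie in the kernel.\<close>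
    have "?D (Complex (Im (q x)) (- Im (p x))) = 0" "?D (Complex (Re (q x)) (- Re (p x))) = 0"
      using 0 unfolding form[OF x] complex_eq_iff by (auto simp: algebra_simps)
    then have "Complex (Im (q x)) (- Im (p x)) = 0" "Complex (Re (q x)) (- Re (p x)) = 0"
      using D0 by blast+
    then have "p x = 0" by (simp add: complex_eq_iff)
    then show False using D0[of 1] by (simp add: p_def)
  qed
  have E: "(?g has_derivative ?E (?g y)) (at y)" if "y \<in> T ` U" for y
  proof -
    let ?x = "?g y"
    have x: "?x \<in> U" "T ?x = y" using that by (auto intro: inv_into_into f_inv_into_f)
    have "(?g has_derivative ?E ?x) (at (T ?x))"
    proof (rule has_derivative_inverse_strong[OF U x(1) smooth_on_continuous[OF T]])
      show "?g (T z) = z" if "z \<in> U" for z using inj that by simp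
      show "(T has_derivative frechet_derivative T (at ?x)) (at ?x)" using smooth_on_derivative(1)[OF T x(1)] .
      have "frechet_derivative T (at ?x) (?E ?x u) = u" for u
        unfolding form[OF x(1)] complex_eq_iff using det[OF x(1)]
        by (simp add: add_divide_distrib[symmetric] diff_divide_distrib[symmetric] divide_eq_eq) (simp add: algebra_simps)
      then show "frechet_derivative T (at ?x) \<circ> ?E ?x = id" by (auto simp: fun_eq_iff)
    qed
    then show ?thesis using x by simp
  qed
  have SE: "smooth_on U (\<lambda>x. ?E x u)" for u
    unfolding p_def q_def
    by (intro smooth_on_intros smooth_on_of_real smooth_on_Re smooth_on_Im smooth_on_derivative(2)[OF T] U
        det[unfolded p_def q_def])
  have "Ck_on k (T ` U) ?g" for k
  proof (induction k)
    case 0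
    show ?case
      unfolding Ck_on.simps
      by (intro continuous_at_imp_continuous_on ballI) (rule has_derivative_continuous[OF E])
  next
    case (Suc k)
    show ?case
    proof (rule Ck_on_SucI[OF op E])
      fix u
      show "Ck_on k (T ` U) (\<lambda>y. ?E (?g y) u)"
        by (rule Ck_on_compose[OF op U _ _ Suc.IH]) (use SE[of u] in \<open>auto simp: smooth_on_def inv_into_into\<close>)
    qed
  qed
  then show "smooth_on (T ` U) ?g" by (simp add: smooth_on_def)
qed

section \<open>Smooth maps on arbitrary subsets\<close>

lemma smooth_mapI: "open U \<Longrightarrow> X \<subseteq> U \<Longrightarrow> smooth_on U f \<Longrightarrow> smooth_map X f"
  unfolding smooth_map_def by blast

lemma smooth_mapD:
  assumes "smooth_map X f" "x \<in> X"
  obtains U F where "open U" "x \<in> U" "smooth_on U F" "\<forall>y\<in>X. y \<in> U \<longrightarrow> F y = f y"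
  using assms unfolding smooth_map_def by auto

lemma smooth_map_def':
  "smooth_map X f \<longleftrightarrow>
     (\<forall>x\<in>X. \<exists>U F. open U \<and> x \<in> U \<and> smooth_on U F \<and> (\<forall>y. y \<in> X \<longrightarrow> y \<in> U \<longrightarrow> F y = f y))"
  unfolding smooth_map_def by (simp add: Ball_def Int_iff imp_conjL)

lemma smooth_map_subset:
  assumes "smooth_map X f" "Y \<subseteq> X"
  shows "smooth_map Y f"
  unfolding smooth_map_def'
proof
  fix x assume "x \<in> Y"
  then have "x \<in> X" using assms(2) by blast
  obtain U F where "open U" "x \<in> U" "smooth_on U F" "\<forall>y\<in>X. y \<in> U \<longrightarrow> F y = f y"
    by (rule smooth_mapD[OF assms(1) \<open>x \<in> X\<close>])
  then show "\<exists>U F. open U \<and> x \<in> U \<and> smooth_on U F \<and> (\<forall>y. y \<in> Y \<longrightarrow> y \<in> U \<longrightarrow> F y = f y)"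
    using assms(2) by (intro exI[of _ U] exI[of _ F]) auto
qed

lemma smooth_map_cong:
  assumes "smooth_map X f" "\<And>x. x \<in> X \<Longrightarrow> f x = g x"
  shows "smooth_map X g"
  using assms(1) unfolding smooth_map_def' by (simp add: assms(2))

lemma smooth_map_local:
  assumes "\<And>x. x \<in> X \<Longrightarrow> \<exists>V. open V \<and> x \<in> V \<and> smooth_map (X \<inter> V) f"
  shows "smooth_map X f"
  unfolding smooth_map_def
proof
  fix x assume x: "x \<in> X"
  then obtain V where V: "open V" "x \<in> V" "smooth_map (X \<inter> V) f" using assms by blast
  obtain U F where U: "open U" "x \<in> U" "smooth_on U F" "\<forall>y\<in>X \<inter> V. y \<in> U \<longrightarrow> F y = f y"
    by (rule smooth_mapD[OF V(3), of x]) (use x V(2) in auto)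
  show "\<exists>U F. open U \<and> x \<in> U \<and> smooth_on U F \<and> (\<forall>y\<in>X \<inter> U. F y = f y)"
    using U V x by (intro exI[of _ "U \<inter> V"] exI[of _ F]) (auto intro: smooth_on_subset)
qed

lemma smooth_map_imp_continuous_on: 
  assumes "smooth_map X f" shows "continuous_on X f"
  unfolding continuous_on_eq_continuous_within
proof
  fix x assume x: "x \<in> X"
  obtain U F where U: "open U" "x \<in> U" "smooth_on U F" "\<forall>y\<in>X. y \<in> U \<longrightarrow> F y = f y"
    by (rule smooth_mapD[OF assms x])
  have "isCont F x"
    using smooth_on_continuous[OF U(3)] U(1,2) by (simp add: continuous_on_eq_continuous_at)
  then have "(F \<longlongrightarrow> f x) (at x within X)"
    using U(4)[rule_format, OF x U(2)] continuous_at_imp_continuous_at_within[of x F X] by (simp add: continuous_within)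
  moreover have "\<forall>\<^sub>F y in at x within X. F y = f y"
    using U(1,2,4) unfolding eventually_at_topological by blast
  ultimately show "continuous (at x within X) f"
    unfolding continuous_within by (rule Lim_transform_eventually)
qed

lemma smooth_map_compose:
  assumes g: "smooth_map X g" and f: "smooth_map Y f" and sub: "g ` X \<subseteq> Y"
  shows "smooth_map X (\<lambda>x. f (g x))"
  unfolding smooth_map_def
proof
  fix x assume x: "x \<in> X"
  obtain U G where U: "open U" "x \<in> U" "smooth_on U G" "\<forall>y\<in>X. y \<in> U \<longrightarrow> G y = g y"
    by (rule smooth_mapD[OF g x])
  have "g x \<in> Y" using x sub by auto
  obtain V F where V: "open V" "g x \<in> V" "smooth_on V F" "\<forall>y\<in>Y. y \<in> V \<longrightarrow> F y = f y"
    by (rule smooth_mapD[OF f \<open>g x \<in> Y\<close>])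
  let ?W = "U \<inter> G -` V"
  have "open ?W" using continuous_open_preimage[OF smooth_on_continuous[OF U(3)] U(1) V(1)] .
  moreover have "smooth_on ?W (\<lambda>x. F (G x))"
    by (rule smooth_on_compose[OF \<open>open ?W\<close> V(1) _ V(3)]) (auto intro: smooth_on_subset[OF U(3)])
  moreover have "x \<in> ?W" using U V x by auto
  moreover have "F (G y) = f (g y)" if "y \<in> X \<inter> ?W" for y
    using that U(4)[rule_format, of y] V(4)[rule_format, of "g y"] sub by auto
  ultimately show "\<exists>U F. open U \<and> x \<in> U \<and> smooth_on U F \<and> (\<forall>y\<in>X \<inter> U. F y = f (g y))"
    by (intro exI[of _ ?W] exI[of _ "\<lambda>x. F (G x)"]) auto
qed

lemma smooth_map_Pair:
  assumes f: "smooth_map X f" and g: "smooth_map X g"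
  shows "smooth_map X (\<lambda>x. (f x, g x))"
  unfolding smooth_map_def
proof
  fix x assume x: "x \<in> X"
  obtain U G where U: "open U" "x \<in> U" "smooth_on U G" "\<forall>y\<in>X. y \<in> U \<longrightarrow> G y = g y"
    by (rule smooth_mapD[OF g x])
  obtain V F where V: "open V" "x \<in> V" "smooth_on V F" "\<forall>y\<in>X. y \<in> V \<longrightarrow> F y = f y"
    by (rule smooth_mapD[OF f x])
  show "\<exists>U H. open U \<and> x \<in> U \<and> smooth_on U H \<and> (\<forall>y\<in>X \<inter> U. H y = (f y, g y))"
    using U V by (intro exI[of _ "U \<inter> V"] exI[of _ "\<lambda>x. (F x, G x)"])
      (auto intro!: smooth_on_Pair intro: smooth_on_subset)
qed

section \<open>Lagrangian planes with prescribed asymptotics\<close>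

lemma smooth_on_sgn: "smooth_on (- {0}) (sgn :: complex \<Rightarrow> complex)"
  unfolding sgn_div_norm[abs_def]
  by (intro smooth_on_intros smooth_on_norm) auto

text \<open>\<open>Im (cnj w * v) / (norm w)\<^sup>2\<close> is the differential of the argument at
  \<open>w\<close> applied to \<open>v\<close>, and \<open>\<i> * sgn w\<close> is the unit tangent
  of the circle at \<open>sgn w\<close>; the radial part of \<open>v\<close> is invisible to
  \<open>sgn\<close>.\<close>

lemma has_derivative_sgn_complex:
  assumes "w \<noteq> 0"
  shows "(sgn has_derivative (\<lambda>v. (Im (cnj w * v) / (norm w)\<^sup>2) *\<^sub>R (\<i> * sgn w))) (at w)"
proof -
  have "(sgn has_derivative (\<lambda>v. v /\<^sub>R norm w - ((v \<bullet> sgn w) / (norm w)\<^sup>2) *\<^sub>R w)) (at w)"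
  proof -
    have "((\<lambda>x. inverse (norm x)) has_derivative (\<lambda>v. - (inverse (norm w) * (v \<bullet> sgn w) * inverse (norm w)))) (at w)"
      using diff_chain_at[OF has_derivative_norm[OF assms] has_derivative_inverse'[of "norm w"]] assms by (simp add: o_def)
    from has_derivative_scaleR[OF this has_derivative_ident] show ?thesis
      unfolding sgn_div_norm[abs_def]
      by (rule has_derivative_eq_rhs) (simp add: fun_eq_iff power2_eq_square divide_inverse algebra_simps)
  qed
  moreover have "v /\<^sub>R norm w - ((v \<bullet> sgn w) / (norm w)\<^sup>2) *\<^sub>R w = (Im (cnj w * v) / (norm w)\<^sup>2) *\<^sub>R (\<i> * sgn w)" for v
  proof -
    let ?n = "norm w"
    have n: "?n > 0" "?n\<^sup>2 = Re w * Re w + Im w * Im w"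
      using assms cmod_power2[of w] by (simp, simp only: power2_eq_square)
    have sg: "sgn w = w /\<^sub>R ?n" by (simp add: sgn_div_norm)
    have "?n ^ 3 *\<^sub>R (v /\<^sub>R ?n - ((v \<bullet> sgn w) / ?n\<^sup>2) *\<^sub>R w) = ?n\<^sup>2 *\<^sub>R v - (v \<bullet> w) *\<^sub>R w"
      using n(1) by (simp add: sg scaleR_diff_right power3_eq_cube power2_eq_square field_simps)
    also have "\<dots> = Im (cnj w * v) *\<^sub>R (\<i> * w)"
      unfolding n(2) by (simp add: complex_eq_iff inner_complex_def algebra_simps)
    also have "\<dots> = ?n ^ 3 *\<^sub>R ((Im (cnj w * v) / ?n\<^sup>2) *\<^sub>R (\<i> * sgn w))"
      using n(1) by (simp add: sg power3_eq_cube power2_eq_square)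
    finally show ?thesis unfolding scaleR_cancel_left using n(1) by simp
  qed
  ultimately show ?thesis by simp
qed

text \<open>The closed 1-form \<open>X d\<theta>\<close> on the punctured plane has a primitive because its period vanishes.\<close>

lemma angular_antiderivative:
  fixes X :: "complex \<Rightarrow> real"
  assumes X: "continuous_on UNIV X" and 0: "integral {0..2 * pi} (\<lambda>t. X (cis t)) = 0"
  obtains g where "\<And>w. w \<noteq> 0 \<Longrightarrow> (g has_derivative (\<lambda>v. (Im (cnj w * v) / (norm w)\<^sup>2) * X (sgn w))) (at w)"
proof -
  let ?q = "\<lambda>t. X (cis t)"
  have "isCont ?q t" for t
    using continuous_on_compose2[OF X, of UNIV cis] continuous_on_cis[OF continuous_on_id]
    by (simp add: continuous_on_eq_continuous_at)
  then obtain P where "\<forall>x. - \<infinity> < ereal x \<longrightarrow> ereal x < \<infinity> \<longrightarrow> (P has_vector_derivative ?q x) (at x)"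
    using einterval_antiderivative[of "- \<infinity>" \<infinity> ?q] by auto
  then have P: "(P has_vector_derivative ?q x) (at x)" for x by simp
  have per: "P (x + 2 * pi) = P x" for x
  proof -
    have "((\<lambda>x. P (x + 2 * pi) - P x) has_derivative (\<lambda>h. 0)) (at x within UNIV)" for x
    proof -
      have "((\<lambda>x. P (x + 2 * pi)) has_vector_derivative 1 *\<^sub>R ?q (x + 2 * pi)) (at x)"
      proof -
        have "((\<lambda>x. x + 2 * pi) has_derivative (\<lambda>x. x)) (at x)" by (auto intro!: derivative_eq_intros)
        from diff_chain_at[OF this P[of "x + 2 * pi", unfolded has_vector_derivative_def]]
        show ?thesis by (simp add: o_def has_vector_derivative_def)
      qed
      then have "((\<lambda>x. P (x + 2 * pi)) has_vector_derivative ?q x) (at x)"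
        by (simp add: cis.ctr)
      from has_vector_derivative_diff[OF this P[of x]] show ?thesis by (simp add: has_vector_derivative_def)
    qed
    \<comment> \<open>The increment of \<open>P\<close> over one period does not depend on
      \<open>x\<close>, and its value is the integral that vanishes by assumption.\<close>
    from has_derivative_zero_unique[OF convex_UNIV this, of x 0]
    have "P (x + 2 * pi) - P x = P (2 * pi) - P 0" by simp
    moreover have "(?q has_integral P (2 * pi) - P 0) {0..2 * pi}"
      by (rule fundamental_theorem_of_calculus) (auto intro: P has_vector_derivative_at_within)
    ultimately show ?thesis using 0 by (simp add: integral_unique)
  qed
  have per_nat: "P (x + 2 * pi * real n) = P x" for x n
  proof (induction n)
    case (Suc n)
    then show ?case using per[of "x + 2 * pi * real n"] by (simp add: algebra_simps)
  qed simp
  have per_int: "P (x + 2 * pi * of_int n) = P x" for x n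
  proof (cases "0 \<le> n")
    case True
    then show ?thesis using per_nat[of x "nat n"] by simp
  next
    case False
    then show ?thesis using per_nat[of "x + 2 * pi * of_int n" "nat (- n)"] by simp
  qed
  define g where "g w = P (Arg w)" for w
  have "(g has_derivative (\<lambda>v. (Im (cnj w * v) / (norm w)\<^sup>2) * X (sgn w))) (at w)" if w: "w \<noteq> 0" for w
  proof -
    \<comment> \<open>A branch of the argument that is smooth near \<open>w\<close> even when
      \<open>w\<close> lies on the cut of \<open>Arg\<close>. It differs from \<open>Arg z\<close>
      by a multiple of \<open>2 * pi\<close>, which the periodic \<open>P\<close> does not
      see.\<close>
    let ?A = "\<lambda>z. Arg w + Im (Ln (z / w))"
    have eq: "g z = P (?A z)" if "z \<noteq> 0" for z
    proof -
      have "cis (Arg z) = cis (?A z)"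
      proof -
        have "cis (Im (Ln (z / w))) = sgn (z / w)"
          using cis_Arg[of "z / w"] that w by (simp add: Arg_def)
        then show ?thesis using that w by (simp add: cis_mult[symmetric] cis_Arg sgn_divide sgn_zero_iff)
      qed
      then have "sin (Arg z) = sin (?A z) \<and> cos (Arg z) = cos (?A z)"
        unfolding complex_eq_iff cis.sel by simp
      then obtain n :: int where "Arg z = ?A z + 2 * pi * of_int n"
        unfolding sin_cos_eq_iff by blast
      then show ?thesis by (simp add: g_def per_int)
    qed
    have "((\<lambda>z. Ln (z / w)) has_field_derivative 1 / w) (at w)"
      using w by (auto intro!: derivative_eq_intros)
    then have "((\<lambda>z. Ln (z / w)) has_derivative (\<lambda>v. v / w)) (at w)"
      unfolding has_field_derivative_def by (auto elim!: has_derivative_eq_rhs)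
    then have A: "(?A has_derivative (\<lambda>v. Im (v / w))) (at w)"
      by (auto intro!: derivative_eq_intros)
    have "?A w = Arg w" using w by simp
    then have "(P has_derivative (\<lambda>h. h *\<^sub>R ?q (Arg w))) (at (?A w))"
      using P[of "Arg w"] by (simp add: has_vector_derivative_def)
    from diff_chain_at[OF A this]
    have "((\<lambda>z. P (?A z)) has_derivative (\<lambda>v. Im (v / w) * X (sgn w))) (at w)"
      using w by (simp add: o_def cis_Arg)
    moreover have "Im (v / w) = Im (cnj w * v) / (norm w)\<^sup>2" for v
      by (simp add: Im_divide cmod_power2 algebra_simps)
    ultimately have "((\<lambda>z. P (?A z)) has_derivative (\<lambda>v. (Im (cnj w * v) / (norm w)\<^sup>2) * X (sgn w))) (at w)"
      by simp
    then show ?thesis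
      by (rule has_derivative_transform_within_open[of _ _ _ _ "- {0}"]) (use w eq in auto)
  qed
  then show thesis by (rule that)
qed

lemma smooth_on_Un:
  assumes "smooth_on U f" "smooth_on V f" "open U" "open V" "S \<subseteq> U \<union> V"
  shows "smooth_on S f"
  by (rule smooth_on_local) (use assms in blast)

text \<open>With \<open>a\<^sub>1 = w\<^sup>m\<close>, the form \<open>Im (a\<^sub>2 da\<^sub>1)\<close> equals \<open>dH\<close> exactly for the function \<open>a\<^sub>2 = K\<close> below.\<close>

lemma potential_lagrangian:
  fixes H :: "complex \<Rightarrow> real" and m :: nat
  defines "K \<equiv> \<lambda>w. \<i> * (of_real (frechet_derivative H (at w) 1) - \<i> * of_real (frechet_derivative H (at w) \<i>)) /
    (of_nat m * w ^ (m - 1))"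
  assumes H: "smooth_on (- {0}) H" and m: "m \<ge> 1"
  shows "smooth_on (- {0}) K"
    and "w \<noteq> 0 \<Longrightarrow> Im (of_nat m * w ^ (m - 1) * u * frechet_derivative K (at w) v -
      of_nat m * w ^ (m - 1) * v * frechet_derivative K (at w) u) = 0"
proof -
  let ?x = "\<lambda>w. frechet_derivative H (at w) 1" and ?y = "\<lambda>w. frechet_derivative H (at w) \<i>"
  have op: "open (- {0::complex})" by auto
  have sx: "smooth_on (- {0}) ?x" and sy: "smooth_on (- {0}) ?y"
    using smooth_on_derivative(2)[OF H] by auto
  show "smooth_on (- {0}) K"
    unfolding K_def using m
    by (intro smooth_on_intros smooth_on_of_real sx sy op) auto
  define p where "p = (\<lambda>w::complex. inverse (of_nat m * w ^ (m - 1)))"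
  assume w: "w \<noteq> 0"
  define xu where "xu = frechet_derivative ?x (at w)"
  define yu where "yu = frechet_derivative ?y (at w)"
  have dx: "(?x has_derivative xu) (at w)" and dy: "(?y has_derivative yu) (at w)"
    using smooth_on_derivative(1)[OF sx] smooth_on_derivative(1)[OF sy] w by (auto simp: xu_def yu_def)
  have "p field_differentiable at w"
    unfolding p_def using w m by (intro derivative_intros field_differentiable_inverse) auto
  then obtain p' where p': "(p has_field_derivative p') (at w)"
    unfolding field_differentiable_def by blast
  let ?Q = "\<lambda>w. \<i> * (of_real (?x w) - \<i> * of_real (?y w))"
  have K: "K = (\<lambda>w. ?Q w * p w)" by (simp add: K_def p_def divide_inverse fun_eq_iff)
  have "(K has_derivative (\<lambda>v. ?Q w * (p' * v) + \<i> * (of_real (xu v) - \<i> * of_real (yu v)) * p w)) (at w)"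
    unfolding K using p'[unfolded has_field_derivative_def]
    by (auto intro!: derivative_eq_intros dx dy simp: fun_eq_iff)
  then have K': "frechet_derivative K (at w) = (\<lambda>v. ?Q w * (p' * v) + \<i> * (of_real (xu v) - \<i> * of_real (yu v)) * p w)"
    by (rule frechet_derivative_at[symmetric])
  have c: "xu \<i> = yu 1"
    unfolding xu_def yu_def using frechet_derivative_commute[OF H op, of w 1 \<i>] w by simp
  have lin: "L v = Re v * L 1 + Im v * L \<i>" if "(f has_derivative L) (at w)" for L f :: "complex \<Rightarrow> real" and v
  proof -
    have l: "linear L" using has_derivative_linear[OF that] .
    have "L (Re v *\<^sub>R 1 + Im v *\<^sub>R \<i>) = Re v * L 1 + Im v * L \<i>"
      by (simp add: linear_add[OF l] linear_cmul[OF l] del: scaleR_conv_of_real)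
    moreover have "Re v *\<^sub>R 1 + Im v *\<^sub>R \<i> = v" by (simp add: complex_eq_iff)
    ultimately show ?thesis by simp
  qed
  define M where "M = of_nat m * w ^ (m - 1)"
  have "M \<noteq> 0" "p w = inverse M" using w m by (simp_all add: M_def p_def)
  then have Mp: "M * p w = 1" by simp
  \<comment> \<open>The terms with \<open>p'\<close> are symmetric in \<open>u\<close> and
    \<open>v\<close> and cancel. What remains is the exterior derivative of \<open>?Q dw\<close>,
    whose imaginary part is the differential of \<open>dH\<close>; it vanishes by the symmetry
    \<open>c\<close> of second derivatives.\<close>
  have "M * u * frechet_derivative K (at w) v - M * v * frechet_derivative K (at w) u =
    (M * p w) * (u * (\<i> * (of_real (xu v) - \<i> * of_real (yu v))) - v * (\<i> * (of_real (xu u) - \<i> * of_real (yu u))))"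
    unfolding K' by (simp add: algebra_simps)
  also have "Im \<dots> = 0"
    unfolding Mp using lin[OF dx, of u] lin[OF dx, of v] lin[OF dy, of u] lin[OF dy, of v] c
    by (simp add: algebra_simps)
  finally show "Im (of_nat m * w ^ (m - 1) * u * frechet_derivative K (at w) v -
      of_nat m * w ^ (m - 1) * v * frechet_derivative K (at w) u) = 0" unfolding M_def .
qed

text \<open>The potential is \<open>g - c / \<bar>w\<bar>\<^sup>2\<^sup>m\<close> near infinity, where \<open>g\<close> is an angular primitive of \<open>m x\<close>; its
  angular derivative is governed by \<open>x\<close> and its radial derivative by the independent function \<open>c\<close>.
  Near \<open>0\<close> it is \<open>Re (w\<^sup>m\<^sup>+\<^sup>1)\<close>, for which \<open>a\<^sub>2\<close> is a multiple of \<open>w\<close>, so that the branch point of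
  \<open>a\<^sub>1 = w\<^sup>m\<close> is immersed.\<close>

lemma asymptotic_lagrangian_graph:
  fixes x c :: "complex \<Rightarrow> real" and m :: nat
  assumes m: "m \<ge> 1" and x: "smooth_on UNIV x" and c: "smooth_on UNIV c"
    and int0: "integral {0..2 * pi} (\<lambda>t. x (cis t)) = 0"
  obtains G d where "smooth_on UNIV G" "inj (frechet_derivative G (at 0))" "continuous_on UNIV d"
    "\<forall>w u v. Im (of_nat m * w ^ (m - 1) * u * frechet_derivative G (at w) v -
      of_nat m * w ^ (m - 1) * v * frechet_derivative G (at w) u) = 0"
    "\<forall>w. norm w > 1 \<longrightarrow> G w = Complex (x (sgn w) - d (sgn w) / norm w ^ (2 * m)) (2 * c (sgn w) / norm w ^ (2 * m)) / w ^ m"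
proof -
  have op: "open (- {0::complex})" by auto
  \<comment> \<open>The angular derivative of \<open>c\<close>. It enters because the decaying term
    of the potential depends on the angle as well; divided by \<open>m\<close>, it becomes the error
    function \<open>d\<close> of the conclusion.\<close>
  define d' where "d' \<omega> = frechet_derivative c (at \<omega>) (\<i> * \<omega>)" for \<omega>
  have "d' = (\<lambda>\<omega>. - Im \<omega> * frechet_derivative c (at \<omega>) 1 + Re \<omega> * frechet_derivative c (at \<omega>) \<i>)"
  proof
    fix \<omega>
    have l: "linear (frechet_derivative c (at \<omega>))"
      using has_derivative_linear[OF smooth_on_derivative(1)[OF c]] by simp
    have "\<i> * \<omega> = (- Im \<omega>) *\<^sub>R 1 + Re \<omega> *\<^sub>R \<i>" by (simp add: complex_eq_iff)
    then show "d' \<omega> = - Im \<omega> * frechet_derivative c (at \<omega>) 1 + Re \<omega> * frechet_derivative c (at \<omega>) \<i>"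
      unfolding d'_def using linear_add[OF l, of "(- Im \<omega>) *\<^sub>R 1" "Re \<omega> *\<^sub>R \<i>"]
        linear_cmul[OF l, of "- Im \<omega>" 1] linear_cmul[OF l, of "Re \<omega>" \<i>] by (simp only: real_scaleR_def)
  qed
  then have d'_cont: "continuous_on UNIV d'"
    using smooth_on_continuous[OF smooth_on_derivative(2)[OF c]] by (auto intro!: continuous_intros)
  have "continuous_on UNIV (\<lambda>\<omega>. of_nat m * x \<omega>)"
    using smooth_on_continuous[OF x] by (auto intro!: continuous_intros)
  then obtain g where g: "\<And>w. w \<noteq> 0 \<Longrightarrow> (g has_derivative (\<lambda>v. (Im (cnj w * v) / (norm w)\<^sup>2) * (of_nat m * x (sgn w)))) (at w)"
    by (rule angular_antiderivative[of "\<lambda>\<omega>. of_nat m * x \<omega>"]) (use int0 in auto)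
  have sx: "smooth_on (- {0}) (\<lambda>w. x (sgn w))" and sc: "smooth_on (- {0}) (\<lambda>w. c (sgn w))"
    using smooth_on_compose[OF op open_UNIV _ x smooth_on_sgn] smooth_on_compose[OF op open_UNIV _ c smooth_on_sgn] by auto
  have sn: "smooth_on (- {0}) (\<lambda>w::complex. norm w)"
    by (intro smooth_on_norm smooth_on_intros op) auto
  have sg: "smooth_on (- {0}) g"
  proof (rule smooth_onI[OF op])
    show "smooth_on (- {0}) (\<lambda>w. (Im (cnj w * v) / (norm w)\<^sup>2) * (of_nat m * x (sgn w)))" for v
      by (intro smooth_on_intros smooth_on_Im smooth_on_cnj sx sn op) auto
  qed (use g in auto)
  define P where "P w = inverse (norm w) ^ (2 * m)" for w :: complex
  define Hi where "Hi w = g w - c (sgn w) * P w" for w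
  have sHi: "smooth_on (- {0}) Hi"
    unfolding Hi_def P_def by (intro smooth_on_intros sg sc sn op) auto
  \<comment> \<open>\<open>A\<close> and \<open>B\<close> are the derivatives of \<open>Hi\<close>
    in the argument of \<open>w\<close> and in the logarithm of \<open>norm w\<close>.\<close>
  define A B where "A w = of_nat m * x (sgn w) - d' (sgn w) * P w" and "B w = 2 * of_nat m * c (sgn w) * P w" for w
  have dHi: "(Hi has_derivative (\<lambda>v. (Im (cnj w * v) * A w + Re (cnj w * v) * B w) / (norm w)\<^sup>2)) (at w)"
    if w: "w \<noteq> 0" for w
  proof -
    have "(c has_derivative frechet_derivative c (at (sgn w))) (at (sgn w))"
      using smooth_on_derivative(1)[OF c] by simp
    from diff_chain_at[OF has_derivative_sgn_complex[OF w] this]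
    have 1: "((\<lambda>w. c (sgn w)) has_derivative (\<lambda>v. (Im (cnj w * v) / (norm w)\<^sup>2) * d' (sgn w))) (at w)"
      using linear_cmul[OF has_derivative_linear[OF smooth_on_derivative(1)[OF c, of "sgn w"]]]
      by (simp add: o_def d'_def)
    have "((\<lambda>x. inverse (norm x)) has_derivative (\<lambda>v. - (inverse (norm w) * (v \<bullet> sgn w) * inverse (norm w)))) (at w)"
      using diff_chain_at[OF has_derivative_norm[OF w] has_derivative_inverse'[of "norm w"]] w by (simp add: o_def)
    from has_derivative_power[OF this, of "2 * m"]
    have "(P has_derivative (\<lambda>v. of_nat (2 * m) * (- (inverse (norm w) * (v \<bullet> sgn w) * inverse (norm w))) * inverse (norm w) ^ (2 * m - 1))) (at w)"
      unfolding P_def[abs_def] by simp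
    moreover have "of_nat (2 * m) * (- (inverse (norm w) * (v \<bullet> sgn w) * inverse (norm w))) * inverse (norm w) ^ (2 * m - 1) =
        - 2 * of_nat m * P w * Re (cnj w * v) / (norm w)\<^sup>2" for v
    proof -
      obtain k where k: "2 * m = Suc k" using m by (cases "2 * m") auto
      have "v \<bullet> sgn w = inverse (norm w) * Re (cnj w * v)"
        by (simp add: sgn_div_norm inner_complex_def algebra_simps)
      then show ?thesis unfolding P_def
        by (simp add: k power2_eq_square divide_inverse) (use k in \<open>simp add: algebra_simps\<close>)
    qed
    ultimately have 2: "(P has_derivative (\<lambda>v. - 2 * of_nat m * P w * Re (cnj w * v) / (norm w)\<^sup>2)) (at w)" by simp
    show ?thesis
      unfolding Hi_def
      by (rule has_derivative_eq_rhs[OF has_derivative_diff[OF g[OF w] has_derivative_mult[OF 1 2]]])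
        (simp add: fun_eq_iff A_def B_def add_divide_distrib diff_divide_distrib algebra_simps)
  qed
  \<comment> \<open>The cut-off is 0 for \<open>norm w\<close> at most \<open>1 / sqrt 2\<close> and
    1 for \<open>norm w \<ge> 1\<close>, so both the ball of radius 1/2 and the region
    \<open>norm w > 1\<close> lie outside the transition annulus.\<close>
  define cut where "cut w = smooth_step (2 * (w \<bullet> w) - 1)" for w :: complex
  have scut: "smooth_on UNIV cut"
    unfolding cut_def
    by (rule smooth_on_compose[OF _ open_UNIV _ smooth_on_smooth_step]) (auto intro!: smooth_on_intros)
  define H where "H w = cut w * Hi w + (1 - cut w) * Re (w ^ (m + 1))" for w
  have sH: "smooth_on (- {0}) H"
    unfolding H_def
    by (intro smooth_on_intros smooth_on_Re smooth_on_subset[OF scut] sHi op) auto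
  have H_in: "H w = Re (w ^ (m + 1))" if "w \<in> ball 0 (1/2)" for w
  proof -
    have "w \<bullet> w \<le> (1/2)\<^sup>2"
      unfolding dot_square_norm using that by (intro power_mono) auto
    then show ?thesis by (simp add: H_def cut_def smooth_step_0 power2_eq_square)
  qed
  have H_out: "H w = Hi w" if "norm w > 1" for w
  proof -
    have "w \<bullet> w \<ge> 1^2"
      unfolding dot_square_norm using that by (intro power_mono) auto
    then show ?thesis by (simp add: H_def cut_def smooth_step_1)
  qed
  define K where "K w = \<i> * (of_real (frechet_derivative H (at w) 1) - \<i> * of_real (frechet_derivative H (at w) \<i>)) /
    (of_nat m * w ^ (m - 1))" for w
  note pot = potential_lagrangian[OF sH m, folded K_def[abs_def]]
  \<comment> \<open>For \<open>H = Re (w ^ (m + 1))\<close> the numerator of \<open>K\<close> is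
    \<open>\<i> * (m + 1) * w ^ m\<close>; division by \<open>m * w ^ (m - 1)\<close> leaves
    \<open>\<kappa> * w\<close>. The value 0 that \<open>G\<close> gets at the origin therefore
    removes the singularity of \<open>K\<close>.\<close>
  define \<kappa> :: complex where "\<kappa> = \<i> * (of_nat m + 1) / of_nat m"
  define G where "G w = (if w = 0 then 0 else K w)" for w
  have G_in: "G w = \<kappa> * w" if "w \<in> ball 0 (1/2)" for w
  proof (cases "w = 0")
    case False
    have "((\<lambda>w. w ^ (m + 1)) has_field_derivative (of_nat (m + 1) * w ^ m)) (at w)"
      by (rule DERIV_cong[OF DERIV_power[OF DERIV_ident]]) simp
    then have "((\<lambda>w. Re (w ^ (m + 1))) has_derivative (\<lambda>v. Re (of_nat (m + 1) * w ^ m * v))) (at w)"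
      unfolding has_field_derivative_def by (rule bounded_linear.has_derivative[OF bounded_linear_Re])
    then have "(H has_derivative (\<lambda>v. Re (of_nat (m + 1) * w ^ m * v))) (at w)"
      by (rule has_derivative_transform_within_open[of _ _ _ _ "ball 0 (1/2)"]) (use that H_in in auto)
    then have "frechet_derivative H (at w) = (\<lambda>v. Re (of_nat (m + 1) * w ^ m * v))"
      by (rule frechet_derivative_at[symmetric])
    then have "of_real (frechet_derivative H (at w) 1) - \<i> * of_real (frechet_derivative H (at w) \<i>) = of_nat (m + 1) * w ^ m"
      by (simp only: complex_eq_iff) (simp del: of_nat_add of_nat_Suc)
    then have "K w = \<i> * (of_nat (m + 1) * w ^ m) / (of_nat m * w ^ (m - 1))" by (simp add: K_def)
    also have "w ^ m = w * w ^ (m - 1)" using m by (cases m) auto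
    finally show ?thesis using False m by (simp add: G_def \<kappa>_def)
  qed (simp add: G_def)
  have G_out: "G w = K w" if "w \<in> - {0}" for w using that by (simp add: G_def)
  have sG1: "smooth_on (ball 0 (1/2)) G"
  proof -
    have "smooth_on (ball 0 (1/2)) (\<lambda>w. \<kappa> * w)" by (intro smooth_on_mult smooth_on_const smooth_on_id) auto
    then show ?thesis using smooth_on_cong[of "ball 0 (1/2)" G "\<lambda>w. \<kappa> * w"] G_in by simp
  qed
  have sG2: "smooth_on (- {0}) G"
    using smooth_on_cong[OF op, of G K] G_out pot(1) by simp
  have sG: "smooth_on UNIV G"
    by (rule smooth_on_Un[OF sG1 sG2]) auto
  have G0: "frechet_derivative G (at 0) = (\<lambda>v. \<kappa> * v)"
  proof -
    have "((\<lambda>v. \<kappa> * v) has_derivative (\<lambda>v. \<kappa> * v)) (at 0)"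
      by (auto intro!: derivative_eq_intros)
    then have "(G has_derivative (\<lambda>v. \<kappa> * v)) (at 0)"
      by (rule has_derivative_transform_within_open[of _ _ _ _ "ball 0 (1/2)"]) (use G_in in auto)
    then show ?thesis by (rule frechet_derivative_at[symmetric])
  qed
  have GK: "frechet_derivative G (at w) = frechet_derivative K (at w)" if "w \<noteq> 0" for w
  proof -
    have "(K has_derivative frechet_derivative K (at w)) (at w)"
      using smooth_on_derivative(1)[OF pot(1)] that by simp
    then have "(G has_derivative frechet_derivative K (at w)) (at w)"
      by (rule has_derivative_transform_within_open[of _ _ _ _ "- {0}"]) (use that G_out in auto)
    then show ?thesis by (rule frechet_derivative_at[symmetric])
  qed
  have k0: "\<kappa> \<noteq> 0"
  proof -
    have "(of_nat m + 1 :: complex) \<noteq> 0" by (metis add.commute of_nat_Suc of_nat_neq_0)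
    then show ?thesis using m by (simp add: \<kappa>_def)
  qed
  show thesis
  proof (rule that[OF sG])
    show "inj (frechet_derivative G (at 0))"
      unfolding G0 using k0 by (simp add: inj_def)
    show "continuous_on UNIV (\<lambda>\<omega>. d' \<omega> / of_nat m)" using d'_cont by (intro continuous_intros) (use m in auto)
    have "Im (of_nat m * w ^ (m - 1) * u * frechet_derivative G (at w) v -
      of_nat m * w ^ (m - 1) * v * frechet_derivative G (at w) u) = 0" for w u v
    proof (cases "w = 0")
      case True
      have "of_nat m * w ^ (m - 1) * u * frechet_derivative G (at w) v -
        of_nat m * w ^ (m - 1) * v * frechet_derivative G (at w) u = 0"
        unfolding True G0 by (simp only: mult_ac diff_self)
      then show ?thesis by (simp only: zero_complex.sel)
    next
      case False
      then show ?thesis using pot(2)[OF False, of u v] by (simp only: GK[OF False])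
    qed
    then show "\<forall>w u v. Im (of_nat m * w ^ (m - 1) * u * frechet_derivative G (at w) v -
      of_nat m * w ^ (m - 1) * v * frechet_derivative G (at w) u) = 0" by blast
    have "G w = Complex (x (sgn w) - d' (sgn w) / of_nat m / norm w ^ (2 * m)) (2 * c (sgn w) / norm w ^ (2 * m)) / w ^ m"
      if w: "norm w > 1" for w
    proof -
      have w0: "w \<noteq> 0" using w by auto
      have "open {w::complex. norm w > 1}" by (intro open_Collect_less continuous_intros)
      then have "(H has_derivative (\<lambda>v. (Im (cnj w * v) * A w + Re (cnj w * v) * B w) / (norm w)\<^sup>2)) (at w)"
        by (rule has_derivative_transform_within_open[OF dHi[OF w0]]) (use w H_out in auto)
      then have HD: "frechet_derivative H (at w) = (\<lambda>v. (Im (cnj w * v) * A w + Re (cnj w * v) * B w) / (norm w)\<^sup>2)"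
        by (rule frechet_derivative_at[symmetric])
      have "\<i> * (of_real (frechet_derivative H (at w) 1) - \<i> * of_real (frechet_derivative H (at w) \<i>)) =
        cnj w * Complex (A w) (B w) / of_real ((norm w)\<^sup>2)"
        unfolding HD by (simp add: complex_eq_iff divide_inverse algebra_simps)
      also have "\<dots> = Complex (A w) (B w) / w"
      proof -
        have "of_real ((norm w)\<^sup>2) = w * cnj w" by (rule complex_norm_square)
        then show ?thesis using w0 by simp
      qed
      finally have "K w = Complex (A w) (B w) / w / (of_nat m * w ^ (m - 1))" by (simp add: K_def)
      also have "\<dots> = Complex (A w / m) (B w / m) / w ^ m"
      proof -
        have "w ^ m = w * w ^ (m - 1)" using m by (cases m) auto
        moreover have "Complex (A w / m) (B w / m) = Complex (A w) (B w) / of_nat m"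
          by (simp add: complex_eq_iff)
        ultimately show ?thesis by simp
      qed
      also have "A w / m = x (sgn w) - d' (sgn w) / of_nat m / norm w ^ (2 * m)"
        using m w0 by (simp add: A_def P_def power_inverse field_simps)
      also have "B w / m = 2 * c (sgn w) / norm w ^ (2 * m)"
        using m by (simp add: B_def P_def power_inverse divide_inverse)
      finally show ?thesis using w0 by (simp add: G_def)
    qed
    then show "\<forall>w. norm w > 1 \<longrightarrow> G w = Complex (x (sgn w) - d' (sgn w) / of_nat m / norm w ^ (2 * m)) (2 * c (sgn w) / norm w ^ (2 * m)) / w ^ m"
      by blast
  qed
qed

text \<open>With \<open>N = \<bar>a\<^sub>1\<bar>\<^sup>2\<close>, the differentiated function is
  the squared distance of the surface from the origin along a ray. Its growth makes large spheres
  meet each ray once and transversely. In terms of \<open>u = 1 / N\<close> the correction to the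
  derivative 1 is at most \<open>u\<^sup>2\<close> times (4 + 3 + 4) \<open>Q\<^sup>2\<close>, and
  \<open>4 * Q * u \<le> 1\<close> bounds this by 11/16.\<close>

lemma radial_energy_deriv:
  fixes a d b Q N :: real
  assumes "\<bar>a\<bar> \<le> Q" "\<bar>d\<bar> \<le> Q" "\<bar>b\<bar> \<le> Q" "N > 1 + 4 * Q"
  obtains e' where "e' > 0" "((\<lambda>N. N + ((a - d / N)\<^sup>2 + (b / N)\<^sup>2) / N) has_real_derivative e') (at N)"
proof -
  have Q: "Q \<ge> 0" "N > 1" using assms by linarith+
  define u where "u = 1 / N"
  have u: "0 < u" "u < 1" "4 * Q * u \<le> 1" using Q assms(4) by (auto simp: u_def field_simps)
  let ?e = "1 + (2 * (a - d * u) * (d * u\<^sup>2) + 2 * (b * u) * (- b * u\<^sup>2)) * u + ((a - d * u)\<^sup>2 + (b * u)\<^sup>2) * (- u\<^sup>2)"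
  have "((\<lambda>N. N + ((a - d / N)\<^sup>2 + (b / N)\<^sup>2) / N) has_real_derivative ?e) (at N)"
    using Q by (auto intro!: derivative_eq_intros simp: u_def power2_eq_square) (simp add: field_simps)
  moreover have "?e > 0"
  proof -
    have du: "\<bar>d * u\<bar> \<le> Q" "\<bar>b * u\<bar> \<le> Q"
      using mult_mono[OF assms(2) less_imp_le[OF u(2)]] mult_mono[OF assms(3) less_imp_le[OF u(2)]] u(1) Q
      by (auto simp: abs_mult)
    have adu: "\<bar>a - d * u\<bar> \<le> 2 * Q" using assms(1) du by linarith
    have 1: "\<bar>2 * (a - d * u) * (d * u)\<bar> \<le> 2 * (2 * Q) * Q"
      unfolding abs_mult[of "2 * (a - d * u)"] using adu du(1) Q by (intro mult_mono) auto
    have 2: "(b * u)\<^sup>2 \<le> Q\<^sup>2" using du(2) Q by (intro abs_le_square_iff[THEN iffD1]) auto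
    have 3: "(a - d * u)\<^sup>2 \<le> (2 * Q)\<^sup>2" using adu Q by (intro abs_le_square_iff[THEN iffD1]) auto
    have "?e = 1 - u\<^sup>2 * (- (2 * (a - d * u) * (d * u)) + 3 * (b * u)\<^sup>2 + (a - d * u)\<^sup>2)"
      by (simp add: power2_eq_square algebra_simps)
    moreover have "u\<^sup>2 * (- (2 * (a - d * u) * (d * u)) + 3 * (b * u)\<^sup>2 + (a - d * u)\<^sup>2) \<le> u\<^sup>2 * (11 * Q\<^sup>2)"
      using 1 2 3 by (intro mult_left_mono) (auto simp: power2_eq_square)
    moreover have "u\<^sup>2 * (11 * Q\<^sup>2) < 1"
    proof -
      have "(4 * Q * u)\<^sup>2 \<le> 1\<^sup>2" using u Q by (intro power_mono) auto
      then show ?thesis by (simp add: power2_eq_square algebra_simps)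
    qed
    ultimately show ?thesis by linarith
  qed
  ultimately show thesis by (rule that[rotated])
qed

text \<open>Here \<open>S\<close> is the squared radius of the sphere and
  \<open>N = \<bar>a\<^sub>1\<bar>\<^sup>2\<close>; their ratio tends to 1, so the radius may
  replace the unknown \<open>\<bar>a\<^sub>1\<bar>\<close>. The constants come from
  \<open>A\<^sup>2 + B\<^sup>2 \<le> 5 * Q\<^sup>2\<close>: the ratio exceeds 1 by at most
  \<open>5 * Q\<^sup>2 / N\<close>, and the two errors are at most
  \<open>(10 * Q ^ 3 + Q) / N\<close> and \<open>15 * Q ^ 3 / N\<close>. Since
  \<open>S \<le> N + 2 * Q\<close>, the lower bound on \<open>S\<close> forces \<open>N\<close> to
  be large.\<close>

lemma slice_estimates:
  fixes a d c Q N S \<epsilon> :: real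
  assumes b: "\<bar>a\<bar> \<le> Q" "\<bar>d\<bar> \<le> Q" "\<bar>2 * c\<bar> \<le> Q" and N: "N > 1 + 4 * Q" and eps: "\<epsilon> > 0"
    and S: "S = N + ((a - d / N)\<^sup>2 + (2 * c / N)\<^sup>2) / N"
    and big: "S \<ge> 2 * Q + 1 + (25 * Q ^ 3 + Q) / \<epsilon>"
  shows "\<bar>S / N * (a - d / N) - a\<bar> < \<epsilon>" "\<bar>(S / N)\<^sup>2 * c - c\<bar> < \<epsilon>"
proof -
  have Q: "Q \<ge> 0" "N > 1" using assms(1-4) by linarith+
  have QN: "Q / N \<le> 1 / 4" using Q N by (simp add: field_simps)
  have c: "\<bar>c\<bar> \<le> Q" using b(3) Q by linarith
  define A B where "A = a - d / N" and "B = 2 * c / N"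
  have le: "\<bar>t / N\<bar> \<le> Q" if "\<bar>t\<bar> \<le> Q" for t
    using that Q frac_le[of Q "\<bar>t\<bar>" 1 N] by simp
  have A: "\<bar>A\<bar> \<le> 2 * Q" using le[OF b(2)] b(1) unfolding A_def by linarith
  have B: "\<bar>B\<bar> \<le> Q" using le[OF b(3)] unfolding B_def .
  have "A\<^sup>2 \<le> (2 * Q)\<^sup>2" using A Q by (intro abs_le_square_iff[THEN iffD1]) simp
  moreover have "B\<^sup>2 \<le> Q\<^sup>2" using B Q by (intro abs_le_square_iff[THEN iffD1]) simp
  ultimately
  have AB: "0 \<le> A\<^sup>2 + B\<^sup>2" "A\<^sup>2 + B\<^sup>2 \<le> 5 * Q\<^sup>2" by (auto simp: power2_eq_square)
  define \<delta> where "\<delta> = S / N - 1"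
  have \<delta>: "\<delta> = (A\<^sup>2 + B\<^sup>2) / N / N" using Q by (simp add: \<delta>_def S A_def B_def add_divide_distrib)
  have \<delta>0: "0 \<le> \<delta>" using AB Q by (simp add: \<delta>)
  have \<delta>N: "\<delta> \<le> 5 * Q\<^sup>2 / N"
  proof -
    have "\<delta> \<le> 5 * Q\<^sup>2 / N / N" unfolding \<delta> using AB Q by (intro divide_right_mono) auto
    also have "\<dots> \<le> 5 * Q\<^sup>2 / N / 1" using Q by (intro divide_left_mono) auto
    finally show ?thesis by simp
  qed
  have \<delta>1: "\<delta> \<le> 1"
  proof -
    have "\<delta> \<le> 5 * Q\<^sup>2 / N / N" unfolding \<delta> using AB Q by (intro divide_right_mono) auto
    also have "\<dots> = 5 * (Q / N)\<^sup>2" by (simp add: power2_eq_square)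
    also have "\<dots> \<le> 5 * (1 / 4)\<^sup>2" using QN Q by (intro mult_left_mono power_mono) auto
    finally show ?thesis by (simp add: power2_eq_square)
  qed
  have SN: "S \<le> N + 2 * Q"
  proof -
    have "S = N + (A\<^sup>2 + B\<^sup>2) / N" by (simp add: S A_def B_def)
    moreover have "(A\<^sup>2 + B\<^sup>2) / N \<le> 5 * Q\<^sup>2 / N" using AB Q by (intro divide_right_mono) auto
    moreover have "5 * Q\<^sup>2 / N = 5 * Q * (Q / N)" by (simp add: power2_eq_square)
    moreover have "5 * Q * (Q / N) \<le> 5 * Q * (1 / 4)" using QN Q by (intro mult_left_mono) auto
    ultimately show ?thesis using Q by linarith
  qed
  then have "(25 * Q ^ 3 + Q) / \<epsilon> < N" using big by linarith
  then have fin: "(25 * Q ^ 3 + Q) / N < \<epsilon>" using eps Q by (simp add: field_simps)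
  have Q3: "Q ^ 3 / N \<ge> 0" using Q by simp
  have e: "(25 * Q ^ 3 + Q) / N = 25 * (Q ^ 3 / N) + Q / N" by (simp add: add_divide_distrib)
  have "S / N * (a - d / N) - a = \<delta> * A - d / N" by (simp add: \<delta>_def A_def algebra_simps)
  moreover have "\<bar>\<delta> * A\<bar> \<le> 5 * Q\<^sup>2 / N * (2 * Q)"
    unfolding abs_mult using \<delta>N \<delta>0 A Q by (intro mult_mono) auto
  moreover have "5 * Q\<^sup>2 / N * (2 * Q) = 10 * (Q ^ 3 / N)" by (simp add: power2_eq_square power3_eq_cube)
  moreover have "\<bar>d / N\<bar> \<le> Q / N" using b(2) Q by (simp add: divide_right_mono)
  ultimately show "\<bar>S / N * (a - d / N) - a\<bar> < \<epsilon>" using fin e Q3 by linarith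
  have eq: "(S / N)\<^sup>2 * c - c = (2 * \<delta> + \<delta> * \<delta>) * c" by (simp add: \<delta>_def power2_eq_square algebra_simps)
  have "\<delta> * \<delta> \<le> \<delta> * 1" using \<delta>1 \<delta>0 by (intro mult_left_mono) auto
  then have "\<bar>(2 * \<delta> + \<delta> * \<delta>) * c\<bar> \<le> 3 * (5 * Q\<^sup>2 / N) * Q"
    unfolding abs_mult using \<delta>N \<delta>0 c Q by (intro mult_mono) auto
  also have "\<dots> = 15 * (Q ^ 3 / N)" by (simp add: power2_eq_square power3_eq_cube)
  finally have "\<bar>(2 * \<delta> + \<delta> * \<delta>) * c\<bar> \<le> 15 * (Q ^ 3 / N)" .
  moreover have "0 \<le> Q / N" using Q by simp
  ultimately show "\<bar>(S / N)\<^sup>2 * c - c\<bar> < \<epsilon>"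
    unfolding eq using fin[unfolded e] Q3 by linarith
qed

section \<open>Realising a prescribed closed strand as the slices of a Lagrangian plane\<close>

lemma real_polynomial_function_smooth:
  "real_polynomial_function p \<Longrightarrow> smooth_on UNIV (p :: 'a::euclidean_space \<Rightarrow> real)"
proof (induction rule: real_polynomial_function.induct)
  case (linear f)
  then show ?case using smooth_on_bounded_linear_comp[OF open_UNIV _ smooth_on_id[OF open_UNIV]] by blast
qed (auto intro!: smooth_on_add smooth_on_mult smooth_on_const)

text \<open>A Lagrangian immersion of the whole plane, expressed in the rotated coordinates, where
  the symplectic form is minus the imaginary part of \<open>da\<^sub>1 \<and> da\<^sub>2\<close>.
  The last clause is a quantitative form of properness.\<close>

definition lagrangian_plane :: "(complex \<Rightarrow> complex \<times> complex) \<Rightarrow> bool" where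
  "lagrangian_plane F \<longleftrightarrow> smooth_on UNIV F \<and>
    (\<forall>w. inj (frechet_derivative F (at w))) \<and>
    (\<forall>w u v. Im (fst (frechet_derivative F (at w) u) * snd (frechet_derivative F (at w) v) -
       fst (frechet_derivative F (at w) v) * snd (frechet_derivative F (at w) u)) = 0) \<and>
    (\<forall>w. norm w \<ge> 1 \<longrightarrow> norm w \<le> norm (F w))"

text \<open>In the coordinates \<open>(\<zeta>, z)\<close> of the solid torus, the slice of radius \<open>R\<close> is
  \<open>\<omega> \<mapsto> (\<omega>\<^sup>m, z)\<close>, where \<open>\<omega>\<^sup>m z\<close> is \<open>Y\<close>, up to an error \<open>e\<close>, contracted by different factors
  in the real and the imaginary direction.\<close>

definition braid_slice ::
  "(complex \<Rightarrow> complex \<times> complex) \<Rightarrow> nat \<Rightarrow> (complex \<Rightarrow> complex) \<Rightarrow> real \<Rightarrow> real \<Rightarrow> (complex \<Rightarrow> complex) \<Rightarrow> bool" where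
  "braid_slice F m Y e R \<psi> \<longleftrightarrow> smooth_map (sphere 0 1) \<psi> \<and> {w. norm (F w) = R} = \<psi> ` sphere 0 1 \<and>
       (\<forall>\<omega>\<in>sphere 0 1. fst (F (\<psi> \<omega>)) \<noteq> 0 \<and> sgn (fst (F (\<psi> \<omega>))) = \<omega> ^ m \<and>
         (\<exists>a b. \<bar>a - Re (Y \<omega>)\<bar> < e \<and> \<bar>b - Im (Y \<omega>)\<bar> < e \<and>
           \<omega> ^ m * (snd (F (\<psi> \<omega>)) / of_real (norm (fst (F (\<psi> \<omega>))))) = Complex (a / R\<^sup>2) (2 * b / R ^ 4)))"

text \<open>Polynomials approximating the two parts of \<open>Y\<close> supply the angular and
  radial data of the potential. Outside a compact set the squared norm \<open>E\<close> increases
  along rays, so \<open>E\<close> can replace the radius as a coordinate; the slice of radius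
  \<open>R\<close> is then parametrised smoothly by the argument of \<open>w\<close>.\<close>

lemma lagrangian_plane_asymptotics:
  fixes Y :: "complex \<Rightarrow> complex"
  assumes m: "m \<ge> 1" and Y: "continuous_on (sphere 0 1) Y" and \<epsilon>: "\<epsilon> > 0"
    and mean: "\<bar>integral {0..2 * pi} (\<lambda>t. Re (Y (cis t)))\<bar> < \<epsilon>"
  obtains F :: "complex \<Rightarrow> complex \<times> complex" and R0 where "R0 > 0" "lagrangian_plane F"
    "\<forall>R\<ge>R0. \<forall>w. norm (F w) = R \<longrightarrow> frechet_derivative F (at w) w \<bullet> F w \<noteq> 0"
    "\<forall>R\<ge>R0. \<exists>\<psi>. braid_slice F m Y (5 * \<epsilon>) R \<psi>"
proof -
  have cpt: "compact (sphere (0::complex) 1)" by simp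
  obtain x1 where x1: "real_polynomial_function x1" "\<And>\<omega>. \<omega> \<in> sphere 0 1 \<Longrightarrow> \<bar>Re (Y \<omega>) - x1 \<omega>\<bar> < \<epsilon>"
    using Stone_Weierstrass_real_polynomial_function[OF cpt continuous_on_Re[OF Y] \<epsilon>] by metis
  obtain c where c: "real_polynomial_function c" "\<And>\<omega>. \<omega> \<in> sphere 0 1 \<Longrightarrow> \<bar>Im (Y \<omega>) - c \<omega>\<bar> < \<epsilon>"
    using Stone_Weierstrass_real_polynomial_function[OF cpt continuous_on_Im[OF Y] \<epsilon>] by metis
  \<comment> \<open>The approximation does not preserve the mean exactly, whereas the primitive
    needs mean zero. The mean of \<open>Re Y\<close> is small, so subtracting \<open>\<mu>\<close>
    costs less than \<open>2 * \<epsilon>\<close>.\<close>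
  define \<mu> where "\<mu> = integral {0..2 * pi} (\<lambda>t. x1 (cis t)) / (2 * pi)"
  define x where "x \<omega> = x1 \<omega> - \<mu>" for \<omega>
  have sx1: "smooth_on UNIV x1" and sc: "smooth_on UNIV c"
    using x1 c by (auto intro: real_polynomial_function_smooth)
  then have sx: "smooth_on UNIV x" unfolding x_def by (intro smooth_on_diff smooth_on_const open_UNIV)
  have int_x1: "(\<lambda>t. x1 (cis t)) integrable_on {0..2 * pi}"
    by (intro integrable_continuous_interval continuous_on_compose2[OF smooth_on_continuous[OF sx1]] continuous_intros) auto
  have int_Y: "(\<lambda>t. Re (Y (cis t))) integrable_on {0..2 * pi}"
    by (intro integrable_continuous_interval continuous_intros continuous_on_compose2[OF Y]) (auto simp: norm_cis)
  have int0: "integral {0..2 * pi} (\<lambda>t. x (cis t)) = 0"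
  proof -
    have "integral {0..2 * pi} (\<lambda>t. x1 (cis t) - \<mu>) = integral {0..2 * pi} (\<lambda>t. x1 (cis t)) - integral {0..2 * pi} (\<lambda>t. \<mu>)"
      by (rule Henstock_Kurzweil_Integration.integral_diff[OF int_x1 integrable_const_ivl])
    then show ?thesis by (simp add: x_def \<mu>_def)
  qed
  have \<mu>: "\<bar>\<mu>\<bar> < 2 * \<epsilon>"
  proof -
    have "\<bar>integral {0..2 * pi} (\<lambda>t. x1 (cis t)) - integral {0..2 * pi} (\<lambda>t. Re (Y (cis t)))\<bar> \<le> \<epsilon> * (2 * pi)"
    proof -
      have "norm (integral {0..2 * pi} (\<lambda>t. x1 (cis t) - Re (Y (cis t)))) \<le> \<epsilon> * (2 * pi - 0)"
      proof (rule integral_bound)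
        show "continuous_on {0..2 * pi} (\<lambda>t. x1 (cis t) - Re (Y (cis t)))"
          by (intro continuous_intros continuous_on_compose2[OF Y] continuous_on_compose2[OF smooth_on_continuous[OF sx1]])
            (auto simp: norm_cis)
        show "norm (x1 (cis t) - Re (Y (cis t))) \<le> \<epsilon>" for t
          using x1(2)[of "cis t"] by (simp add: norm_cis)
      qed simp
      then show ?thesis by (simp add: Henstock_Kurzweil_Integration.integral_diff[OF int_x1 int_Y])
    qed
    then have "\<bar>integral {0..2 * pi} (\<lambda>t. x1 (cis t))\<bar> < \<epsilon> * (2 * pi) + \<epsilon>" using mean by linarith
    also have "\<dots> \<le> 2 * \<epsilon> * (2 * pi)"
    proof -
      have "\<epsilon> * 1 \<le> \<epsilon> * (2 * pi)" using pi_ge_two \<epsilon> by (intro mult_left_mono) auto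
      then show ?thesis by linarith
    qed
    finally show ?thesis by (simp add: \<mu>_def abs_divide divide_less_eq)
  qed
  have x_Y: "\<bar>x \<omega> - Re (Y \<omega>)\<bar> < 3 * \<epsilon>" if "\<omega> \<in> sphere 0 1" for \<omega>
    using x1(2)[OF that] \<mu> unfolding x_def by linarith
  obtain G d where sG: "smooth_on UNIV G" and G0: "inj (frechet_derivative G (at 0))" and dc: "continuous_on UNIV d"
    and lag: "\<forall>w u v. Im (of_nat m * w ^ (m - 1) * u * frechet_derivative G (at w) v -
      of_nat m * w ^ (m - 1) * v * frechet_derivative G (at w) u) = 0"
    and Gout: "\<forall>w. norm w > 1 \<longrightarrow> G w = Complex (x (sgn w) - d (sgn w) / norm w ^ (2 * m)) (2 * c (sgn w) / norm w ^ (2 * m)) / w ^ m"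
    by (rule asymptotic_lagrangian_graph[OF m sx sc int0])
  have bounded: "\<exists>Q. \<forall>\<omega>\<in>sphere 0 1. \<bar>f \<omega>\<bar> \<le> Q" if "continuous_on UNIV f" for f :: "complex \<Rightarrow> real"
  proof -
    have "bounded (f ` sphere 0 1)"
      using that by (intro compact_imp_bounded compact_continuous_image) (auto intro: continuous_on_subset)
    then show ?thesis by (auto simp: bounded_iff)
  qed
  obtain Q1 where Q1: "\<And>\<omega>. \<omega> \<in> sphere 0 1 \<Longrightarrow> \<bar>x \<omega>\<bar> \<le> Q1"
    using bounded[OF smooth_on_continuous[OF sx]] by blast
  obtain Q2 where Q2: "\<And>\<omega>. \<omega> \<in> sphere 0 1 \<Longrightarrow> \<bar>d \<omega>\<bar> \<le> Q2" using bounded[OF dc] by blast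
  obtain Q3 where Q3: "\<And>\<omega>. \<omega> \<in> sphere 0 1 \<Longrightarrow> \<bar>c \<omega>\<bar> \<le> Q3"
    using bounded[OF smooth_on_continuous[OF sc]] by blast
  define Q where "Q = max Q1 (max Q2 (2 * Q3))"
  have Qb: "\<bar>x \<omega>\<bar> \<le> Q" "\<bar>d \<omega>\<bar> \<le> Q" "\<bar>2 * c \<omega>\<bar> \<le> Q" if "\<omega> \<in> sphere 0 1" for \<omega>
    using Q1[OF that] Q2[OF that] Q3[OF that] unfolding Q_def by linarith+
  have Q: "Q \<ge> 0" using Qb(1)[of 1] by auto
  define F where "F w = (w ^ m, G w)" for w
  have sF: "smooth_on UNIV F" unfolding F_def by (intro smooth_on_Pair smooth_on_power smooth_on_id sG open_UNIV)
  have DF: "frechet_derivative F (at w) = (\<lambda>v. (of_nat m * w ^ (m - 1) * v, frechet_derivative G (at w) v))" for w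
  proof -
    have "((\<lambda>w. w ^ m) has_field_derivative (of_nat m * w ^ (m - 1))) (at w)"
      by (rule DERIV_cong[OF DERIV_power[OF DERIV_ident]]) simp
    then have "(F has_derivative (\<lambda>v. (of_nat m * w ^ (m - 1) * v, frechet_derivative G (at w) v))) (at w)"
      unfolding has_field_derivative_def F_def[abs_def]
      by (rule has_derivative_Pair) (use smooth_on_derivative(1)[OF sG] in simp)
    then show ?thesis by (rule frechet_derivative_at[symmetric])
  qed
  have norm_ge: "norm w \<le> norm (F w)" if "norm w \<ge> 1" for w
  proof -
    have "norm w \<le> norm w ^ m" using that m by (intro self_le_power) auto
    also have "\<dots> \<le> norm (F w)" using norm_fst_le[of "w ^ m" "G w"] by (simp add: F_def norm_power)
    finally show ?thesis .
  qed
  define E where "E w = F w \<bullet> F w" for w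
  have E_norm: "E w = (norm (F w))\<^sup>2" for w by (simp add: E_def dot_square_norm)
  have sE: "smooth_on UNIV E" unfolding E_def by (intro smooth_on_inner sF open_UNIV)
  have DE: "frechet_derivative E (at w) v = 2 * (frechet_derivative F (at w) v \<bullet> F w)" for w v
  proof -
    have "(F has_derivative frechet_derivative F (at w)) (at w)" using smooth_on_derivative(1)[OF sF] by simp
    from has_derivative_inner[OF this this]
    have "(E has_derivative (\<lambda>v. F w \<bullet> frechet_derivative F (at w) v + frechet_derivative F (at w) v \<bullet> F w)) (at w)"
      unfolding E_def[abs_def] .
    from frechet_derivative_at[OF this, symmetric] show ?thesis by (simp add: inner_commute)
  qed
  let ?e = "\<lambda>\<omega> N. N + ((x \<omega> - d \<omega> / N)\<^sup>2 + (2 * c \<omega> / N)\<^sup>2) / N"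
  have E_out: "E w = ?e (sgn w) (norm w ^ (2 * m))" if w: "norm w > 1" for w
  proof -
    have "E w = (norm (w ^ m))\<^sup>2 + (norm (G w))\<^sup>2"
      unfolding E_norm F_def norm_prod_def by simp
    moreover have "(norm (w ^ m))\<^sup>2 = norm w ^ (2 * m)" by (simp add: norm_power power_mult[symmetric] mult.commute)
    moreover have "(norm (G w))\<^sup>2 = ((x (sgn w) - d (sgn w) / norm w ^ (2 * m))\<^sup>2 + (2 * c (sgn w) / norm w ^ (2 * m))\<^sup>2) / norm w ^ (2 * m)"
    proof -
      have "(norm (Complex A B / W))\<^sup>2 = (A\<^sup>2 + B\<^sup>2) / (norm W)\<^sup>2" for A B W
        by (simp only: norm_divide power_divide) (simp add: complex_norm)
      then show ?thesis unfolding Gout[rule_format, OF w] by (simp only: \<open>(norm (w ^ m))\<^sup>2 = norm w ^ (2 * m)\<close>)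
    qed
    ultimately show ?thesis by simp
  qed
  define U where "U = {w::complex. norm w > 1 + 4 * Q}"
  have opU: "open U" unfolding U_def by (intro open_Collect_less continuous_intros)
  have U1: "norm w > 1" "w \<noteq> 0" "norm w ^ (2 * m) > 1 + 4 * Q" "sgn w \<in> sphere 0 1" if "w \<in> U" for w
  proof -
    show 1: "norm w > 1" using that Q by (auto simp: U_def)
    then show "w \<noteq> 0" by auto
    then show "sgn w \<in> sphere 0 1" by (simp add: norm_sgn)
    have "norm w \<le> norm w ^ (2 * m)" using 1 m by (intro self_le_power) auto
    then show "norm w ^ (2 * m) > 1 + 4 * Q" using that by (simp add: U_def)
  qed
  \<comment> \<open>Along the ray through \<open>w\<close> the argument is fixed and
    \<open>N\<close> varies as \<open>t ^ (2 * m)\<close> times its value at \<open>w\<close>, so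
    the chain rule at \<open>t = 1\<close> reduces the claim to the derivative of the energy in
    \<open>N\<close>.\<close>
  have radial: "frechet_derivative E (at w) w > 0" if w: "w \<in> U" for w
  proof -
    let ?N = "norm w ^ (2 * m)"
    note w1 = U1[OF w]
    obtain e' where e': "e' > 0" "(?e (sgn w) has_real_derivative e') (at ?N)"
      by (rule radial_energy_deriv[OF Qb[OF w1(4)] w1(3)])
    have "((\<lambda>t. t ^ (2 * m) * ?N) has_real_derivative of_nat (2 * m) * ?N) (at 1)"
      by (auto intro!: derivative_eq_intros)
    then have 1: "((\<lambda>t. ?e (sgn w) (t ^ (2 * m) * ?N)) has_real_derivative e' * (of_nat (2 * m) * ?N)) (at 1)"
      using DERIV_chain2[of "?e (sgn w)" e' "\<lambda>t. t ^ (2 * m) * ?N" 1] e'(2) by simp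
    have "((\<lambda>t. E (t *\<^sub>R w)) has_real_derivative e' * (of_nat (2 * m) * ?N)) (at 1)"
    proof (rule has_field_derivative_transform_within_open[OF 1])
      show "open {t. t > inverse (norm w)}" "(1::real) \<in> {t. t > inverse (norm w)}"
        using w1(1) by (auto simp: open_Collect_less inverse_less_1_iff)
      fix t assume "t \<in> {t. t > inverse (norm w)}"
      then have t: "t > inverse (norm w)" by simp
      moreover have "inverse (norm w) > 0" using w1(1) by auto
      ultimately have t0: "t > 0" by linarith
      have tw: "norm (t *\<^sub>R w) > 1" using mult_strict_right_mono[OF t, of "norm w"] t0 w1(1,2) by simp
      have "sgn (t *\<^sub>R w) = sgn w" using t0 by (simp only: sgn_scaleR sgn_pos scaleR_one)
      then show "?e (sgn w) (t ^ (2 * m) * ?N) = E (t *\<^sub>R w)"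
        unfolding E_out[OF tw] using t0 by (simp add: power_mult_distrib)
    qed
    moreover have "((\<lambda>t. E (t *\<^sub>R w)) has_real_derivative frechet_derivative E (at w) w) (at 1)"
    proof -
      have D: "(E has_derivative frechet_derivative E (at w)) (at (1 *\<^sub>R w))"
        using smooth_on_derivative(1)[OF sE] by simp
      have "((\<lambda>t. t *\<^sub>R w) has_derivative (\<lambda>r. r *\<^sub>R w)) (at 1)"
        by (auto intro!: derivative_eq_intros)
      from diff_chain_at[OF this D] show ?thesis
        unfolding has_field_derivative_def using linear_cmul[OF has_derivative_linear[OF D]]
        by (auto simp: o_def elim!: has_derivative_eq_rhs)
    qed
    ultimately have "frechet_derivative E (at w) w = e' * (of_nat (2 * m) * ?N)"
      by (rule DERIV_unique[symmetric])
    moreover have "?N > 0" using w1(2) by simp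
    ultimately show ?thesis using e'(1) m by simp
  qed
  have mono: "E (s *\<^sub>R \<omega>) < E (t *\<^sub>R \<omega>)" if "norm \<omega> = 1" "1 + 4 * Q < s" "s < t" for \<omega> s t
  proof (rule DERIV_pos_imp_increasing[OF that(3)])
    fix r assume r: "s \<le> r" "r \<le> t"
    have rU: "r *\<^sub>R \<omega> \<in> U" using that r Q by (simp add: U_def)
    have r0: "r > 0" using that r Q by linarith
    have D: "(E has_derivative frechet_derivative E (at (r *\<^sub>R \<omega>))) (at (r *\<^sub>R \<omega>))"
      using smooth_on_derivative(1)[OF sE] by simp
    have "((\<lambda>t. t *\<^sub>R \<omega>) has_derivative (\<lambda>h. h *\<^sub>R \<omega>)) (at r)" by (auto intro!: derivative_eq_intros)
    from diff_chain_at[OF this D]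
    have "((\<lambda>r. E (r *\<^sub>R \<omega>)) has_real_derivative frechet_derivative E (at (r *\<^sub>R \<omega>)) \<omega>) (at r)"
      unfolding has_field_derivative_def using linear_cmul[OF has_derivative_linear[OF D]]
      by (auto simp: o_def elim!: has_derivative_eq_rhs)
    moreover have "frechet_derivative E (at (r *\<^sub>R \<omega>)) \<omega> > 0"
      using radial[OF rU] linear_cmul[OF has_derivative_linear[OF D], of r \<omega>] r0 by (simp add: zero_less_mult_iff)
    ultimately show "\<exists>y. ((\<lambda>r. E (r *\<^sub>R \<omega>)) has_real_derivative y) (at r) \<and> 0 < y" by blast
  qed
  have E_pos: "E w > 0" if "w \<in> U" for w
  proof -
    have "norm (F w) > 0" using norm_ge[of w] U1(1)[OF that] by linarith
    then show ?thesis by (simp add: E_norm)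
  qed
  \<comment> \<open>\<open>T\<close> keeps every ray and replaces the distance from the origin by
    \<open>E\<close>, so level sets of \<open>E\<close> become round circles. Its smooth inverse
    gives the parametrisation \<open>\<psi>\<close> of the slices.\<close>
  define T where "T w = E w *\<^sub>R sgn w" for w
  have U0: "U \<subseteq> - {0}" using U1(2) by auto
  have sT: "smooth_on U T"
    unfolding T_def
    by (intro smooth_on_scaleR opU smooth_on_subset[OF sE] smooth_on_subset[OF smooth_on_sgn U0]) auto
  have sgnT: "sgn (T w) = sgn w" "norm (T w) = E w" if "w \<in> U" for w
  proof -
    have "sgn (E w) = 1" using E_pos[OF that] by simp
    then show "sgn (T w) = sgn w" unfolding T_def sgn_scaleR by simp
    show "norm (T w) = E w" using E_pos[OF that] U1(2)[OF that] by (simp add: T_def norm_sgn)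
  qed
  have wform: "w = norm w *\<^sub>R sgn w" for w :: complex
    by (cases "w = 0") (simp_all add: sgn_div_norm)
  have injT: "inj_on T U"
  proof (rule inj_onI)
    fix w z assume w: "w \<in> U" and z: "z \<in> U" and eq: "T w = T z"
    have s: "sgn w = sgn z" "E w = E z" using sgnT[OF w] sgnT[OF z] eq by auto
    have "norm (sgn w) = 1" using U1(2)[OF w] by (simp add: norm_sgn)
    then have "\<not> norm w < norm z" "\<not> norm z < norm w"
      using mono[of "sgn w" "norm w" "norm z"] mono[of "sgn w" "norm z" "norm w"] wform[of w] wform[of z] s w z
      by (auto simp: U_def)
    then have "norm w = norm z" by simp
    then show "w = z" using wform[of w] wform[of z] s by simp
  qed
  have injDT: "inj (frechet_derivative T (at w))" if w: "w \<in> U" for w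
  proof -
    let ?t = "\<lambda>v. Im (cnj w * v) / (norm w)\<^sup>2"
    have "(E has_derivative frechet_derivative E (at w)) (at w)"
      using smooth_on_derivative(1)[OF sE] by simp
    from has_derivative_scaleR[OF this has_derivative_sgn_complex[OF U1(2)[OF w]]]
    have D: "(T has_derivative (\<lambda>v. E w *\<^sub>R (?t v *\<^sub>R (\<i> * sgn w)) + frechet_derivative E (at w) v *\<^sub>R sgn w)) (at w)"
      unfolding T_def[abs_def] .
    have lin: "linear (frechet_derivative T (at w))"
      using has_derivative_linear[OF D] frechet_derivative_at[OF D] by simp
    show ?thesis
      unfolding linear_injective_0[OF lin]
    proof (intro allI impI)
      fix v assume "frechet_derivative T (at w) v = 0"
      \<comment> \<open>In the frame \<open>sgn w\<close>, \<open>\<i> * sgn w\<close> the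
        components of the derivative of \<open>T\<close> are that of \<open>E\<close> and
        \<open>E\<close> times the differential of the argument. If both vanish, \<open>v\<close> is
        radial, and in the radial direction \<open>E\<close> has positive derivative.\<close>
      moreover have "e *\<^sub>R (t *\<^sub>R (\<i> * z)) + b *\<^sub>R z = Complex b (e * t) * z" for e t b z
        by (simp add: complex_eq_iff algebra_simps)
      ultimately have "Complex (frechet_derivative E (at w) v) (E w * ?t v) * sgn w = 0"
        unfolding frechet_derivative_at[OF D, symmetric] by (simp only:)
      then have "Complex (frechet_derivative E (at w) v) (E w * ?t v) = 0"
        using U1(2)[OF w] by (simp add: sgn_zero_iff)
      then have 0: "frechet_derivative E (at w) v = 0" "?t v = 0"
        using E_pos[OF w] by (auto simp: complex_eq_iff)
      have n0: "of_real ((norm w)\<^sup>2) \<noteq> (0::complex)" using U1(2)[OF w] by simp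
      have "Im (cnj w * v) = 0" using 0(2) U1(2)[OF w] by simp
      then have "cnj w * v = of_real (Re (cnj w * v))" by (simp add: complex_eq_iff)
      then have "w * cnj w * v = of_real (Re (cnj w * v)) * w" by (simp add: mult.assoc)
      then have "v = of_real (Re (cnj w * v)) * w / of_real ((norm w)\<^sup>2)"
        unfolding complex_norm_square[symmetric] using n0 by (simp add: field_simps)
      then have v: "v = (Re (cnj w * v) / (norm w)\<^sup>2) *\<^sub>R w" by (simp add: scaleR_conv_of_real)
      then have "frechet_derivative E (at w) v = (Re (cnj w * v) / (norm w)\<^sup>2) * frechet_derivative E (at w) w"
        using linear_cmul[OF has_derivative_linear[OF smooth_on_derivative(1)[OF sE]], of w "Re (cnj w * v) / (norm w)\<^sup>2" w] by simp
      then have eq0: "Re (cnj w * v) / (norm w)\<^sup>2 = 0" using 0(1) radial[OF w] by simp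
      show "v = 0" by (subst v) (simp only: eq0 scaleR_zero_left)
    qed
  qed
  have inv: "open (T ` U)" "smooth_on (T ` U) (inv_into U T)"
    using smooth_on_inverse_function[OF opU sT injT] injDT by auto
  let ?r = "2 + 4 * Q"
  have "bounded (F ` cball 0 ?r)"
    by (intro compact_imp_bounded compact_continuous_image continuous_on_subset[OF smooth_on_continuous[OF sF]]) auto
  then obtain M where "\<forall>w\<in>cball 0 ?r. norm (F w) \<le> M" by (auto simp: bounded_iff)
  then have M: "norm (F w) \<le> M" if "norm w \<le> ?r" for w using that by simp
  \<comment> \<open>Exceeding \<open>M\<close> keeps the slices away from the ball of radius
    \<open>?r\<close>, hence inside \<open>U\<close>. The other entry is the threshold of
    \<open>slice_estimates\<close>, which applies to \<open>R\<^sup>2\<close> because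
    \<open>R \<ge> 1\<close> gives \<open>R\<^sup>2 \<ge> R\<close>.\<close>
  define R0 where "R0 = max (max 1 (M + 1)) (2 * Q + 1 + (25 * Q ^ 3 + Q) / \<epsilon>)"
  have R0: "R0 \<ge> 1" "R0 > M" "R0 \<ge> 2 * Q + 1 + (25 * Q ^ 3 + Q) / \<epsilon>" by (auto simp: R0_def)
  have in_U: "w \<in> U" if "norm (F w) \<ge> R0" for w
  proof -
    have "\<not> norm w \<le> ?r" using M[of w] that R0(2) by linarith
    then show ?thesis by (simp add: U_def)
  qed
  show thesis
  proof (rule that[of R0 F])
    show "R0 > 0" using R0 by simp
    have "inj (frechet_derivative F (at w))" for w
    proof (cases "w = 0")
      case True
      then show ?thesis using G0 by (auto simp: DF inj_def)
    next
      case False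
      then show ?thesis using m by (auto simp: DF inj_def)
    qed
    then have "\<forall>w. inj (frechet_derivative F (at w))" by blast
    moreover have "\<forall>w u v. Im (fst (frechet_derivative F (at w) u) * snd (frechet_derivative F (at w) v) -
       fst (frechet_derivative F (at w) v) * snd (frechet_derivative F (at w) u)) = 0"
      unfolding DF fst_conv snd_conv by (rule lag)
    moreover have "\<forall>w. norm w \<ge> 1 \<longrightarrow> norm w \<le> norm (F w)" using norm_ge by blast
    ultimately show "lagrangian_plane F" using sF unfolding lagrangian_plane_def by blast
    have "frechet_derivative F (at w) w \<bullet> F w \<noteq> 0" if "R \<ge> R0" "norm (F w) = R" for R w
      using radial[OF in_U[of w]] that by (simp add: DE)
    then show "\<forall>R\<ge>R0. \<forall>w. norm (F w) = R \<longrightarrow> frechet_derivative F (at w) w \<bullet> F w \<noteq> 0" by blast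
    show "\<forall>R\<ge>R0. \<exists>\<psi>. braid_slice F m Y (5 * \<epsilon>) R \<psi>"
    proof (intro allI impI)
    fix R assume R: "R \<ge> R0"
    then have R1: "R \<ge> 1" using R0 by simp
    have "R * 1 \<le> R * R" using R1 by (intro mult_left_mono) auto
    then have R2: "R\<^sup>2 \<ge> R" by (simp add: power2_eq_square)
    have ex: "\<exists>w\<in>U. sgn w = \<omega> \<and> E w = R\<^sup>2" if \<omega>: "\<omega> \<in> sphere 0 1" for \<omega>
    proof -
      \<comment> \<open>At the inner end \<open>norm (F w)\<close> is at most \<open>M < R\<close>;
        at the outer end it is at least \<open>norm w \<ge> R\<close>. The intermediate value
        theorem gives the crossing.\<close>
      let ?s = "max R ?r"
      have n1: "norm \<omega> = 1" using \<omega> by simp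
      have "E (?r *\<^sub>R \<omega>) \<le> R\<^sup>2"
        unfolding E_norm using M[of "?r *\<^sub>R \<omega>"] n1 R R0 Q by (intro power_mono) auto
      moreover have "R\<^sup>2 \<le> E (?s *\<^sub>R \<omega>)"
        unfolding E_norm using norm_ge[of "?s *\<^sub>R \<omega>"] n1 R1 by (intro power_mono) auto
      moreover have "continuous_on {?r..?s} (\<lambda>r. E (r *\<^sub>R \<omega>))"
        by (intro continuous_on_compose2[OF smooth_on_continuous[OF sE]] continuous_intros) auto
      ultimately obtain r where r: "?r \<le> r" "r \<le> ?s" "E (r *\<^sub>R \<omega>) = R\<^sup>2"
        using IVT'[of "\<lambda>r. E (r *\<^sub>R \<omega>)" ?r "R\<^sup>2" ?s] by auto
      have "r > 0" using r(1) Q by linarith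
      then have "sgn (r *\<^sub>R \<omega>) = \<omega>" using n1 by (simp add: sgn_scaleR sgn_div_norm del: scaleR_conv_of_real)
      moreover have "r *\<^sub>R \<omega> \<in> U" using r(1) n1 Q by (simp add: U_def)
      ultimately show ?thesis using r(3) by blast
    qed
    define \<psi> where "\<psi> \<omega> = inv_into U T (R\<^sup>2 *\<^sub>R \<omega>)" for \<omega>
    have \<psi>: "\<psi> \<omega> \<in> U" "sgn (\<psi> \<omega>) = \<omega>" "E (\<psi> \<omega>) = R\<^sup>2" and mem: "R\<^sup>2 *\<^sub>R \<omega> \<in> T ` U" if \<omega>: "\<omega> \<in> sphere 0 1" for \<omega>
    proof -
      obtain w where w: "w \<in> U" "sgn w = \<omega>" "E w = R\<^sup>2" using ex[OF \<omega>] by blast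
      then have Tw: "T w = R\<^sup>2 *\<^sub>R \<omega>" by (simp add: T_def)
      then have "\<psi> \<omega> = w" unfolding \<psi>_def using inv_into_f_f[OF injT w(1)] by simp
      then show "\<psi> \<omega> \<in> U" "sgn (\<psi> \<omega>) = \<omega>" "E (\<psi> \<omega>) = R\<^sup>2" using w by auto
      show "R\<^sup>2 *\<^sub>R \<omega> \<in> T ` U" using Tw w(1) by (metis imageI)
    qed
    let ?W = "(\<lambda>\<omega>. R\<^sup>2 *\<^sub>R \<omega>) -` (T ` U)"
    have opW: "open ?W"
      by (rule open_vimage[OF inv(1)]) (intro continuous_intros)
    have "smooth_on ?W (\<lambda>\<omega>. R\<^sup>2 *\<^sub>R \<omega>)" by (intro smooth_on_scaleR smooth_on_const smooth_on_id opW)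
    then have "smooth_on ?W \<psi>"
      unfolding \<psi>_def by (intro smooth_on_compose[OF opW inv(1) _ inv(2)]) auto
    moreover have "sphere 0 1 \<subseteq> ?W" using mem by auto
    ultimately have s\<psi>: "smooth_map (sphere 0 1) \<psi>" using smooth_mapI[OF opW] by blast
    have img: "{w. norm (F w) = R} = \<psi> ` sphere 0 1"
    proof (intro equalityI subsetI)
      fix w assume "w \<in> {w. norm (F w) = R}"
      then have w: "norm (F w) = R" by simp
      have wU: "w \<in> U" using in_U[of w] w R by simp
      have "T w = R\<^sup>2 *\<^sub>R sgn w" by (simp add: T_def E_norm w)
      then have "\<psi> (sgn w) = w" unfolding \<psi>_def using inv_into_f_f[OF injT wU] by simp
      then show "w \<in> \<psi> ` sphere 0 1" using U1(4)[OF wU] by (metis imageI)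
    next
      fix w assume "w \<in> \<psi> ` sphere 0 1"
      then have "E w = R\<^sup>2" using \<psi>(3) by auto
      then show "w \<in> {w. norm (F w) = R}" using R1 by (simp add: E_norm)
    qed
    have asym: "fst (F (\<psi> \<omega>)) \<noteq> 0 \<and> sgn (fst (F (\<psi> \<omega>))) = \<omega> ^ m \<and>
         (\<exists>a b. \<bar>a - Re (Y \<omega>)\<bar> < 5 * \<epsilon> \<and> \<bar>b - Im (Y \<omega>)\<bar> < 5 * \<epsilon> \<and>
           \<omega> ^ m * (snd (F (\<psi> \<omega>)) / of_real (norm (fst (F (\<psi> \<omega>))))) = Complex (a / R\<^sup>2) (2 * b / R ^ 4))"
      if \<omega>: "\<omega> \<in> sphere 0 1" for \<omega>
    proof -
      define w where "w = \<psi> \<omega>"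
      have w: "w \<in> U" "sgn w = \<omega>" "E w = R\<^sup>2" using \<psi>[OF \<omega>] by (auto simp: w_def)
      note w1 = U1[OF w(1)]
      let ?N = "norm w ^ (2 * m)"
      have N0: "?N > 0" using w1(2) by simp
      \<comment> \<open>\<open>a\<close> and \<open>b\<close> are solved from
        \<open>a / R\<^sup>2 = (x \<omega> - d \<omega> / ?N) / ?N\<close> and
        \<open>2 * b / R ^ 4 = 2 * c \<omega> / ?N\<^sup>2\<close>, the two coordinates of the slice
        after the phase \<open>\<omega> ^ m\<close> is removed.\<close>
      define a where "a = R\<^sup>2 / ?N * (x \<omega> - d \<omega> / ?N)"
      define b where "b = (R\<^sup>2 / ?N)\<^sup>2 * c \<omega>"
      have big: "R\<^sup>2 \<ge> 2 * Q + 1 + (25 * Q ^ 3 + Q) / \<epsilon>" using R2 R R0(3) by linarith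
      have S: "R\<^sup>2 = ?e \<omega> ?N" using E_out[OF w1(1)] w by simp
      have "\<bar>a - x \<omega>\<bar> < \<epsilon>" "\<bar>b - c \<omega>\<bar> < \<epsilon>"
        unfolding a_def b_def using slice_estimates[OF Qb[OF \<omega>] w1(3) \<epsilon> S big] by auto
      \<comment> \<open>In the real part the approximation costs \<open>\<epsilon>\<close>, the
        removed mean \<open>2 * \<epsilon>\<close> and the change from \<open>?N\<close> to
        \<open>R\<^sup>2\<close> another \<open>\<epsilon>\<close>; the imaginary part has no mean
        to remove.\<close>
      then have ab: "\<bar>a - Re (Y \<omega>)\<bar> < 5 * \<epsilon>" "\<bar>b - Im (Y \<omega>)\<bar> < 5 * \<epsilon>"
        using x_Y[OF \<omega>] c(2)[OF \<omega>] \<epsilon> by linarith+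
      have wm: "w ^ m = of_real (norm w ^ m) * \<omega> ^ m"
      proof -
        have "w = of_real (norm w) * \<omega>" using wform[of w] w(2) by (simp add: scaleR_conv_of_real)
        then have "w ^ m = (of_real (norm w) * \<omega>) ^ m" by simp
        then show ?thesis by (simp add: power_mult_distrib)
      qed
      have \<omega>0: "\<omega> \<noteq> 0" using \<omega> by auto
      have "\<omega> ^ m * (G w / of_real (norm (w ^ m))) = Complex (x \<omega> - d \<omega> / ?N) (2 * c \<omega> / ?N) / of_real ?N"
      proof -
        have N2: "of_real ?N = (of_real (norm w ^ m) * of_real (norm w ^ m) :: complex)"
          by (simp add: mult_2 power_add)
        have "o1 * (z / (p * o1) / p) = z / (p * p)" if "o1 \<noteq> 0" for o1 p z :: complex
          using that by simp
        from this[of "\<omega> ^ m"] show ?thesis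
          unfolding norm_power unfolding Gout[rule_format, OF w1(1)] w(2) unfolding wm N2 using \<omega>0 by simp
      qed
      also have "\<dots> = Complex (a / R\<^sup>2) (2 * b / R ^ 4)"
        using R1 N0 by (simp add: complex_eq_iff a_def b_def power_divide) (simp add: field_simps power2_eq_square power4_eq_xxxx)
      finally have "\<omega> ^ m * (G w / of_real (norm (w ^ m))) = Complex (a / R\<^sup>2) (2 * b / R ^ 4)" .
      moreover have "sgn (w ^ m) = \<omega> ^ m"
        unfolding w(2)[symmetric] by (induction m) (simp_all add: sgn_mult)
      ultimately show ?thesis
        using ab w1(2) unfolding w_def[symmetric] F_def fst_conv snd_conv by auto
    qed
    show "\<exists>\<psi>. braid_slice F m Y (5 * \<epsilon>) R \<psi>"
      unfolding braid_slice_def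
      using s\<psi> img asym by blast
    qed
  qed
qed

section \<open>Closed braids as coverings of the circle\<close>

lemma smooth_coveringD:
  assumes "smooth_covering N E p B" "x \<in> B"
  obtains T V where "x \<in> T" "openin (top_of_set B) T" "finite V" "card V = N" "\<Union>V = E \<inter> p -` T"
    "\<forall>u\<in>V. openin (top_of_set E) u" "pairwise disjnt V" "\<forall>u\<in>V. \<exists>q. diffeomorphism u T p q"
proof -
  from assms have "\<exists>T. x \<in> T \<and> openin (top_of_set B) T \<and>
        (\<exists>\<V>. finite \<V> \<and> card \<V> = N \<and> \<Union>\<V> = E \<inter> p -` T \<and>
             (\<forall>u\<in>\<V>. openin (top_of_set E) u) \<and> pairwise disjnt \<V> \<and>
             (\<forall>u\<in>\<V>. \<exists>q. diffeomorphism u T p q))"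
    unfolding smooth_covering_def by (elim conjE) (rule bspec)
  then show thesis by (elim exE conjE) (rule that)
qed

lemma braid_local_sheet:
  assumes B: "solid_torus_braid N B" and p: "p \<in> B"
  obtains u T q where "p \<in> u" "openin (top_of_set B) u" "openin (top_of_set (sphere 0 1)) T"
    "diffeomorphism u T fst q" "u \<subseteq> B"
proof -
  have fp: "fst p \<in> sphere 0 1" using B p by (auto simp: solid_torus_braid_def)
  have sc: "smooth_covering N B fst (sphere 0 1)" using B by (simp add: solid_torus_braid_def)
  obtain T V where T: "fst p \<in> T" "openin (top_of_set (sphere 0 1)) T" and "finite V" "card V = N" and V: "\<Union>V = B \<inter> fst -` T"
      "\<forall>u\<in>V. openin (top_of_set B) u" and "pairwise disjnt V" and V3: "\<forall>u\<in>V. \<exists>q. diffeomorphism u T fst q"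
    by (rule smooth_coveringD[OF sc fp])
  have "p \<in> \<Union>V" using V(1) T(1) p by simp
  then obtain u where u: "u \<in> V" "p \<in> u" by blast
  then obtain q where q: "diffeomorphism u T fst q" using V3 by blast
  have op: "openin (top_of_set B) u" using V(2) u(1) by blast
  show thesis by (rule that[OF u(2) op T(2) q openin_imp_subset[OF op]])
qed

lemma diffeomorphism_imp_homeomorphism: "diffeomorphism S T f g \<Longrightarrow> homeomorphism S T f g"
  by (simp add: diffeomorphism_def homeomorphism_def smooth_map_imp_continuous_on)

lemma diffeomorphism_inj: "diffeomorphism S T f g \<Longrightarrow> x \<in> S \<Longrightarrow> y \<in> S \<Longrightarrow> f x = f y \<Longrightarrow> x = y"
  unfolding diffeomorphism_def by metis

lemma braid_covering_space:
  assumes B: "solid_torus_braid N B" and N: "N \<ge> 1"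
  shows "covering_space B fst (sphere 0 1)"
proof
  have sc: "smooth_covering N B fst (sphere 0 1)" using B by (simp add: solid_torus_braid_def)
  show "continuous_on B fst" by (intro continuous_intros)
  show "fst ` B = sphere 0 1"
  proof
    show "fst ` B \<subseteq> sphere 0 1" using B by (auto simp: solid_torus_braid_def)
    show "sphere 0 1 \<subseteq> fst ` B"
    proof
      fix x :: complex assume x: "x \<in> sphere 0 1"
      obtain T V where TV: "x \<in> T" "openin (top_of_set (sphere 0 1)) T" "finite V" "card V = N" "\<Union>V = B \<inter> fst -` T"
      "\<forall>u\<in>V. openin (top_of_set B) u" "pairwise disjnt V" "\<forall>u\<in>V. \<exists>q. diffeomorphism u T fst q"
    by (rule smooth_coveringD[OF sc x])
      have "V \<noteq> {}" using TV(4) N by auto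
      then obtain u q where u: "u \<in> V" "diffeomorphism u T fst q" using TV(8) by blast
      then have "x \<in> fst ` u" using TV(1) by (simp add: diffeomorphism_def)
      then show "x \<in> fst ` B" using TV(5) u(1) by blast
    qed
  qed
  fix x :: complex assume x: "x \<in> sphere 0 1"
  obtain T V where TV: "x \<in> T" "openin (top_of_set (sphere 0 1)) T" "finite V" "card V = N" "\<Union>V = B \<inter> fst -` T"
      "\<forall>u\<in>V. openin (top_of_set B) u" "pairwise disjnt V" "\<forall>u\<in>V. \<exists>q. diffeomorphism u T fst q"
    by (rule smooth_coveringD[OF sc x])
  have "\<forall>u\<in>V. \<exists>q. homeomorphism u T fst q" using TV(8) diffeomorphism_imp_homeomorphism by blast
  then show "\<exists>T. x \<in> T \<and> openin (top_of_set (sphere 0 1)) T \<and> (\<exists>v. \<Union>v = B \<inter> fst -` T \<and>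
      (\<forall>u\<in>v. openin (top_of_set B) u) \<and> pairwise disjnt v \<and> (\<forall>u\<in>v. \<exists>q. homeomorphism u T fst q))"
    using TV(1,2,5,6,7) by (intro exI[of _ T] exI[of _ V] conjI)
qed

lemma braid_finite_fibre:
  assumes B: "solid_torus_braid N B" and x: "x \<in> sphere 0 1"
  shows "finite {p \<in> B. fst p = x}"
proof -
  have sc: "smooth_covering N B fst (sphere 0 1)" using B by (simp add: solid_torus_braid_def)
  obtain T V where TV: "x \<in> T" "openin (top_of_set (sphere 0 1)) T" "finite V" "card V = N" "\<Union>V = B \<inter> fst -` T"
      "\<forall>u\<in>V. openin (top_of_set B) u" "pairwise disjnt V" "\<forall>u\<in>V. \<exists>q. diffeomorphism u T fst q"
    by (rule smooth_coveringD[OF sc x])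
  obtain q where q: "\<forall>u\<in>V. diffeomorphism u T fst (q u)" using bchoice[OF TV(8)] by blast
  have "{p \<in> B. fst p = x} \<subseteq> (\<lambda>u. q u x) ` V"
  proof
    fix p assume p: "p \<in> {p \<in> B. fst p = x}"
    then obtain u where u: "u \<in> V" "p \<in> u" using TV(1,5) by blast
    then have "q u (fst p) = p" using q by (simp add: diffeomorphism_def)
    then show "p \<in> (\<lambda>u. q u x) ` V" using u(1) p by force
  qed
  then show ?thesis using TV(3) finite_surj by blast
qed

text \<open>The constant is a Lebesgue number of the cover of the compact set \<open>B\<close> by
  open sets on which \<open>fst\<close> is injective: distinct points closer than it share such a
  set, so they cannot lie over the same base point.\<close>

lemma braid_strand_separation:
  assumes B: "solid_torus_braid N B"
  obtains d where "d > 0" "\<forall>\<zeta> z z'. (\<zeta>, z) \<in> B \<longrightarrow> (\<zeta>, z') \<in> B \<longrightarrow> z \<noteq> z' \<longrightarrow> d \<le> dist z z'"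
proof -
  define \<G> where "\<G> = {G. open G \<and> inj_on fst (B \<inter> G)}"
  have cover: "B \<subseteq> \<Union>\<G>"
  proof
    fix p assume "p \<in> B"
    obtain u T q where u: "p \<in> u" "openin (top_of_set B) u" "openin (top_of_set (sphere 0 1)) T" "diffeomorphism u T fst q" "u \<subseteq> B"
      by (rule braid_local_sheet[OF B \<open>p \<in> B\<close>])
    obtain G where "open G" "u = B \<inter> G" using u(2) unfolding openin_open by blast
    moreover have "inj_on fst u" using diffeomorphism_inj[OF u(4)] by (auto simp: inj_on_def)
    ultimately show "p \<in> \<Union>\<G>" using u(1) unfolding \<G>_def by blast
  qed
  have "compact B" using B by (simp add: solid_torus_braid_def)
  have "\<exists>e>0. \<forall>p\<in>B. \<exists>G\<in>\<G>. ball p e \<subseteq> G"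
  proof (rule Heine_Borel_lemma[OF \<open>compact B\<close> cover])
    show "open G" if "G \<in> \<G>" for G using that by (simp add: \<G>_def)
  qed blast
  then obtain e where e: "e > 0" "\<forall>p\<in>B. \<exists>G\<in>\<G>. ball p e \<subseteq> G" by blast
  show thesis
  proof (rule that[OF e(1)], intro allI impI)
    fix \<zeta> z z' assume z: "(\<zeta>, z) \<in> B" "(\<zeta>, z') \<in> B" "z \<noteq> z'"
    show "e \<le> dist z z'"
    proof (rule ccontr)
      assume "\<not> e \<le> dist z z'"
      then have "dist (\<zeta>, z) (\<zeta>, z') < e" by (simp add: dist_Pair_Pair)
      then have b: "(\<zeta>, z) \<in> ball (\<zeta>, z) e" "(\<zeta>, z') \<in> ball (\<zeta>, z) e" using e(1) by auto
      obtain G where G: "G \<in> \<G>" "ball (\<zeta>, z) e \<subseteq> G" using e(2) z(1) by blast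
      have "(\<zeta>, z) = (\<zeta>, z')"
        by (rule inj_onD[of fst "B \<inter> G"]) (use G b z in \<open>auto simp: \<G>_def\<close>)
      then show False using z(3) by simp
    qed
  qed
qed

lemma cis_eq_iff: "cis s = cis t \<longleftrightarrow> (\<exists>k::int. s = t + 2 * pi * of_int k)"
  unfolding complex_eq_iff cis.sel using sin_cos_eq_iff[of s t] by blast

text \<open>\<open>h\<close> is a lift of \<open>cis\<close> through the covering. The fibre being
  finite, the lift is periodic, with least period \<open>2 * pi * m\<close>. Its range is compact,
  and open in \<open>B\<close> by local uniqueness of lifts, so it fills the whole
  component.\<close>

lemma braid_component_parametrization:
  assumes B: "solid_torus_braid N B" and N: "N \<ge> 1" and C: "C \<in> components B"
  obtains m h where "m \<ge> 1" "continuous_on UNIV h" "range h = C" "\<forall>t. fst (h t) = cis t"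
    "\<forall>s t. h s = h t \<longleftrightarrow> (\<exists>k::int. s = t + 2 * pi * of_nat m * of_int k)"
proof -
  note cov = braid_covering_space[OF B N]
  obtain p0 where p0: "p0 \<in> C" using in_components_nonempty[OF C] by blast
  have CB: "C \<subseteq> B" using in_components_subset[OF C] .
  have "fst p0 \<in> sphere 0 1" using p0 CB B by (auto simp: solid_torus_braid_def)
  then have "cis (Arg (fst p0)) = fst p0"
    by (subst cis_Arg) (auto simp: sgn_div_norm)
  then have e0: "cis (Arg (fst p0)) = fst p0" .
  have cis_cont: "continuous_on UNIV cis" by (intro continuous_intros)
  have cis_sph: "cis \<in> UNIV \<rightarrow> sphere 0 1" by (auto simp: norm_cis)
  have p0B: "p0 \<in> B" using p0 CB by blast
  have sc: "simply_connected (UNIV::real set)" by (simp add: convex_imp_simply_connected)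
  have lpc: "locally path_connected (UNIV::real set)" by (simp add: convex_imp_locally_path_connected)
  have "\<exists>h. continuous_on UNIV h \<and> h \<in> UNIV \<rightarrow> B \<and> h (Arg (fst p0)) = p0 \<and> (\<forall>t. fst (h t) = cis t)"
    by (rule covering_space_lift_strong[OF cov p0B UNIV_I sc lpc cis_cont cis_sph e0]) blast
  then obtain h where h: "continuous_on UNIV h" "h \<in> UNIV \<rightarrow> B" "h (Arg (fst p0)) = p0" and hc: "\<forall>t. fst (h t) = cis t"
    by blast
  \<comment> \<open>For \<open>cis c = 1\<close> the translate of \<open>h\<close> by
    \<open>c\<close> is again a lift of \<open>cis\<close>; two lifts on the connected line that
    agree at one point agree everywhere.\<close>
  have uniq: "h (t + c) = h t" if "h (s + c) = h s" "cis c = 1" for s t c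
  proof (rule covering_space_lift_unique[OF cov, where ?g1.0 = "\<lambda>t. h (t + c)" and ?g2.0 = h and a = s and f = cis and T = UNIV])
    show "continuous_on UNIV (\<lambda>t. h (t + c))"
      by (intro continuous_on_compose2[OF h(1)] continuous_intros) auto
    show "cis x = fst (h (x + c))" for x using hc that(2) by (simp add: cis_mult[symmetric])
  qed (use h hc cis_cont cis_sph that in auto)
  have cis1: "cis (2 * pi * of_int k) = 1" for k
    using cis_eq_iff[of "2 * pi * of_int k" 0] by auto
  have uniq_int: "h (t + 2 * pi * of_int k) = h t" if "h (s + 2 * pi * of_int k) = h s" for s t k
    using uniq[OF that cis1] .
  let ?P = "\<lambda>n::nat. n \<ge> 1 \<and> (\<forall>t. h (t + 2 * pi * of_int (int n)) = h t)"
  have "\<exists>n. ?P n"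
  proof -
    \<comment> \<open>Pigeonhole: infinitely many multiples of \<open>2 * pi\<close> are sent to the
      finite fibre over 1, so two of them have the same image, and their difference is a
      period.\<close>
    have "finite {p \<in> B. fst p = 1}" using braid_finite_fibre[OF B] by simp
    moreover have "range (\<lambda>n::nat. h (2 * pi * of_int (int n))) \<subseteq> {p \<in> B. fst p = 1}"
      using h(2) hc cis1 by (auto simp del: of_int_of_nat_eq)
    ultimately have "finite (range (\<lambda>n::nat. h (2 * pi * of_int (int n))))" by (rule finite_subset[rotated])
    then have "\<not> inj (\<lambda>n::nat. h (2 * pi * of_int (int n)))"
      using finite_imageD infinite_UNIV_nat by blast
    then obtain i j :: nat where ij: "i \<noteq> j" "h (2 * pi * of_int (int i)) = h (2 * pi * of_int (int j))"
      by (auto simp: inj_def)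
    have "\<exists>n. ?P n" if "i < j" "h (2 * pi * of_int (int i)) = h (2 * pi * of_int (int j))" for i j :: nat
    proof -
      have "2 * pi * of_int (int i) + 2 * pi * of_int (int (j - i)) = 2 * pi * of_int (int j)"
        using that(1) by (simp add: of_nat_diff algebra_simps)
      then have "h (2 * pi * of_int (int i) + 2 * pi * of_int (int (j - i))) = h (2 * pi * of_int (int i))"
        using that(2) by simp
      then have "?P (j - i)" using uniq_int that(1) by (metis One_nat_def Suc_leI zero_less_diff)
      then show ?thesis by blast
    qed
    from this[of i j] this[of j i] ij show ?thesis by (metis linorder_neqE_nat)
  qed
  define m where "m = (LEAST n. ?P n)"
  have m: "?P m" unfolding m_def using LeastI_ex[OF \<open>\<exists>n. ?P n\<close>] .
  have least: "m \<le> n" if "?P n" for n unfolding m_def using Least_le[of ?P n] that by blast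
  have per_nat: "h (t + 2 * pi * of_nat m * of_nat k) = h t" for t k
  proof (induction k)
    case (Suc k)
    have "h ((t + 2 * pi * of_nat m * of_nat k) + 2 * pi * of_int (int m)) = h (t + 2 * pi * of_nat m * of_nat k)"
      using m by blast
    then show ?case using Suc by (simp add: algebra_simps)
  qed simp
  have per: "h (t + 2 * pi * of_nat m * of_int k) = h t" for t k
  proof (cases "k \<ge> 0")
    case True
    then show ?thesis using per_nat[of t "nat k"] by simp
  next
    case False
    then show ?thesis using per_nat[of "t + 2 * pi * of_nat m * of_int k" "nat (- k)"] by simp
  qed
  have eq_iff: "h s = h t \<longleftrightarrow> (\<exists>k::int. s = t + 2 * pi * of_nat m * of_int k)" for s t
  proof
    assume st: "h s = h t"
    then have "cis s = cis t" using hc by metis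
    then obtain k :: int where k: "s = t + 2 * pi * of_int k" unfolding cis_eq_iff by blast
    have Pk: "h (x + 2 * pi * of_int k) = h x" for x using uniq_int[of t k x] st k by simp
    let ?r = "k mod int m"
    have r: "0 \<le> ?r" "?r < int m" using m by auto
    have "h (x + 2 * pi * of_int ?r) = h x" for x
    proof -
      have "k = ?r + int m * (k div int m)" by simp
      then have "of_int k = (of_int ?r + of_nat m * of_int (k div int m) :: real)"
        by (metis of_int_add of_int_mult of_int_of_nat_eq)
      then have "x + 2 * pi * of_int k = (x + 2 * pi * of_int ?r) + 2 * pi * of_nat m * of_int (k div int m)"
        by (simp add: algebra_simps)
      then show ?thesis using per[of "x + 2 * pi * of_int ?r" "k div int m"] Pk[of x] by metis
    qed
    then have A: "\<forall>x. h (x + 2 * pi * of_int ?r) = h x" by blast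
    have "?r = 0"
    proof (rule ccontr)
      assume "?r \<noteq> 0"
      then have nr: "int (nat ?r) = ?r" "nat ?r \<ge> 1" using r by auto
      have "?P (nat ?r)" unfolding nr(1) using nr(2) A by blast
      from least[OF this] show False using r nr by linarith
    qed
    then have "int m dvd k" by (rule dvd_eq_mod_eq_0[THEN iffD2])
    then obtain l where "k = int m * l" by (rule dvdE)
    then show "\<exists>k::int. s = t + 2 * pi * of_nat m * of_int k" using k by (intro exI[of _ l]) simp
  qed (use per in auto)
  have rC: "range h \<subseteq> C"
  proof (rule components_maximal[OF C])
    show "connected (range h)" using h(1) by (intro connected_continuous_image) auto
    show "range h \<subseteq> B" using h(2) by auto
    show "C \<inter> range h \<noteq> {}" using p0 h(3) by (metis IntI empty_iff rangeI)
  qed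
  have closed: "closed (range h)"
  proof -
    let ?M = "2 * pi * of_nat m"
    have M: "?M > 0" using m by simp
    have "range h \<subseteq> h ` {0..?M}"
    proof
      fix p assume "p \<in> range h"
      then obtain t where t: "p = h t" by blast
      define k where "k = - \<lfloor>t / ?M\<rfloor>"
      have "t + ?M * of_int k \<in> {0..?M}"
        using floor_divide_lower[OF M, of t] floor_divide_upper[OF M, of t] by (simp add: k_def algebra_simps)
      moreover have "h (t + ?M * of_int k) = p" using per[of t k] t by simp
      ultimately show "p \<in> h ` {0..?M}" by (metis imageI)
    qed
    then have "range h = h ` {0..?M}" by blast
    moreover have "compact (h ` {0..?M})"
      by (intro compact_continuous_image continuous_on_subset[OF h(1)]) auto
    ultimately show ?thesis by (simp add: compact_imp_closed)
  qed
  have "openin (top_of_set B) (range h)"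
    unfolding openin_subopen[of _ "range h"]
  proof
    fix p1 assume "p1 \<in> range h"
    then obtain t1 where t1: "p1 = h t1" by blast
    have p1: "p1 \<in> B" using h(2) t1 by auto
    obtain u T q where u: "p1 \<in> u" "openin (top_of_set B) u" "openin (top_of_set (sphere 0 1)) T" "diffeomorphism u T fst q" "u \<subseteq> B"
      by (rule braid_local_sheet[OF B p1])
    obtain W where W: "open W" "u = B \<inter> W" using u(2) unfolding openin_open by blast
    \<comment> \<open>\<open>k p\<close> is the point of the range of \<open>h\<close> over
      \<open>fst p\<close> whose parameter is the one close to \<open>t1\<close>. Near
      \<open>p1\<close> it lies in the same sheet as \<open>p\<close>, and a sheet has one point
      over each base point, so \<open>k p = p\<close>.\<close>
    define k where "k p = h (t1 + Im (Ln (fst p / cis t1)))" for p :: "complex \<times> complex"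
    have "fst p1 / cis t1 = 1" using hc t1 by simp
    then have "isCont (\<lambda>p. t1 + Im (Ln (fst p / cis t1))) p1"
      by (intro continuous_intros) auto
    moreover have "isCont h x" for x using h(1) by (simp add: continuous_on_eq_continuous_at)
    ultimately have kc: "isCont k p1"
      unfolding k_def using isCont_o2[of p1 "\<lambda>p. t1 + Im (Ln (fst p / cis t1))" h] by blast
    have "k p1 = p1" using \<open>fst p1 / cis t1 = 1\<close> t1 by (simp add: k_def)
    then have "k p1 \<in> W" using u(1) W(2) by simp
    then obtain V where V: "open V" "p1 \<in> V" "\<forall>p\<in>V. k p \<in> W"
      using kc W(1) unfolding continuous_at_open by blast
    have "B \<inter> (V \<inter> W) \<subseteq> range h"
    proof
      fix p assume p: "p \<in> B \<inter> (V \<inter> W)"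
      have n1: "norm (fst p) = 1" using p B by (auto simp: solid_torus_braid_def)
      then have "fst p / cis t1 \<noteq> 0" by auto
      then have "cis (Im (Ln (fst p / cis t1))) = fst p / cis t1"
        using cis_Arg[of "fst p / cis t1"] n1 by (simp add: Arg_eq_Im_Ln sgn_div_norm norm_divide norm_cis)
      then have "fst (k p) = fst p" using hc by (simp add: k_def cis_mult[symmetric])
      moreover have "k p \<in> u" "p \<in> u" using V(3) p W(2) h(2) by (auto simp: k_def)
      ultimately have "k p = p" using diffeomorphism_inj[OF u(4)] by blast
      then show "p \<in> range h" unfolding k_def by (metis rangeI)
    qed
    moreover have "openin (top_of_set B) (B \<inter> (V \<inter> W))" using V(1) W(1) by (intro openin_open_Int) auto
    moreover have "p1 \<in> B \<inter> (V \<inter> W)" using V(2) u(1) W(2) by auto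
    ultimately show "\<exists>T. openin (top_of_set B) T \<and> p1 \<in> T \<and> T \<subseteq> range h" by blast
  qed
  then have "openin (top_of_set C) (range h)"
    using rC CB by (metis openin_subset_trans)
  moreover have "closedin (top_of_set C) (range h)"
    using closed rC by (simp add: closed_subset)
  moreover have "connected C" using in_components_connected[OF C] .
  ultimately have "range h = C" unfolding connected_clopen by blast
  with m h(1) hc eq_iff show thesis by (intro that[of m h]) auto
qed

text \<open>Each component covers the whole circle, so it is the component of some point of the
  finite fibre over 1.\<close>

lemma braid_finite_components:
  assumes B: "solid_torus_braid N B" and N: "N \<ge> 1"
  shows "finite (components B)"
proof -
  have "components B \<subseteq> connected_component_set B ` {p \<in> B. fst p = 1}"
  proof
    fix C assume C: "C \<in> components B"
    obtain m h where h: "range h = C" "\<forall>t. fst (h t) = cis t"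
      using braid_component_parametrization[OF B N C] by metis
    have "h 0 \<in> C" "fst (h 0) = 1" using h by auto
    moreover have "C = connected_component_set B (h 0)"
      using C \<open>h 0 \<in> C\<close> by (metis components_iff connected_component_eq)
    ultimately show "C \<in> connected_component_set B ` {p \<in> B. fst p = 1}"
      using in_components_subset[OF C] by blast
  qed
  then show ?thesis using braid_finite_fibre[OF B, of 1] by (simp add: finite_surj)
qed

section \<open>Moebius transformations of the base circle\<close>

text \<open>As \<open>b \<rightarrow> 1\<close>, the inverse of \<open>disk_moebius b\<close> tends to a constant away from one point of the
  circle. Since \<open>e\<^sup>i\<^sup>t\<close> has mean \<open>0\<close>, this makes the means of \<open>Re (e\<^sup>i\<^sup>t \<gamma> t)\<close> along all components of
  the transported braid tend to \<open>0\<close>.\<close>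

definition disk_moebius :: "real \<Rightarrow> complex \<Rightarrow> complex" where
  "disk_moebius b u = (u + of_real b) / (1 + of_real b * u)"

text \<open>The lift to angles of the inverse transformation: with \<open>q = 1 - b * cis t\<close>
  that inverse sends \<open>cis t\<close> to \<open>cis t * cnj q / q\<close>, and
  \<open>cnj q / q\<close> has argument \<open>- 2 * Arg q\<close>. At \<open>b = 1\<close> the
  formula still makes sense and gives the pointwise limit, a step function.\<close>

definition moebius_phase :: "real \<Rightarrow> real \<Rightarrow> real" where
  "moebius_phase b t = t - 2 * Arg (1 - of_real b * cis t)"

lemma Re_one_pm_pos:
  assumes "0 \<le> b" "b < 1" "norm u = 1"
  shows "Re (1 - of_real b * u) > 0" "Re (1 + of_real b * u) > 0"
proof -
  have "\<bar>Re u\<bar> \<le> 1" using abs_Re_le_cmod[of u] assms by simp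
  then have "b * \<bar>Re u\<bar> \<le> b * 1" using assms by (intro mult_left_mono) auto
  then have "\<bar>b * Re u\<bar> < 1" using assms by (simp add: abs_mult)
  then show "Re (1 - of_real b * u) > 0" "Re (1 + of_real b * u) > 0" by auto
qed

lemma disk_moebius_phase:
  assumes "0 \<le> b" "b < 1"
  shows "disk_moebius b (cis (moebius_phase b t)) = cis t"
proof -
  let ?q = "1 - of_real b * cis t"
  have "Re ?q > 0" using Re_one_pm_pos[OF assms, of "cis t"] by (simp add: norm_cis)
  then have q0: "?q \<noteq> 0" by force
  then have c0: "cnj ?q \<noteq> 0" by (metis complex_cnj_zero_iff)
  have "cis (2 * Arg ?q) = cis (Arg ?q) * cis (Arg ?q)" by (simp only: cis_mult mult_2)
  also have "\<dots> = sgn ?q * sgn ?q" by (simp only: cis_Arg[OF q0])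
  also have "\<dots> = ?q * ?q / (of_real (norm ?q) * of_real (norm ?q))"
    by (simp add: sgn_eq)
  also have "of_real (norm ?q) * of_real (norm ?q) = ?q * cnj ?q"
    using complex_norm_square[of ?q] by (simp add: power2_eq_square)
  also have "?q * ?q / (?q * cnj ?q) = ?q / cnj ?q" using q0 c0 by simp
  finally have "cis (moebius_phase b t) = cis t / (?q / cnj ?q)"
    by (simp add: moebius_phase_def cis_divide[symmetric])
  also have "\<dots> = (cis t * cnj ?q) / ?q" using q0 c0 by simp
  also have "cis t * cnj ?q = cis t - of_real b"
    by (simp add: algebra_simps cis_cnj cis_mult)
  finally have e: "cis (moebius_phase b t) = (cis t - of_real b) / ?q" .
  have b2: "1 - of_real b * of_real b \<noteq> (0::complex)"
  proof -
    have "b * b < 1" using assms mult_strict_mono'[of b 1 b 1] by simp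
    then show ?thesis by (metis less_irrefl of_real_1 of_real_mult of_real_eq_iff right_minus_eq)
  qed
  have "(cis t - of_real b) / ?q + of_real b = (1 - of_real b * of_real b) * cis t / ?q"
    using q0 by (simp add: field_simps)
  moreover have "1 + of_real b * ((cis t - of_real b) / ?q) = (1 - of_real b * of_real b) / ?q"
    using q0 by (simp add: field_simps)
  ultimately show ?thesis
    unfolding disk_moebius_def e using q0 b2 by simp
qed

lemma moebius_phase_period: "moebius_phase b (t + 2 * pi * of_int k) = moebius_phase b t + 2 * pi * of_int k"
proof -
  have "cis (t + 2 * pi * of_int k) = cis t" unfolding cis_eq_iff by blast
  then show ?thesis by (simp add: moebius_phase_def)
qed

lemma continuous_moebius_phase:
  assumes "0 \<le> b" "b < 1"
  shows "continuous_on UNIV (moebius_phase b)"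
  unfolding continuous_on_eq_continuous_at[OF open_UNIV]
proof
  fix t
  have "Re (1 - of_real b * cis t) > 0" using Re_one_pm_pos[OF assms, of "cis t"] by (simp add: norm_cis)
  then have "1 - of_real b * cis t \<notin> \<real>\<^sub>\<le>\<^sub>0" by (simp add: complex_nonpos_Reals_iff)
  then have "isCont (\<lambda>t. Arg (1 - of_real b * cis t)) t"
  proof -
    assume n: "1 - of_real b * cis t \<notin> \<real>\<^sub>\<le>\<^sub>0"
    have "continuous_on UNIV (\<lambda>t. 1 - of_real b * cis t)" by (intro continuous_intros)
    then have "isCont (\<lambda>t. 1 - of_real b * cis t) t" by (simp add: continuous_on_eq_continuous_at)
    from isCont_o2[where g = Arg, OF this continuous_at_Arg[OF n]] show ?thesis .
  qed
  then show "isCont (moebius_phase b) t"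
    unfolding moebius_phase_def[abs_def] by (intro continuous_intros)
qed

lemma surj_moebius_phase:
  assumes "0 \<le> b" "b < 1"
  shows "surj (moebius_phase b)"
proof -
  have "\<exists>t. moebius_phase b t = y" for y
  proof -
    \<comment> \<open>The phase differs from the identity by at most one full turn, so points
      \<open>2 * pi\<close> to either side of \<open>y\<close> bracket the value
      \<open>y\<close>.\<close>
    have bound: "\<bar>moebius_phase b t - t\<bar> \<le> 2 * pi" for t
      using Arg_le_pi[of "1 - of_real b * cis t"] mpi_less_Arg[of "1 - of_real b * cis t"]
      by (simp add: moebius_phase_def)
    have "moebius_phase b (y - 2 * pi) \<le> y" "y \<le> moebius_phase b (y + 2 * pi)"
      using bound[of "y - 2 * pi"] bound[of "y + 2 * pi"] by linarith+
    then show ?thesis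
      using IVT'[of "moebius_phase b" "y - 2 * pi" y "y + 2 * pi"]
        continuous_on_subset[OF continuous_moebius_phase[OF assms]] by auto
  qed
  then show ?thesis by (metis surjI)
qed

text \<open>The chord formula: \<open>1 - cis s\<close> has modulus \<open>2 * sin (s / 2)\<close>
  and argument \<open>(s - pi) / 2\<close> for \<open>s\<close> strictly between 0 and
  \<open>2 * pi\<close>, so twice the argument cancels all dependence on \<open>s\<close>.\<close>

lemma moebius_phase_limit:
  "2 * pi * of_int k < t \<Longrightarrow> t < 2 * pi * (of_int k + 1) \<Longrightarrow> moebius_phase 1 t = 2 * pi * of_int k + pi"
proof -
  assume t: "2 * pi * of_int k < t" "t < 2 * pi * (of_int k + 1)"
  define s where "s = t - 2 * pi * of_int k"
  have s: "0 < s" "s < 2 * pi" using t by (auto simp: s_def algebra_simps)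
  have "t = s + 2 * pi * of_int k" by (simp add: s_def)
  then have "cis t = cis s" unfolding cis_eq_iff by blast
  have "Arg (1 - cis s) = s / 2 - pi / 2"
  proof (rule Arg_unique')
    show "0 < 2 * sin (s / 2)" using s by (intro mult_pos_pos sin_gt_zero) auto
    show "s / 2 - pi / 2 \<in> {- pi<..pi}" using s by auto
    have c: "cos s = 1 - 2 * (sin (s / 2))\<^sup>2" "sin s = 2 * sin (s / 2) * cos (s / 2)"
      using cos_double_sin[of "s / 2"] sin_double[of "s / 2"] by auto
    show "1 - cis s = rcis (2 * sin (s / 2)) (s / 2 - pi / 2)"
      by (simp add: complex_eq_iff c cos_diff sin_diff power2_eq_square)
  qed
  then show ?thesis using \<open>cis t = cis s\<close> by (simp add: moebius_phase_def s_def field_simps)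
qed

lemma moebius_phase_tendsto:
  "(\<lambda>n. moebius_phase (1 - 1 / (real n + 2)) t) \<longlonglongrightarrow> moebius_phase 1 t"
proof (cases "cis t = 1")
  case True
  have "Arg (1 - of_real (1 - 1 / (real n + 2)) * cis t) = 0" for n
  proof -
    have "1 - of_real (1 - 1 / (real n + 2)) * cis t = complex_of_real (1 / (real n + 2))"
      unfolding True by simp
    moreover have "Arg (complex_of_real (1 / (real n + 2))) = 0" by (rule Arg_of_real[THEN trans]) auto
    ultimately show ?thesis by simp
  qed
  \<comment> \<open>The convention \<open>Arg 0 = 0\<close> matters here: it agrees with the
    argument of the positive reals through which 0 is approached, so convergence holds at every
    \<open>t\<close> although \<open>Arg\<close> is not continuous at 0.\<close>
  moreover have "Arg (1 - of_real 1 * cis t) = 0" unfolding True by (simp add: Arg_zero)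
  ultimately show ?thesis unfolding moebius_phase_def by simp
next
  case False
  have "cos t \<noteq> 1"
  proof
    assume "cos t = 1"
    then have "sin t = 0" using sin_cos_squared_add[of t] by simp
    then show False using False \<open>cos t = 1\<close> by (simp add: complex_eq_iff)
  qed
  moreover have "\<bar>cos t\<bar> \<le> 1" by simp
  ultimately have "cos t < 1" by linarith
  then have "Re (1 - of_real 1 * cis t) > 0" by simp
  then have "1 - of_real 1 * cis t \<notin> \<real>\<^sub>\<le>\<^sub>0" by (simp add: complex_nonpos_Reals_iff)
  then have "isCont Arg (1 - of_real 1 * cis t)" by (rule continuous_at_Arg)
  moreover have "(\<lambda>n. 1 - of_real (1 - 1 / (real n + 2)) * cis t) \<longlonglongrightarrow> 1 - of_real 1 * cis t"
  proof -
    have "(\<lambda>n. 1 / (real n + 2)) \<longlonglongrightarrow> 0" by real_asymp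
    then have "(\<lambda>n. 1 - of_real (1 - 1 / (real n + 2)) * cis t) \<longlonglongrightarrow> 1 - of_real (1 - 0) * cis t"
      by (intro tendsto_intros)
    then show ?thesis by simp
  qed
  ultimately have "(\<lambda>n. Arg (1 - of_real (1 - 1 / (real n + 2)) * cis t)) \<longlonglongrightarrow> Arg (1 - of_real 1 * cis t)"
    by (rule isCont_tendsto_compose)
  then show ?thesis unfolding moebius_phase_def by (intro tendsto_diff tendsto_const tendsto_mult)
qed

text \<open>Dominated convergence reduces the claim to the limiting phase, a constant on each of the
  \<open>m\<close> open intervals of length \<open>2 * pi / m\<close>. There \<open>\<gamma>\<close>
  contributes a constant while \<open>cis (m * t)\<close> runs once around the circle, so each
  interval contributes 0.\<close>

lemma moebius_mean_tendsto:
  fixes \<gamma> :: "real \<Rightarrow> complex" and m :: nat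
  assumes m: "m \<ge> 1" and \<gamma>: "continuous_on UNIV \<gamma>" and bd: "\<forall>t. norm (\<gamma> t) \<le> Q"
  shows "(\<lambda>n. integral {0..2 * pi} (\<lambda>t. Re (cis (real m * t) * \<gamma> (moebius_phase (1 - 1 / (real n + 2)) (real m * t))))) \<longlonglongrightarrow> 0"
proof -
  let ?f = "\<lambda>b t. Re (cis (real m * t) * \<gamma> (moebius_phase b (real m * t)))"
  let ?b = "\<lambda>n. 1 - 1 / (real n + 2)"
  have b: "0 \<le> ?b n" "?b n < 1" for n by (auto simp: field_simps)
  have "(\<lambda>n. integral {0..2 * pi} (?f (?b n))) \<longlonglongrightarrow> integral {0..2 * pi} (?f 1)"
  proof (rule dominated_convergence)
    show "?f (?b n) integrable_on {0..2 * pi}" for n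
      by (intro integrable_continuous_interval continuous_intros continuous_on_compose2[OF \<gamma>]
          continuous_on_compose2[OF continuous_moebius_phase[OF b]]) auto
    show "(\<lambda>t. Q) integrable_on {0..2 * pi}" by (rule integrable_const_ivl)
    show "norm (?f (?b n) t) \<le> Q" for n t
    proof -
      have "norm (?f (?b n) t) \<le> norm (cis (real m * t) * \<gamma> (moebius_phase (?b n) (real m * t)))"
        by (simp only: real_norm_def abs_Re_le_cmod)
      also have "\<dots> \<le> Q" using bd by (simp add: norm_mult norm_cis)
      finally show ?thesis .
    qed
    show "(\<lambda>n. ?f (?b n) t) \<longlonglongrightarrow> ?f 1 t" for t
      using \<gamma> by (intro tendsto_intros isCont_tendsto_compose[of _ \<gamma>] moebius_phase_tendsto)
        (simp add: continuous_on_eq_continuous_at)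
  qed
  moreover have "(?f 1 has_integral 0) {0..2 * pi * of_nat k / real m}" for k :: nat
  proof (induction k)
    case 0
    then show ?case using has_integral_refl(2)[of "?f 1" 0] by simp
  next
    case (Suc k)
    let ?a = "2 * pi * of_nat k / real m" and ?c = "2 * pi * of_nat (Suc k) / real m"
    have ac: "0 \<le> ?a" "?a \<le> ?c" using m by (auto simp: field_simps)
    define \<kappa> where "\<kappa> = \<gamma> (2 * pi * of_nat k + pi)"
    have "((\<lambda>t. Re (cis (real m * t) * \<kappa>)) has_integral
        Re (cis (real m * ?c) * \<kappa> / (\<i> * of_nat m)) - Re (cis (real m * ?a) * \<kappa> / (\<i> * of_nat m))) {?a..?c}"
    proof (rule fundamental_theorem_of_calculus[OF ac(2)])
      fix t
      have "((\<lambda>t. cis (real m * t) * \<kappa> / (\<i> * of_nat m)) has_vector_derivative cis (real m * t) * \<kappa>) (at t within {?a..?c})"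
      proof -
        have "((\<lambda>t. cis (real m * t)) has_vector_derivative of_nat m * (\<i> * cis (real m * t))) (at t within {?a..?c})"
        proof -
          have "((\<lambda>t. real m * t) has_derivative (\<lambda>h. real m * h)) (at t within {?a..?c})"
            by (auto intro!: derivative_eq_intros)
          from has_derivative_cis[OF this] show ?thesis
            unfolding has_vector_derivative_def by (auto elim!: has_derivative_eq_rhs simp: scaleR_conv_of_real mult_ac)
        qed
        from has_vector_derivative_mult_left[OF this, of "\<kappa> / (\<i> * of_nat m)"] show ?thesis
          using m by simp
      qed
      from bounded_linear.has_vector_derivative[OF bounded_linear_Re this]
      show "((\<lambda>t. Re (cis (real m * t) * \<kappa> / (\<i> * of_nat m))) has_vector_derivative Re (cis (real m * t) * \<kappa>)) (at t within {?a..?c})" .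
    qed
    moreover have "cis (real m * ?c) = cis (real m * ?a)"
    proof -
      have "real m * ?c = real m * ?a + 2 * pi * of_int 1" using m by (simp add: field_simps)
      then show ?thesis unfolding cis_eq_iff by blast
    qed
    ultimately have "((\<lambda>t. Re (cis (real m * t) * \<kappa>)) has_integral 0) {?a..?c}" by simp
    then have "(?f 1 has_integral 0) {?a..?c}"
    \<comment> \<open>Only the two endpoints are excluded; between them the limiting phase is
      constant and \<open>\<gamma>\<close> takes the value \<open>\<kappa>\<close>.\<close>
    proof (rule has_integral_spike_finite[rotated 2])
      fix t assume t: "t \<in> {?a..?c} - {?a, ?c}"
      then have "2 * pi * of_int (int k) < real m * t" "real m * t < 2 * pi * (of_int (int k) + 1)"
        using m by (auto simp: field_simps)
      from moebius_phase_limit[OF this] show "?f 1 t = Re (cis (real m * t) * \<kappa>)" by (simp add: \<kappa>_def)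
    qed auto
    from has_integral_combine[OF ac Suc.IH this] show ?case by simp
  qed
  from this[of m] have "integral {0..2 * pi} (?f 1) = 0" using m by (simp add: integral_unique)
  ultimately show ?thesis by simp
qed

text \<open>\<open>\<rho>\<close> is a coordinate on a component, an \<open>m\<close>-th root of the
  transported base coordinate, and \<open>E\<close> is its inverse. In this coordinate the component
  is ready to be the target of a Lagrangian plane with \<open>a\<^sub>1 = w\<^sup>m\<close>, and the
  last clause is the smallness of the mean which that construction requires.\<close>

lemma braid_normal_form:
  assumes B: "solid_torus_braid N B" and N: "N \<ge> 1" and \<epsilon>: "\<epsilon> > 0"
  obtains b where "0 \<le> b" "b < 1"
    "\<forall>C\<in>components B. \<exists>m \<rho> E. m \<ge> 1 \<and> homeomorphism C (sphere 0 1) \<rho> E \<and>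
       (\<forall>p\<in>C. \<rho> p ^ m = disk_moebius b (fst p)) \<and>
       \<bar>integral {0..2 * pi} (\<lambda>t. Re (cis t ^ m * snd (E (cis t))))\<bar> < \<epsilon>"
proof -
  let ?b = "\<lambda>n. 1 - 1 / (real n + 2)"
  let ?R = "\<lambda>C n. \<exists>m \<rho> E. m \<ge> 1 \<and> homeomorphism C (sphere 0 1) \<rho> E \<and>
       (\<forall>p\<in>C. \<rho> p ^ m = disk_moebius (?b n) (fst p)) \<and>
       \<bar>integral {0..2 * pi} (\<lambda>t. Re (cis t ^ m * snd (E (cis t))))\<bar> < \<epsilon>"
  have b: "0 \<le> ?b n" "?b n < 1" for n by (auto simp: field_simps)
  have "eventually (?R C) sequentially" if C: "C \<in> components B" for C
  proof -
    obtain m h where m: "m \<ge> 1" and h: "continuous_on UNIV h" "range h = C" "\<forall>t. fst (h t) = cis t"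
      and hh: "\<forall>s t. h s = h t \<longleftrightarrow> (\<exists>k::int. s = t + 2 * pi * of_nat m * of_int k)"
      by (rule braid_component_parametrization[OF B N C])
    have cC: "compact C" using B C compact_components by (auto simp: solid_torus_braid_def)
    then have "bounded C" by (rule compact_imp_bounded)
    then obtain Q where Q: "\<forall>p\<in>C. norm p \<le> Q" by (auto simp: bounded_iff)
    have bd: "norm (snd (h t)) \<le> Q" for t
    proof -
      have "h t \<in> C" using h(2) by blast
      then have "norm (h t) \<le> Q" using Q by blast
      moreover have "norm (snd (h t)) \<le> norm (h t)" by (cases "h t") (simp add: norm_snd_le)
      ultimately show ?thesis by linarith
    qed
    have "continuous_on UNIV (\<lambda>t. snd (h t))" using h(1) by (intro continuous_intros)
    from moebius_mean_tendsto[OF m this, of Q] bd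
    have "(\<lambda>n. integral {0..2 * pi} (\<lambda>t. Re (cis (real m * t) * snd (h (moebius_phase (?b n) (real m * t)))))) \<longlonglongrightarrow> 0"
      by blast
    then have "\<forall>\<^sub>F n in sequentially. \<bar>integral {0..2 * pi} (\<lambda>t. Re (cis (real m * t) * snd (h (moebius_phase (?b n) (real m * t)))))\<bar> < \<epsilon>"
      using \<epsilon> by (auto dest!: tendstoD[where e = \<epsilon>] simp: dist_real_def)
    then show ?thesis
    proof (rule eventually_mono)
      fix n assume small: "\<bar>integral {0..2 * pi} (\<lambda>t. Re (cis (real m * t) * snd (h (moebius_phase (?b n) (real m * t)))))\<bar> < \<epsilon>"
      define g where "g t = h (moebius_phase (?b n) t)" for t
      have g_cont: "continuous_on UNIV g"
        unfolding g_def by (intro continuous_on_compose2[OF h(1) continuous_moebius_phase[OF b]]) auto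
      have g_range: "range g = C"
        unfolding g_def h(2)[symmetric] using surj_moebius_phase[OF b, of n] by (metis image_image)
      have g_fst: "disk_moebius (?b n) (fst (g t)) = cis t" for t
        unfolding g_def using h(3) disk_moebius_phase[OF b] by simp
      have g_eq: "g s = g t \<longleftrightarrow> cis (s / m) = cis (t / m)" for s t
      proof
        assume st: "g s = g t"
        then have "cis s = cis t" using g_fst by metis
        then obtain k where k: "s = t + 2 * pi * of_int k" unfolding cis_eq_iff by blast
        have "h (moebius_phase (?b n) t + 2 * pi * of_int k) = h (moebius_phase (?b n) t)"
          using st unfolding g_def k moebius_phase_period .
        then obtain l where "2 * pi * of_int k = 2 * pi * of_nat m * of_int l"
          using hh[rule_format, of "moebius_phase (?b n) t + 2 * pi * of_int k" "moebius_phase (?b n) t"] by auto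
        then have "s / m = t / m + 2 * pi * of_int l" using k m by (simp add: field_simps)
        then show "cis (s / m) = cis (t / m)" unfolding cis_eq_iff by blast
      next
        assume "cis (s / m) = cis (t / m)"
        then obtain k where "s / m = t / m + 2 * pi * of_int k" unfolding cis_eq_iff by blast
        then have k: "s = t + 2 * pi * of_int (int m * k)" using m by (simp add: field_simps)
        show "g s = g t"
          unfolding g_def k moebius_phase_period hh[rule_format] by (intro exI[of _ k]) simp
      qed
      \<comment> \<open>The choice of parameter is harmless: by \<open>g_eq\<close>, all parameters
        of a point give the same value of \<open>cis (t / m)\<close>.\<close>
      define \<rho> where "\<rho> p = cis ((SOME t. g t = p) / m)" for p
      have \<rho>: "\<rho> (g t) = cis (t / m)" for t
      proof -
        have "g (SOME s. g s = g t) = g t" by (rule someI) (rule refl)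
        then show ?thesis unfolding \<rho>_def g_eq .
      qed
      have \<rho>_img: "\<rho> ` C = sphere 0 1"
      proof (intro equalityI subsetI)
        fix z :: complex assume "z \<in> sphere 0 1"
        then have "sgn z = z" "z \<noteq> 0" by (auto simp: sgn_div_norm)
        then have "z = \<rho> (g (m * Arg z))" using m by (simp add: \<rho> cis_Arg)
        then show "z \<in> \<rho> ` C" using g_range by blast
      qed (use g_range \<rho> in \<open>auto simp: \<rho>_def norm_cis\<close>)
      have \<rho>_inj: "inj_on \<rho> C"
      proof (rule inj_onI)
        fix p q assume "p \<in> C" "q \<in> C" and eq: "\<rho> p = \<rho> q"
        then obtain s t where "p = g s" "q = g t" using g_range by blast
        then show "p = q" using eq by (simp add: \<rho> g_eq)
      qed
      let ?M = "2 * pi * real m"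
      have M: "?M > 0" using m by simp
      have \<rho>_cont: "continuous_on C \<rho>"
        unfolding continuous_on_closed_vimage[OF compact_imp_closed[OF cC]]
      proof (intro allI impI)
        fix A :: "complex set" assume A: "closed A"
        \<comment> \<open>A closed set pulls back to the image under \<open>g\<close> of a compact
          set of parameters, because one full period \<open>2 * pi * m\<close> already reaches every
          point of \<open>C\<close>.\<close>
        have "\<rho> -` A \<inter> C = g ` ({0..?M} \<inter> {t. cis (t / m) \<in> A})"
        proof (intro equalityI subsetI)
          fix p assume p: "p \<in> \<rho> -` A \<inter> C"
          then obtain t where t: "p = g t" using g_range by blast
          define k where "k = - \<lfloor>t / ?M\<rfloor>"
          let ?s = "t + ?M * of_int k"
          have "?s \<in> {0..?M}"
            using floor_divide_lower[OF M, of t] floor_divide_upper[OF M, of t] by (simp add: k_def algebra_simps)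
          moreover have "?s / m = t / m + 2 * pi * of_int k" using m by (simp add: field_simps)
          then have c: "cis (?s / m) = cis (t / m)" unfolding cis_eq_iff by blast
          then have "g ?s = p" using t g_eq by simp
          moreover have "cis (?s / m) \<in> A" using p t \<rho> c by simp
          ultimately show "p \<in> g ` ({0..?M} \<inter> {t. cis (t / m) \<in> A})" by (intro image_eqI[of _ _ ?s]) auto
        qed (use g_range \<rho> in auto)
        moreover have "compact ({0..?M} \<inter> {t. cis (t / m) \<in> A})"
        proof -
          have "closed ((\<lambda>t. cis (t / m)) -` A)"
            by (rule closed_vimage[OF A]) (use m in \<open>intro continuous_intros; simp\<close>)
          then show ?thesis unfolding vimage_def by (intro compact_Int_closed) auto
        qed
        ultimately show "closed (\<rho> -` A \<inter> C)"
          using compact_continuous_image[OF continuous_on_subset[OF g_cont]] by (simp add: compact_imp_closed)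
      qed
      obtain E where E: "homeomorphism C (sphere 0 1) \<rho> E"
        using homeomorphism_compact[OF cC \<rho>_cont \<rho>_img \<rho>_inj] by blast
      have E_cis: "E (cis t) = g (real m * t)" for t :: real
      proof -
        have "E (\<rho> (g (real m * t))) = g (real m * t)" 
          using g_range by (intro homeomorphism_apply1[OF E]) blast
        then show ?thesis using m by (simp add: \<rho>)
      qed
      have "\<rho> p ^ m = disk_moebius (?b n) (fst p)" if p: "p \<in> C" for p
      proof -
        obtain t where "p = g t" using p unfolding g_range[symmetric] by blast
        then show ?thesis using m by (simp add: \<rho> g_fst Complex.DeMoivre)
      qed
      moreover have "\<bar>integral {0..2 * pi} (\<lambda>t. Re (cis t ^ m * snd (E (cis t))))\<bar> < \<epsilon>"
        using small by (simp only: E_cis g_def Complex.DeMoivre)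
      ultimately show "?R C n" using m E by (intro exI[of _ m] exI[of _ \<rho>] exI[of _ E] conjI ballI)
    qed
  qed
  \<comment> \<open>Finiteness of the set of components gives one index for all of them; a common
    parameter is essential because a single transformation moves the base of the whole
    braid.\<close>
  then have "eventually (\<lambda>n. \<forall>C\<in>components B. ?R C n) sequentially"
    by (intro eventually_ball_finite braid_finite_components[OF B N]) blast
  then obtain n where "\<forall>C\<in>components B. ?R C n"
    using eventually_happens'[OF sequentially_bot] by blast
  then show thesis using that[OF b] by blast
qed

section \<open>Images of braids under diffeomorphisms\<close>

lemma diffeomorphism_sym: "diffeomorphism S T f g \<Longrightarrow> diffeomorphism T S g f"
  by (simp add: diffeomorphism_def)

lemma diffeomorphism_trans:
  assumes f: "diffeomorphism S T f f'" and g: "diffeomorphism T U g g'"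
  shows "diffeomorphism S U (\<lambda>x. g (f x)) (\<lambda>y. f' (g' y))"
proof -
  have f1: "smooth_map S f" "f ` S = T" "\<forall>x\<in>S. f' (f x) = x" "smooth_map T f'" "f' ` T = S" "\<forall>y\<in>T. f (f' y) = y"
    using f by (simp_all add: diffeomorphism_def)
  have g1: "smooth_map T g" "g ` T = U" "\<forall>x\<in>T. g' (g x) = x" "smooth_map U g'" "g' ` U = T" "\<forall>y\<in>U. g (g' y) = y"
    using g by (simp_all add: diffeomorphism_def)
  have "smooth_map S (\<lambda>x. g (f x))" using smooth_map_compose[OF f1(1) g1(1)] f1(2) by simp
  moreover have "smooth_map U (\<lambda>y. f' (g' y))" using smooth_map_compose[OF g1(4) f1(4)] g1(5) by simp
  moreover have "(\<lambda>x. g (f x)) ` S = U" using f1(2) g1(2) by (simp add: image_image[symmetric])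
  moreover have "(\<lambda>y. f' (g' y)) ` U = S" using f1(5) g1(5) by (simp add: image_image[symmetric])
  moreover have "\<forall>x\<in>S. f' (g' (g (f x))) = x" using f1(2,3) g1(3) by auto
  moreover have "\<forall>y\<in>U. g (f (f' (g' y))) = y" using f1(6) g1(5,6) by auto
  ultimately show ?thesis by (simp add: diffeomorphism_def)
qed

lemma diffeomorphism_restrict:
  assumes f: "diffeomorphism S T f g" and sub: "S' \<subseteq> S"
  shows "diffeomorphism S' (f ` S') f g"
proof -
  have f1: "smooth_map S f" "f ` S = T" "\<forall>x\<in>S. g (f x) = x" "smooth_map T g"
    using f by (simp_all add: diffeomorphism_def)
  have "smooth_map S' f" using smooth_map_subset[OF f1(1) sub] .
  moreover have "smooth_map (f ` S') g" using smooth_map_subset[OF f1(4)] f1(2) sub by blast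
  moreover have "g ` f ` S' = S'" using f1(3) sub by (auto simp: image_image subset_eq intro!: image_eqI)
  moreover have "\<forall>x\<in>S'. g (f x) = x" using f1(3) sub by blast
  ultimately show ?thesis by (auto simp: diffeomorphism_def)
qed

lemma diffeomorphism_openin:
  assumes f: "diffeomorphism S T f g" and U: "openin (top_of_set S) U"
  shows "openin (top_of_set T) (f ` U)"
  using homeomorphism_imp_open_map[OF diffeomorphism_imp_homeomorphism[OF f] U] .

lemma diffeomorphic_embedded_1_submanifold:
  assumes M: "embedded_1_submanifold M" and f: "diffeomorphism M M' f g"
  shows "embedded_1_submanifold M'"
  unfolding embedded_1_submanifold_def
proof
  fix y assume y: "y \<in> M'"
  then have gy: "g y \<in> M" "f (g y) = y" using f by (auto simp: diffeomorphism_def)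
  from bspec[OF M[unfolded embedded_1_submanifold_def] gy(1)]
  obtain U I h k where U: "openin (top_of_set M) U" "g y \<in> U" and I: "open (I::real set)" and h: "diffeomorphism U I h k"
    by (elim exE conjE)
  have "diffeomorphism U (f ` U) f g" using diffeomorphism_restrict[OF f openin_imp_subset[OF U(1)]] .
  from diffeomorphism_trans[OF diffeomorphism_sym[OF this] h]
  have 1: "diffeomorphism (f ` U) I (\<lambda>y. h (g y)) (\<lambda>t. f (k t))" .
  have 2: "openin (top_of_set M') (f ` U)" using diffeomorphism_openin[OF f U(1)] .
  have 3: "y \<in> f ` U" using U(2) gy(2) by force
  show "\<exists>U. openin (top_of_set M') U \<and> y \<in> U \<and> (\<exists>(I::real set) f g. open I \<and> diffeomorphism U I f g)"
    by (intro exI[of _ "f ` U"] exI[of _ I] exI[of _ "\<lambda>y. h (g y)"] exI[of _ "\<lambda>t. f (k t)"] conjI 1 2 3 I)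
qed

text \<open>Even coverings are transported by conjugation: \<open>T\<close> becomes its image under
  \<open>\<mu>\<close>, each sheet its image under \<open>f\<close>, and the section
  \<open>q\<close> over \<open>T\<close> becomes \<open>f\<close> after \<open>q\<close> after
  \<open>\<nu>\<close>.\<close>

lemma diffeomorphic_smooth_covering:
  assumes cov: "smooth_covering N E p B" and f: "diffeomorphism E E' f g" and \<mu>: "diffeomorphism B B \<mu> \<nu>"
    and p': "smooth_map E' p'" and comm: "\<forall>x\<in>E. p' (f x) = \<mu> (p x)"
  shows "smooth_covering N E' p' B"
proof -
  have f1: "f ` E = E'" "\<forall>x\<in>E. g (f x) = x" "\<forall>y\<in>E'. f (g y) = y" "g ` E' = E"
    using f by (simp_all add: diffeomorphism_def)
  have \<mu>1: "\<mu> ` B = B" "\<forall>x\<in>B. \<nu> (\<mu> x) = x" "\<forall>x\<in>B. \<mu> (\<nu> x) = x" "\<nu> ` B = B"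
    using \<mu> by (simp_all add: diffeomorphism_def)
  have pE: "p ` E \<subseteq> B" using cov by (simp add: smooth_covering_def)
  have p'E: "p' ` E' \<subseteq> B"
  proof
    fix y assume "y \<in> p' ` E'"
    then obtain x where x: "x \<in> E" "y = p' (f x)" using f1(1) by blast
    then have "p x \<in> B" using pE by blast
    then show "y \<in> B" using x comm \<mu>1(1) by auto
  qed
  show ?thesis
    unfolding smooth_covering_def
  proof (intro conjI p' p'E ballI)
    fix b assume b: "b \<in> B"
    then have nb: "\<nu> b \<in> B" "\<mu> (\<nu> b) = b" using \<mu>1 by auto
    obtain T V where T: "\<nu> b \<in> T" "openin (top_of_set B) T" and V: "finite V" "card V = N" "\<Union>V = E \<inter> p -` T"
      "\<forall>u\<in>V. openin (top_of_set E) u" "pairwise disjnt V" "\<forall>u\<in>V. \<exists>q. diffeomorphism u T p q"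
      by (rule smooth_coveringD[OF cov nb(1)])
    have TB: "T \<subseteq> B" using openin_imp_subset[OF T(2)] .
    have uE: "u \<subseteq> E" if "u \<in> V" for u using V(4) that openin_imp_subset by blast
    have inj: "inj_on f E" using f1(2) by (metis inj_on_inverseI)
    define V' where "V' = (\<lambda>u. f ` u) ` V"
    have "inj_on (\<lambda>u. f ` u) V" using inj uE by (auto simp: inj_on_def inj_on_image_eq_iff)
    then have 1: "card V' = N" using V(2) by (simp add: V'_def card_image)
    have 2: "\<Union>V' = E' \<inter> p' -` (\<mu> ` T)"
    proof -
      have "\<Union>V' = f ` (\<Union>V)" by (auto simp: V'_def)
      also have "\<dots> = E' \<inter> p' -` (\<mu> ` T)"
      proof (intro equalityI subsetI)
        fix y assume "y \<in> f ` \<Union>V"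
        then obtain x where "x \<in> E" "p x \<in> T" "y = f x" unfolding V(3) by blast
        then show "y \<in> E' \<inter> p' -` (\<mu> ` T)" using comm f1(1) by auto
      next
        fix y assume y: "y \<in> E' \<inter> p' -` (\<mu> ` T)"
        then obtain x where x: "x \<in> E" "y = f x" using f1(1) by blast
        then have "\<mu> (p x) \<in> \<mu> ` T" using y comm by auto
        then obtain t where t: "t \<in> T" "\<mu> (p x) = \<mu> t" by blast
        have "p x = t" using \<mu>1(2) t TB pE x(1) by (metis image_subset_iff subsetD)
        then show "y \<in> f ` \<Union>V" unfolding V(3) using x t by blast
      qed
      finally show ?thesis .
    qed
    have 3: "\<forall>u\<in>V'. openin (top_of_set E') u"
      using V(4) diffeomorphism_openin[OF f] by (auto simp: V'_def)
    have 4: "pairwise disjnt V'"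
      unfolding V'_def pairwise_image
    proof (rule pairwiseI)
      fix u v assume uv: "u \<in> V" "v \<in> V" "u \<noteq> v"
      then have "u \<inter> v = {}" using V(5) by (auto simp: pairwise_def disjnt_def)
      then have "f ` u \<inter> f ` v = {}" using inj_on_image_Int[OF inj uE[OF uv(1)] uE[OF uv(2)]] by simp
      then show "f ` u \<noteq> f ` v \<longrightarrow> disjnt (f ` u) (f ` v)" by (simp add: disjnt_def)
    qed
    have 5: "\<forall>u\<in>V'. \<exists>q. diffeomorphism u (\<mu> ` T) p' q"
    proof
      fix u' assume "u' \<in> V'"
      then obtain u where u: "u \<in> V" "u' = f ` u" by (auto simp: V'_def)
      then obtain q where q: "diffeomorphism u T p q" using V(6) by blast
      have a: "diffeomorphism u' u g f"
        using diffeomorphism_sym[OF diffeomorphism_restrict[OF f uE[OF u(1)]]] u(2) by simp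
      have "diffeomorphism T (\<mu> ` T) \<mu> \<nu>" using diffeomorphism_restrict[OF \<mu> TB] .
      from diffeomorphism_trans[OF diffeomorphism_trans[OF a q] this]
      have d: "diffeomorphism u' (\<mu> ` T) (\<lambda>x. \<mu> (p (g x))) (\<lambda>y. f (q (\<nu> y)))" .
      have eq: "\<mu> (p (g y)) = p' y" if y: "y \<in> u'" for y
      proof -
        obtain x where "x \<in> u" "y = f x" using y u(2) by blast
        then show ?thesis using comm f1(2) uE[OF u(1)] by auto
      qed
      have "diffeomorphism u' (\<mu> ` T) p' (\<lambda>y. f (q (\<nu> y)))"
      proof -
        have d1: "smooth_map u' (\<lambda>x. \<mu> (p (g x)))" "(\<lambda>x. \<mu> (p (g x))) ` u' = \<mu> ` T" "\<forall>x\<in>u'. f (q (\<nu> (\<mu> (p (g x))))) = x"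
          "smooth_map (\<mu> ` T) (\<lambda>y. f (q (\<nu> y)))" "(\<lambda>y. f (q (\<nu> y))) ` (\<mu> ` T) = u'" "\<forall>y\<in>\<mu> ` T. \<mu> (p (g (f (q (\<nu> y))))) = y"
          using d unfolding diffeomorphism_def by blast+
        have "smooth_map u' p'" using smooth_map_cong[OF d1(1) eq] .
        moreover have "p' ` u' = \<mu> ` T" using d1(2) eq image_cong[of u' u' "\<lambda>x. \<mu> (p (g x))" p'] by simp
        moreover have "\<forall>x\<in>u'. f (q (\<nu> (p' x))) = x" using d1(3) eq by simp
        moreover have "\<forall>y\<in>\<mu> ` T. p' (f (q (\<nu> y))) = y"
        proof
          fix y assume y: "y \<in> \<mu> ` T"
          then have m: "f (q (\<nu> y)) \<in> u'" using d1(5) by blast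
          show "p' (f (q (\<nu> y))) = y" by (rule trans[OF eq[OF m, symmetric] bspec[OF d1(6) y]])
        qed
        ultimately show ?thesis using d1(4,5) by (simp only: diffeomorphism_def)
      qed
      then show "\<exists>q. diffeomorphism u' (\<mu> ` T) p' q" by blast
    qed
    have 6: "openin (top_of_set B) (\<mu> ` T)" using diffeomorphism_openin[OF \<mu> T(2)] .
    have 7: "b \<in> \<mu> ` T" using T(1) nb(2) by force
    have 8: "finite V'" using V(1) by (simp add: V'_def)
    show "\<exists>T. b \<in> T \<and> openin (top_of_set B) T \<and>
        (\<exists>\<V>. finite \<V> \<and> card \<V> = N \<and> \<Union>\<V> = E' \<inter> p' -` T \<and>
             (\<forall>u\<in>\<V>. openin (top_of_set E') u) \<and> pairwise disjnt \<V> \<and> (\<forall>u\<in>\<V>. \<exists>q. diffeomorphism u T p' q))"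
      by (intro exI[of _ "\<mu> ` T"] exI[of _ V'] conjI 1 2 3 4 5 6 7 8)
  qed
qed

lemma smooth_map_fst: "smooth_map X (fst :: 'a::euclidean_space \<times> 'b::euclidean_space \<Rightarrow> 'a)"
  by (rule smooth_mapI[OF open_UNIV subset_UNIV smooth_on_fst[OF open_UNIV smooth_on_id[OF open_UNIV]]])

lemma smooth_map_snd: "smooth_map X (snd :: 'a::euclidean_space \<times> 'b::euclidean_space \<Rightarrow> 'b)"
  by (rule smooth_mapI[OF open_UNIV subset_UNIV smooth_on_snd[OF open_UNIV smooth_on_id[OF open_UNIV]]])

text \<open>Compactness makes \<open>\<Theta>\<close> a homeomorphism onto its image, so the inverse
  can be tested sheet by sheet. On the image of a sheet with section \<open>q\<close> the inverse is
  \<open>q (\<nu> (fst y))\<close>: it is recovered from the base point alone, and is therefore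
  smooth.\<close>

lemma braid_image:
  assumes B: "solid_torus_braid N B" and \<Theta>: "smooth_map B \<Theta>" "inj_on \<Theta> B"
    and \<mu>: "diffeomorphism (sphere 0 1) (sphere 0 1) \<mu> \<nu>" and comm: "\<forall>p\<in>B. fst (\<Theta> p) = \<mu> (fst p)"
  shows "solid_torus_braid N (\<Theta> ` B)" "diffeomorphism B (\<Theta> ` B) \<Theta> (inv_into B \<Theta>)"
proof -
  have B1: "B \<subseteq> sphere 0 1 \<times> UNIV" "compact B" "embedded_1_submanifold B" "smooth_covering N B fst (sphere 0 1)"
    using B by (simp_all add: solid_torus_braid_def)
  let ?\<Psi> = "inv_into B \<Theta>"
  have cont: "continuous_on B \<Theta>" using smooth_map_imp_continuous_on[OF \<Theta>(1)] .
  have \<mu>1: "\<mu> ` sphere 0 1 = sphere 0 1" "\<forall>x\<in>sphere 0 1. \<nu> (\<mu> x) = x" "smooth_map (sphere 0 1) \<nu>"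
    using \<mu> by (simp_all add: diffeomorphism_def)
  have inv: "?\<Psi> (\<Theta> p) = p" if "p \<in> B" for p using \<Theta>(2) that by simp
  obtain k where k: "homeomorphism B (\<Theta> ` B) \<Theta> k"
    using homeomorphism_compact[OF B1(2) cont refl \<Theta>(2)] by blast
  have "smooth_map (\<Theta> ` B) ?\<Psi>"
  proof (rule smooth_map_local)
    fix y assume "y \<in> \<Theta> ` B"
    then obtain p where p: "p \<in> B" "y = \<Theta> p" by blast
    obtain u T q where u: "p \<in> u" "openin (top_of_set B) u" "openin (top_of_set (sphere 0 1)) T" "diffeomorphism u T fst q" "u \<subseteq> B"
      by (rule braid_local_sheet[OF B p(1)])
    have "openin (top_of_set (\<Theta> ` B)) (\<Theta> ` u)" using homeomorphism_imp_open_map[OF k u(2)] .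
    then obtain W where W: "open W" "\<Theta> ` u = \<Theta> ` B \<inter> W" unfolding openin_open by blast
    have u1: "\<forall>p\<in>u. q (fst p) = p" "fst ` u = T" "smooth_map T q" using u(4) by (simp_all add: diffeomorphism_def)
    have TS: "T \<subseteq> sphere 0 1" using openin_imp_subset[OF u(3)] .
    have fib: "\<nu> (fst (\<Theta> p2)) = fst p2" if "p2 \<in> u" for p2
    proof -
      have "p2 \<in> B" using that u(5) by blast
      then have "fst p2 \<in> sphere 0 1" using B1(1) by auto
      then show ?thesis using comm \<open>p2 \<in> B\<close> \<mu>1(2) by simp
    qed
    have "smooth_map (\<Theta> ` u) (\<lambda>y. \<nu> (fst y))"
    proof (rule smooth_map_compose[OF smooth_map_fst \<mu>1(3)])
      show "fst ` \<Theta> ` u \<subseteq> sphere 0 1"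
      proof
        fix x assume "x \<in> fst ` \<Theta> ` u"
        then obtain p2 where p2: "p2 \<in> B" "x = fst (\<Theta> p2)" using u(5) by blast
        then have "fst p2 \<in> sphere 0 1" using B1(1) by auto
        then have "\<mu> (fst p2) \<in> sphere 0 1" using \<mu>1(1) by blast
        then show "x \<in> sphere 0 1" using comm p2 by simp
      qed
    qed
    then have "smooth_map (\<Theta> ` u) (\<lambda>y. q (\<nu> (fst y)))"
    proof (rule smooth_map_compose[OF _ u1(3)])
      show "(\<lambda>y. \<nu> (fst y)) ` \<Theta> ` u \<subseteq> T"
      proof
        fix x assume "x \<in> (\<lambda>y. \<nu> (fst y)) ` \<Theta> ` u"
        then obtain p2 where p2: "p2 \<in> u" "x = \<nu> (fst (\<Theta> p2))" by blast
        then have "x = fst p2" using fib[OF p2(1)] by simp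
        then show "x \<in> T" using u1(2) p2(1) by blast
      qed
    qed
    then have "smooth_map (\<Theta> ` u) ?\<Psi>"
    proof (rule smooth_map_cong)
      fix y assume "y \<in> \<Theta> ` u"
      then obtain p2 where p2: "p2 \<in> u" "y = \<Theta> p2" by blast
      have "p2 \<in> B" using p2(1) u(5) by blast
      then show "q (\<nu> (fst y)) = ?\<Psi> y" using fib[OF p2(1)] bspec[OF u1(1) p2(1)] inv[of p2] p2(2) by simp
    qed
    moreover have "y \<in> W" using W(2) p u(1) by blast
    ultimately show "\<exists>V. open V \<and> y \<in> V \<and> smooth_map (\<Theta> ` B \<inter> V) ?\<Psi>" using W by auto
  qed
  then show d: "diffeomorphism B (\<Theta> ` B) \<Theta> ?\<Psi>"
    using \<Theta> inv by (auto simp: diffeomorphism_def image_image f_inv_into_f intro!: image_eqI)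
  have "compact (\<Theta> ` B)" using compact_continuous_image[OF cont B1(2)] .
  moreover have "\<Theta> ` B \<subseteq> sphere 0 1 \<times> UNIV"
  proof
    fix y assume "y \<in> \<Theta> ` B"
    then obtain p where p: "p \<in> B" "y = \<Theta> p" by blast
    then have "fst p \<in> sphere 0 1" using B1(1) by auto
    then have "fst y \<in> sphere 0 1" using comm p \<mu>1(1) by auto
    then show "y \<in> sphere 0 1 \<times> UNIV" by (cases y) auto
  qed
  moreover have "embedded_1_submanifold (\<Theta> ` B)" using diffeomorphic_embedded_1_submanifold[OF B1(3) d] .
  moreover have "smooth_covering N (\<Theta> ` B) fst (sphere 0 1)"
    using diffeomorphic_smooth_covering[OF B1(4) d \<mu> smooth_map_fst comm] .
  ultimately show "solid_torus_braid N (\<Theta> ` B)" by (simp add: solid_torus_braid_def)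
qed

section \<open>The solid torus in the sphere\<close>

text \<open>The inverse of \<open>torus_to_S3\<close>, extended to all points with nonzero first
  coordinate by invariance under positive scaling. Points of a slice can thus be inserted before
  they are rescaled to the unit sphere.\<close>

definition S3_to_torus :: "complex \<times> complex \<Rightarrow> complex \<times> complex" where
  "S3_to_torus a = (sgn (fst a), snd a / of_real (norm (fst a)))"

lemma smooth_on_torus_to_S3: "smooth_on UNIV torus_to_S3"
proof -
  have "smooth_on UNIV (\<lambda>p::complex \<times> complex. (1 / sqrt (1 + snd p \<bullet> snd p)) *\<^sub>R p)"
    by (intro smooth_on_scaleR smooth_on_divide smooth_on_const smooth_on_sqrt smooth_on_add smooth_on_inner smooth_on_snd smooth_on_id open_UNIV)
      (smt (verit) inner_ge_zero real_sqrt_gt_zero)+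
  moreover have "torus_to_S3 = (\<lambda>p. (1 / sqrt (1 + snd p \<bullet> snd p)) *\<^sub>R p)"
    by (auto simp: torus_to_S3_def fun_eq_iff dot_square_norm)
  ultimately show ?thesis by simp
qed

lemma open_fst_nonzero: "open {a :: complex \<times> complex. fst a \<noteq> 0}"
  by (intro open_Collect_neq continuous_intros)

lemma smooth_on_S3_to_torus: "smooth_on {a. fst a \<noteq> 0} S3_to_torus"
proof -
  have f: "smooth_on {a::complex \<times> complex. fst a \<noteq> 0} fst" "smooth_on {a::complex \<times> complex. fst a \<noteq> 0} snd"
    using smooth_on_fst[OF open_fst_nonzero smooth_on_id[OF open_fst_nonzero]]
      smooth_on_snd[OF open_fst_nonzero smooth_on_id[OF open_fst_nonzero]] by auto
  have "smooth_on {a::complex \<times> complex. fst a \<noteq> 0} (\<lambda>a. sgn (fst a))"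
    by (rule smooth_on_compose[OF open_fst_nonzero _ _ smooth_on_sgn f(1)]) auto
  moreover have "smooth_on {a::complex \<times> complex. fst a \<noteq> 0} (\<lambda>a. snd a / of_real (norm (fst a)))"
    by (intro smooth_on_divide smooth_on_of_real smooth_on_norm f open_fst_nonzero) auto
  ultimately show ?thesis
    unfolding S3_to_torus_def[abs_def] by (intro smooth_on_Pair open_fst_nonzero)
qed

lemma fst_torus_to_S3_nonzero: "fst p \<noteq> 0 \<Longrightarrow> fst (torus_to_S3 p) \<noteq> 0"
proof -
  have "sqrt (1 + (norm z)\<^sup>2) \<noteq> 0" for z :: complex by (smt (verit) real_sqrt_gt_zero zero_le_power2)
  then show "fst p \<noteq> 0 \<Longrightarrow> fst (torus_to_S3 p) \<noteq> 0" by (cases p) (simp add: torus_to_S3_def)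
qed

lemma S3_to_torus_to_S3:
  assumes "p \<in> sphere 0 1 \<times> UNIV"
  shows "S3_to_torus (torus_to_S3 p) = p"
proof -
  obtain x z where p: "p = (x, z)" by (cases p)
  have x: "norm x = 1" "sgn x = x" using assms by (auto simp: p sgn_div_norm)
  define s where "s = 1 / sqrt (1 + (norm z)\<^sup>2)"
  have s: "s > 0" unfolding s_def by (smt (verit) divide_pos_pos real_sqrt_gt_zero zero_le_power2)
  have "S3_to_torus (s *\<^sub>R x, s *\<^sub>R z) = (x, z)"
  proof -
    have "sgn (s *\<^sub>R x) = x" unfolding sgn_scaleR using s x by simp
    moreover have "(s *\<^sub>R z) / of_real (norm (s *\<^sub>R x)) = z"
      using s x(1) by (simp add: norm_mult scaleR_conv_of_real)
    ultimately show ?thesis by (simp only: S3_to_torus_def fst_conv snd_conv)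
  qed
  then show ?thesis by (simp add: p torus_to_S3_def s_def)
qed

lemma torus_to_S3_S3_to_torus:
  assumes "fst a \<noteq> 0"
  shows "torus_to_S3 (S3_to_torus a) = (1 / norm a) *\<^sub>R a"
proof -
  obtain x z where a: "a = (x, z)" by (cases a)
  have x: "x \<noteq> 0" using assms by (simp add: a)
  have "1 + (norm (z / of_real (norm x)))\<^sup>2 = ((norm x)\<^sup>2 + (norm z)\<^sup>2) / (norm x)\<^sup>2"
    using x by (simp add: norm_divide power_divide field_simps)
  then have "sqrt (1 + (norm (z / of_real (norm x)))\<^sup>2) = norm a / norm x"
    by (simp add: a norm_prod_def real_sqrt_divide)
  then have "torus_to_S3 (S3_to_torus a) = (norm x / norm a) *\<^sub>R (sgn x, z / of_real (norm x))"
    by (simp add: a S3_to_torus_def torus_to_S3_def)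
  also have "\<dots> = (1 / norm a) *\<^sub>R a"
    using x by (simp add: a sgn_div_norm scaleR_conv_of_real)
  finally show ?thesis .
qed

lemma diffeomorphism_torus_to_S3:
  assumes "B \<subseteq> sphere 0 1 \<times> UNIV"
  shows "diffeomorphism B (torus_to_S3 ` B) torus_to_S3 S3_to_torus"
proof -
  have "smooth_map B torus_to_S3" by (rule smooth_mapI[OF open_UNIV _ smooth_on_torus_to_S3]) auto
  moreover have "smooth_map (torus_to_S3 ` B) S3_to_torus"
  proof (rule smooth_mapI[OF open_fst_nonzero _ smooth_on_S3_to_torus])
    have "fst p \<noteq> 0" if "p \<in> B" for p using that assms by auto
    then show "torus_to_S3 ` B \<subseteq> {a. fst a \<noteq> 0}" using fst_torus_to_S3_nonzero by auto
  qed
  moreover have eq: "S3_to_torus (torus_to_S3 p) = p" if "p \<in> B" for p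
    using S3_to_torus_to_S3 that assms by blast
  ultimately show ?thesis
    by (auto simp: diffeomorphism_def image_image eq)
qed

section \<open>Disks from planes\<close>

text \<open>A radial diffeomorphism of the open disk onto the plane; squared norms under the root
  keep it smooth at the origin.\<close>

definition disk_to_plane :: "complex \<Rightarrow> complex" where
  "disk_to_plane p = p /\<^sub>R sqrt (1 - p \<bullet> p)"

definition plane_to_disk :: "complex \<Rightarrow> complex" where
  "plane_to_disk w = w /\<^sub>R sqrt (1 + w \<bullet> w)"

lemma ball_iff_inner_less_1: "p \<in> ball 0 1 \<longleftrightarrow> p \<bullet> p < 1" for p :: complex
  by (simp add: dot_square_norm power_less_one_iff)

lemma smooth_on_disk_to_plane: "smooth_on unit_disk disk_to_plane"
  unfolding disk_to_plane_def[abs_def]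
  by (intro smooth_on_scaleR smooth_on_inverse smooth_on_sqrt smooth_on_diff smooth_on_inner smooth_on_const smooth_on_id open_ball)
    (drule ball_iff_inner_less_1[THEN iffD1], simp)+

lemma one_plus_inner_pos: "0 < 1 + w \<bullet> w" for w :: complex
  by (smt (verit) inner_ge_zero)

lemma smooth_on_plane_to_disk: "smooth_on UNIV plane_to_disk"
  unfolding plane_to_disk_def[abs_def]
  by (intro smooth_on_scaleR smooth_on_inverse smooth_on_sqrt smooth_on_add smooth_on_inner smooth_on_const smooth_on_id open_UNIV)
    (use one_plus_inner_pos in \<open>auto simp: less_imp_neq[symmetric]\<close>)

lemma plane_to_disk_in: "plane_to_disk w \<in> unit_disk"
  and disk_to_plane_to_disk: "p \<in> unit_disk \<Longrightarrow> plane_to_disk (disk_to_plane p) = p"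
  and plane_to_disk_to_plane: "disk_to_plane (plane_to_disk w) = w"
proof -
  have i: "plane_to_disk w \<bullet> plane_to_disk w = (w \<bullet> w) / (1 + w \<bullet> w)" for w
    using one_plus_inner_pos[of w] by (simp add: plane_to_disk_def divide_inverse power2_eq_square[symmetric] power_inverse mult.commute)
  have j: "1 - plane_to_disk w \<bullet> plane_to_disk w = 1 / (1 + w \<bullet> w)" for w
    unfolding i using one_plus_inner_pos[of w] by (simp add: field_simps)
  then have "1 - plane_to_disk w \<bullet> plane_to_disk w > 0" using one_plus_inner_pos[of w] by simp
  then show "plane_to_disk w \<in> unit_disk" by (simp only: ball_iff_inner_less_1)
  show "disk_to_plane (plane_to_disk w) = w"
    unfolding disk_to_plane_def j using one_plus_inner_pos[of w] by (simp add: plane_to_disk_def real_sqrt_divide)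
  assume "p \<in> unit_disk"
  then have p: "1 - p \<bullet> p > 0" by (simp only: ball_iff_inner_less_1)
  have "disk_to_plane p \<bullet> disk_to_plane p = (p \<bullet> p) / (1 - p \<bullet> p)"
    using p by (simp add: disk_to_plane_def divide_inverse power2_eq_square[symmetric] power_inverse mult.commute)
  then have "1 + disk_to_plane p \<bullet> disk_to_plane p = 1 / (1 - p \<bullet> p)"
    using p by (simp add: field_simps)
  then show "plane_to_disk (disk_to_plane p) = p"
    unfolding plane_to_disk_def using p by (simp add: disk_to_plane_def real_sqrt_divide)
qed

text \<open>The chain rule for both compositions with \<open>plane_to_disk\<close> shows that its
  derivative is a two-sided inverse. Injectivity serves the immersion property, surjectivity the
  transversality.\<close>

lemma disk_to_plane_deriv:
  assumes p: "p \<in> unit_disk"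
  obtains D' where "\<forall>v. D' (frechet_derivative disk_to_plane (at p) v) = v"
    "\<forall>v. frechet_derivative disk_to_plane (at p) (D' v) = v"
proof -
  let ?w = "disk_to_plane p"
  have D: "(disk_to_plane has_derivative frechet_derivative disk_to_plane (at p)) (at p)"
    using smooth_on_derivative(1)[OF smooth_on_disk_to_plane p] .
  have E: "(plane_to_disk has_derivative frechet_derivative plane_to_disk (at ?w)) (at ?w)"
    using smooth_on_derivative(1)[OF smooth_on_plane_to_disk] by simp
  have "((\<lambda>q. plane_to_disk (disk_to_plane q)) has_derivative (\<lambda>v. frechet_derivative plane_to_disk (at ?w) (frechet_derivative disk_to_plane (at p) v))) (at p)"
    using diff_chain_at[OF D E] by (simp add: o_def)
  then have 1: "((\<lambda>q. q) has_derivative (\<lambda>v. frechet_derivative plane_to_disk (at ?w) (frechet_derivative disk_to_plane (at p) v))) (at p)"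
    by (rule has_derivative_transform_within_open[OF _ open_ball p]) (rule disk_to_plane_to_disk)
  have D2: "(disk_to_plane has_derivative frechet_derivative disk_to_plane (at p)) (at (plane_to_disk ?w))"
    using D disk_to_plane_to_disk[OF p] by simp
  have 2: "((\<lambda>q. q) has_derivative (\<lambda>v. frechet_derivative disk_to_plane (at p) (frechet_derivative plane_to_disk (at ?w) v))) (at ?w)"
    using diff_chain_at[OF E D2] by (simp add: o_def plane_to_disk_to_plane)
  show thesis
    using has_derivative_unique[OF 1 has_derivative_ident] has_derivative_unique[OF 2 has_derivative_ident]
    by (intro that[of "frechet_derivative plane_to_disk (at ?w)"]) (simp_all add: fun_eq_iff)
qed

section \<open>Back to the standard coordinates, and the disk carried by a plane\<close>

definition unrotated_coords :: "complex \<times> complex \<Rightarrow> complex \<times> complex" where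
  "unrotated_coords a = ((fst a + cnj (snd a)) / sqrt 2, (snd a - cnj (fst a)) / sqrt 2)"

lemma rotated_unrotated: "rotated_coords (unrotated_coords a) = a"
proof -
  have s: "complex_of_real (sqrt 2) * complex_of_real (sqrt 2) = 2" by (simp flip: of_real_mult)
  show ?thesis
    by (cases a) (simp add: rotated_coords_def unrotated_coords_def s diff_divide_distrib[symmetric] add_divide_distrib[symmetric])
qed

lemma norm_unrotated: "norm (unrotated_coords a) = norm a"
  using rotated_coords_isometry[of "unrotated_coords a"] by (simp add: rotated_unrotated)

lemma bounded_linear_unrotated: "bounded_linear unrotated_coords"
  unfolding unrotated_coords_def[abs_def]
  by (intro bounded_linear_Pair bounded_linear_compose[OF bounded_linear_divide] bounded_linear_add bounded_linear_sub
      bounded_linear_fst bounded_linear_snd bounded_linear_compose[OF bounded_linear_cnj])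

text \<open>Polarisation: a linear map that preserves norms preserves inner products.\<close>

lemma inner_unrotated: "unrotated_coords a \<bullet> unrotated_coords b = a \<bullet> b"
proof -
  interpret bounded_linear unrotated_coords by (rule bounded_linear_unrotated)
  show ?thesis
    unfolding dot_norm add[symmetric] norm_unrotated ..
qed

definition plane_disk :: "(complex \<Rightarrow> complex \<times> complex) \<Rightarrow> complex \<Rightarrow> complex \<times> complex" where
  "plane_disk F p = unrotated_coords (F (disk_to_plane p))"

lemma plane_disk_derivative:
  assumes F: "smooth_on UNIV F" and p: "p \<in> unit_disk"
  shows "frechet_derivative (plane_disk F) (at p) =
    (\<lambda>v. unrotated_coords (frechet_derivative F (at (disk_to_plane p)) (frechet_derivative disk_to_plane (at p) v)))"
proof -
  have D: "(disk_to_plane has_derivative frechet_derivative disk_to_plane (at p)) (at p)"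
    using smooth_on_derivative(1)[OF smooth_on_disk_to_plane p] .
  have "(F has_derivative frechet_derivative F (at (disk_to_plane p))) (at (disk_to_plane p))"
    using smooth_on_derivative(1)[OF F] by simp
  from bounded_linear.has_derivative[OF bounded_linear_unrotated diff_chain_at[OF D this]]
  have "(plane_disk F has_derivative (\<lambda>v. unrotated_coords (frechet_derivative F (at (disk_to_plane p)) (frechet_derivative disk_to_plane (at p) v)))) (at p)"
    unfolding plane_disk_def[abs_def] by (simp add: o_def)
  then show ?thesis by (rule frechet_derivative_at[symmetric])
qed

lemma plane_disk_image: "plane_disk F ` unit_disk = unrotated_coords ` range F"
proof -
  have "disk_to_plane ` unit_disk = UNIV"
    using plane_to_disk_in plane_to_disk_to_plane by (metis UNIV_eq_I image_eqI)
  then show ?thesis unfolding plane_disk_def[abs_def] by (metis image_image)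
qed

lemma plane_disk_proper_lagrangian:
  assumes "lagrangian_plane F"
  shows "proper_lagrangian_disk (plane_disk F)"
proof -
  have F: "smooth_on UNIV F" and inj: "\<forall>w. inj (frechet_derivative F (at w))"
    and lag: "\<forall>w u v. Im (fst (frechet_derivative F (at w) u) * snd (frechet_derivative F (at w) v) -
       fst (frechet_derivative F (at w) v) * snd (frechet_derivative F (at w) u)) = 0"
    and proper: "\<forall>w. norm w \<ge> 1 \<longrightarrow> norm w \<le> norm (F w)"
    using assms by (simp_all add: lagrangian_plane_def)
  have s1: "smooth_on unit_disk (\<lambda>p. F (disk_to_plane p))"
    by (rule smooth_on_compose[OF open_ball open_UNIV _ F smooth_on_disk_to_plane]) auto
  have s: "smooth_on unit_disk (plane_disk F)"
    unfolding plane_disk_def[abs_def] by (rule smooth_on_bounded_linear_comp[OF open_ball bounded_linear_unrotated s1])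
  have injU: "inj unrotated_coords" by (metis injI rotated_unrotated)
  have "inj (frechet_derivative (plane_disk F) (at p))" if p: "p \<in> unit_disk" for p
  proof -
    obtain D' where "\<forall>v. D' (frechet_derivative disk_to_plane (at p) v) = v"
      by (rule disk_to_plane_deriv[OF p])
    then have inj': "inj (frechet_derivative disk_to_plane (at p))" by (metis injI)
    show ?thesis
      unfolding plane_disk_derivative[OF F p]
    proof (rule injI)
      fix x y assume "unrotated_coords (frechet_derivative F (at (disk_to_plane p)) (frechet_derivative disk_to_plane (at p) x)) =
        unrotated_coords (frechet_derivative F (at (disk_to_plane p)) (frechet_derivative disk_to_plane (at p) y))"
      then have "frechet_derivative F (at (disk_to_plane p)) (frechet_derivative disk_to_plane (at p) x) =
        frechet_derivative F (at (disk_to_plane p)) (frechet_derivative disk_to_plane (at p) y)" by (rule injD[OF injU])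
      then have "frechet_derivative disk_to_plane (at p) x = frechet_derivative disk_to_plane (at p) y"
        by (rule injD[OF spec[OF inj]])
      then show "x = y" by (rule injD[OF inj'])
    qed
  qed
  with s have imm: "immersion_on unit_disk (plane_disk F)" by (simp add: immersion_on_def)
  have lagr: "lagrangian_on unit_disk (plane_disk F)"
    unfolding lagrangian_on_def
  proof (intro ballI allI)
    fix p u v assume p: "p \<in> unit_disk"
    let ?d = "frechet_derivative disk_to_plane (at p)" and ?G = "frechet_derivative F (at (disk_to_plane p))"
    let ?w = "fst (?G (?d u)) * snd (?G (?d v)) - fst (?G (?d v)) * snd (?G (?d u))"
    \<comment> \<open>In the rotated coordinates \<open>omega\<close> is a multiple of
      \<open>?w - cnj ?w\<close>, which is \<open>2 * \<i>\<close> times the imaginary part that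
      vanishes for a \<open>lagrangian_plane\<close>.\<close>
    have "?w - cnj ?w = 0" using lag[rule_format, of "disk_to_plane p" "?d u" "?d v"] by (simp only: complex_eq_iff) simp
    then show "omega (frechet_derivative (plane_disk F) (at p) u) (frechet_derivative (plane_disk F) (at p) v) = 0"
      unfolding plane_disk_derivative[OF F p] omega_rotated_coords rotated_unrotated by (simp only: mult_zero_right)
  qed
  have "proper_map (top_of_set unit_disk) euclidean (plane_disk F)"
  proof (rule compact_imp_proper_map)
    show "plane_disk F \<in> topspace (top_of_set unit_disk) \<rightarrow> topspace euclidean" by simp
    fix K :: "(complex \<times> complex) set" assume "compactin euclidean K"
    then have K: "compact K" by simp
    \<comment> \<open>Compactness is checked in the plane, where the lower bound on
      \<open>norm (F w)\<close> makes \<open>?S\<close> bounded; the preimage in the disk is the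
      continuous image of \<open>?S\<close> under \<open>plane_to_disk\<close>.\<close>
    let ?S = "{w. unrotated_coords (F w) \<in> K}"
    have cF: "continuous_on UNIV (\<lambda>w. unrotated_coords (F w))"
      using bounded_linear.continuous_on[OF bounded_linear_unrotated smooth_on_continuous[OF F]] .
    have "closed ?S"
      using closed_vimage[OF compact_imp_closed[OF K] cF] by (simp add: vimage_def)
    moreover have "bounded ?S"
    proof -
      obtain M where M: "\<forall>x\<in>K. norm x \<le> M" using compact_imp_bounded[OF K] by (auto simp: bounded_iff)
      have "norm w \<le> max 1 M" if "w \<in> ?S" for w
      proof -
        have "norm (F w) \<le> M" using M that norm_unrotated[of "F w"] by auto
        then show ?thesis using proper[rule_format, of w] by linarith
      qed
      then show ?thesis unfolding bounded_iff by blast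
    qed
    ultimately have "compact ?S" by (simp add: compact_eq_bounded_closed)
    then have "compact (plane_to_disk ` ?S)"
      by (rule compact_continuous_image[OF continuous_on_subset[OF smooth_on_continuous[OF smooth_on_plane_to_disk]], rotated]) auto
    moreover have "{x \<in> topspace (top_of_set unit_disk). plane_disk F x \<in> K} = plane_to_disk ` ?S"
    proof (intro equalityI subsetI)
      fix x assume "x \<in> {x \<in> topspace (top_of_set unit_disk). plane_disk F x \<in> K}"
      then have x: "x \<in> unit_disk" "disk_to_plane x \<in> ?S" by (auto simp: plane_disk_def)
      then show "x \<in> plane_to_disk ` ?S" using disk_to_plane_to_disk[OF x(1)] by (metis imageI)
    next
      fix x assume "x \<in> plane_to_disk ` ?S"
      then obtain w where w: "w \<in> ?S" "x = plane_to_disk w" by blast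
      then show "x \<in> {x \<in> topspace (top_of_set unit_disk). plane_disk F x \<in> K}"
        using plane_to_disk_in[of w] by (simp add: plane_disk_def plane_to_disk_to_plane)
    qed
    moreover have "plane_to_disk ` ?S \<subseteq> unit_disk" using plane_to_disk_in by blast
    ultimately show "compactin (top_of_set unit_disk) {x \<in> topspace (top_of_set unit_disk). plane_disk F x \<in> K}"
      by (simp add: compactin_subtopology)
  qed (auto intro: Hausdorff_imp_kc_space metrizable_imp_k_space metrizable_space_euclidean
      Hausdorff_space_subtopology Hausdorff_space_euclidean)
  with imm lagr show ?thesis by (simp add: proper_lagrangian_disk_def)
qed

text \<open>The tangent space of the sphere is a hyperplane, so one tangent vector of the surface
  with nonzero component along the position vector suffices. That vector is the image of the
  direction in the disk which \<open>disk_to_plane\<close> sends to the radial direction of the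
  plane.\<close>

lemma plane_disk_transverse:
  assumes F: "smooth_on UNIV F" and tr: "\<forall>w. norm (F w) = R \<longrightarrow> frechet_derivative F (at w) w \<bullet> F w \<noteq> 0"
  shows "transverse_to_sphere (plane_disk F) R"
  unfolding transverse_to_sphere_def
proof (intro ballI impI)
  fix p assume p: "p \<in> unit_disk" and "plane_disk F p \<in> sphere 0 R"
  let ?w = "disk_to_plane p" and ?f' = "frechet_derivative (plane_disk F) (at p)"
  have "norm (F ?w) = R" using \<open>plane_disk F p \<in> sphere 0 R\<close> by (simp add: plane_disk_def norm_unrotated)
  then have nz: "frechet_derivative F (at ?w) ?w \<bullet> F ?w \<noteq> 0" using tr by blast
  obtain D' where D': "\<forall>v. D' (frechet_derivative disk_to_plane (at p) v) = v" "\<forall>v. frechet_derivative disk_to_plane (at p) (D' v) = v"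
    by (rule disk_to_plane_deriv[OF p])
  define v where "v = D' ?w"
  define s where "s = ?f' v \<bullet> plane_disk F p"
  have s: "s \<noteq> 0"
    unfolding s_def plane_disk_derivative[OF F p] v_def plane_disk_def inner_unrotated using D'(2) nz by simp
  have lin: "linear ?f'"
  proof -
    have l1: "linear (frechet_derivative disk_to_plane (at p))"
      using has_derivative_linear[OF smooth_on_derivative(1)[OF smooth_on_disk_to_plane p]] .
    have l2: "linear (frechet_derivative F (at ?w))"
      using has_derivative_linear[OF smooth_on_derivative(1)[OF F]] by simp
    have l3: "linear unrotated_coords" using bounded_linear_unrotated by (simp add: bounded_linear.linear)
    show ?thesis
      using linear_compose[OF linear_compose[OF l1 l2] l3] unfolding plane_disk_derivative[OF F p] by (simp add: o_def)
  qed
  have "y \<in> {?f' v + w | v w. w \<bullet> plane_disk F p = 0}" for y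
  proof -
    let ?c = "(y \<bullet> plane_disk F p) / s"
    have "y = ?f' (?c *\<^sub>R v) + (y - ?c *\<^sub>R ?f' v)" by (simp add: linear_cmul[OF lin])
    moreover have "(y - ?c *\<^sub>R ?f' v) \<bullet> plane_disk F p = 0"
      unfolding inner_diff_left inner_scaleR_left using s by (simp add: s_def)
    ultimately show ?thesis by blast
  qed
  then show "{?f' v + w | v w. w \<bullet> plane_disk F p = 0} = UNIV" by blast
qed

lemma rescaled_slice_plane_disk:
  "rescaled_slice (plane_disk F ` unit_disk) R = (\<lambda>w. (1 / R) *\<^sub>R F w) ` {w. norm (F w) = R}"
proof -
  have "plane_disk F ` unit_disk \<inter> sphere 0 R = (\<lambda>w. unrotated_coords (F w)) ` {w. norm (F w) = R}"
    unfolding plane_disk_image by (auto simp: norm_unrotated)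
  then show ?thesis by (simp add: rescaled_slice_def image_image rotated_unrotated)
qed

lemma rescaled_slice_UN: "rescaled_slice (\<Union>i\<in>I. L i) R = (\<Union>i\<in>I. rescaled_slice (L i) R)"
  by (auto simp: rescaled_slice_def)

section \<open>The isotopy\<close>

text \<open>For real \<open>c\<close> and \<open>norm u = 1\<close> one has
  \<open>u * cnj (1 + c * u) = u + c\<close>, so numerator and denominator have equal norm; the
  parameter \<open>- b\<close> gives the inverse. Replacing \<open>b\<close> by \<open>t * b\<close>
  yields a path of circle diffeomorphisms starting at the identity.\<close>

lemma disk_moebius_circle:
  assumes b: "0 \<le> b" "b < 1"
  shows "diffeomorphism (sphere 0 1) (sphere 0 1) (disk_moebius b) (disk_moebius (- b))"
proof -
  have abs: "norm (of_real b * u) < 1" "norm (of_real (- b) * u) < 1" if "norm u = 1" for u :: complex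
    using b that by (auto simp: norm_mult)
  have nz: "1 + of_real c * u \<noteq> (0::complex)" if "\<bar>c\<bar> < 1" "norm u = 1" for c u
  proof
    assume "1 + of_real c * u = 0"
    then have "of_real c * u = - 1" by (simp add: add_eq_0_iff)
    then have "norm (of_real c * u) = 1" by simp
    then show False using that by (simp add: norm_mult)
  qed
  have sm: "smooth_map (sphere 0 1) (disk_moebius c)" if c: "\<bar>c\<bar> < 1" for c
  proof -
    let ?U = "{u::complex. 1 + of_real c * u \<noteq> 0}"
    have op: "open ?U" by (intro open_Collect_neq continuous_intros)
    have "smooth_on ?U (disk_moebius c)"
      unfolding disk_moebius_def[abs_def]
      by (intro smooth_on_divide smooth_on_add smooth_on_mult smooth_on_const smooth_on_id op) auto
    then show ?thesis by (rule smooth_mapI[OF op, rotated]) (use nz[OF c] in auto)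
  qed
  have circ: "norm (disk_moebius c u) = 1" if c: "\<bar>c\<bar> < 1" and u: "norm u = 1" for c u
  proof -
    have "u * cnj u = 1" using u complex_norm_square[of u] by simp
    then have "u * cnj (1 + of_real c * u) = u + of_real c" by (simp add: algebra_simps)
    then have "norm (u + of_real c) = norm u * norm (cnj (1 + of_real c * u))" by (metis norm_mult)
    then have "norm (u + of_real c) = norm (1 + of_real c * u)"
      unfolding complex_mod_cnj using u by simp
    moreover have "norm (1 + of_real c * u) \<noteq> 0" using nz[OF c u] by simp
    ultimately show ?thesis by (simp add: disk_moebius_def norm_divide)
  qed
  have inv: "disk_moebius (- c) (disk_moebius c u) = u" if c: "\<bar>c\<bar> < 1" and u: "norm u = 1" for c u
  proof -
    let ?q = "1 + of_real c * u"
    have q: "?q \<noteq> 0" using nz[OF c u] .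
    have "\<bar>c\<bar> * \<bar>c\<bar> < 1 * 1" using c by (intro mult_strict_mono') auto
    then have "c * c \<noteq> 1" by auto
    then have c2: "1 - of_real c * of_real c \<noteq> (0::complex)"
      by (metis of_real_1 of_real_mult of_real_eq_iff right_minus_eq)
    have "(u + of_real c) / ?q - of_real c = (1 - of_real c * of_real c) * u / ?q"
      using q by (simp add: field_simps)
    moreover have "1 - of_real c * ((u + of_real c) / ?q) = (1 - of_real c * of_real c) / ?q"
      using q by (simp add: field_simps)
    ultimately show ?thesis
      unfolding disk_moebius_def using q c2 by simp
  qed
  have ab: "\<bar>b\<bar> < 1" "\<bar>- b\<bar> < 1" using b by auto
  have i1: "disk_moebius (- b) (disk_moebius b u) = u" "disk_moebius b (disk_moebius (- b) u) = u" if "u \<in> sphere 0 1" for u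
    using inv[OF ab(1), of u] inv[OF ab(2), of u] that by auto
  have i2: "disk_moebius b u \<in> sphere 0 1" "disk_moebius (- b) u \<in> sphere 0 1" if "u \<in> sphere 0 1" for u
    using circ[OF ab(1), of u] circ[OF ab(2), of u] that by auto
  have "disk_moebius b ` sphere 0 1 = sphere 0 1" "disk_moebius (- b) ` sphere 0 1 = sphere 0 1"
  proof -
    show "disk_moebius b ` sphere 0 1 = sphere 0 1"
    proof (intro equalityI subsetI)
      fix u :: complex assume u: "u \<in> sphere 0 1"
      show "u \<in> disk_moebius b ` sphere 0 1" by (rule image_eqI[of _ _ "disk_moebius (- b) u"]) (simp_all only: i1(2)[OF u] i2(2)[OF u])
    qed (use i2(1) in blast)
    show "disk_moebius (- b) ` sphere 0 1 = sphere 0 1"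
    proof (intro equalityI subsetI)
      fix u :: complex assume u: "u \<in> sphere 0 1"
      show "u \<in> disk_moebius (- b) ` sphere 0 1" by (rule image_eqI[of _ _ "disk_moebius b u"]) (simp_all only: i1(1)[OF u] i2(1)[OF u])
    qed (use i2(2) in blast)
  qed
  then show ?thesis using sm[OF ab(1)] sm[OF ab(2)] i1 by (simp add: diffeomorphism_def)
qed

text \<open>Near \<open>p0\<close> a continuous root is determined by its value there: it equals
  \<open>\<rho> p0 * exp (Ln (\<sigma> p / \<sigma> p0) / m)\<close>, a smooth function of
  \<open>\<sigma>\<close>. This upgrades the coordinate of a braid component from a homeomorphism to
  a smooth map.\<close>

lemma smooth_map_root:
  fixes \<rho> \<sigma> :: "'a::euclidean_space \<Rightarrow> complex"
  assumes m: "m \<ge> 1" and \<rho>: "continuous_on C \<rho>" "\<forall>p\<in>C. \<rho> p \<noteq> 0" and \<sigma>: "smooth_map C \<sigma>"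
    and root: "\<forall>p\<in>C. \<rho> p ^ m = \<sigma> p"
  shows "smooth_map C \<rho>"
proof (rule smooth_map_local)
  fix p0 assume p0: "p0 \<in> C"
  define q where "q p = \<rho> p / \<rho> p0" for p
  have nz: "\<rho> p0 \<noteq> 0" using \<rho>(2) p0 by blast
  have q0: "q p0 = 1" using nz by (simp add: q_def)
  have "continuous_on C q" unfolding q_def by (intro continuous_intros \<rho>(1)) (use nz in auto)
  \<comment> \<open>A sector around 1 on which \<open>m * Ln z\<close> has imaginary part strictly
    between \<open>- pi\<close> and \<open>pi\<close>, so that
    \<open>Ln (z ^ m) = m * Ln z\<close>.\<close>
  define A where "A = {z::complex. 0 < Re z \<and> - pi / m < Im (Ln z) \<and> Im (Ln z) < pi / m}"
  have opH: "open {z::complex. 0 < Re z}" by (intro open_Collect_less continuous_intros)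
  have cH: "continuous_on {z::complex. 0 < Re z} (\<lambda>z. Im (Ln z))"
    by (intro continuous_intros) (auto simp: complex_nonpos_Reals_iff)
  have "A = {z. 0 < Re z} \<inter> (\<lambda>z. Im (Ln z)) -` {- pi / m <..< pi / m}" by (auto simp: A_def)
  then have "open A" using continuous_open_preimage[OF cH opH, of "{- pi / m <..< pi / m}"] by simp
  have "1 \<in> A" using m by (simp add: A_def)
  obtain V where V: "open V" "\<forall>p\<in>C. p \<in> V \<longleftrightarrow> q p \<in> A"
  proof -
    have "openin (top_of_set C) (C \<inter> q -` A)"
      using \<open>continuous_on C q\<close> \<open>open A\<close> by (rule continuous_openin_preimage_gen)
    then obtain V where "open V" "C \<inter> q -` A = C \<inter> V" unfolding openin_open by blast
    then show thesis by (intro that[of V]) auto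
  qed
  define s where "s p = \<sigma> p / \<sigma> p0" for p
  have s_q: "s p = q p ^ m" if "p \<in> C" for p
    using root that p0 by (simp add: s_def q_def power_divide)
  have Ln_s: "Ln (s p) = of_nat m * Ln (q p)" if p: "p \<in> C \<inter> V" for p
  proof -
    have qA: "q p \<in> A" using V(2) p by blast
    then have q1: "q p \<noteq> 0" by (auto simp: A_def)
    have "- pi / m < Im (Ln (q p))" "Im (Ln (q p)) < pi / m" using qA by (auto simp: A_def)
    then have "- pi < m * Im (Ln (q p))" "m * Im (Ln (q p)) < pi" using m by (auto simp: field_simps)
    then have "Ln (exp (of_nat m * Ln (q p))) = of_nat m * Ln (q p)" by (intro Ln_exp) auto
    moreover have "exp (of_nat m * Ln (q p)) = s p"
      using q1 p by (simp add: exp_of_nat_mult s_q)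
    ultimately show ?thesis by simp
  qed
  have formula: "\<rho> p0 * exp (Ln (s p) / of_nat m) = \<rho> p" if p: "p \<in> C \<inter> V" for p
  proof -
    have "q p \<in> A" using V(2) p by blast
    then have "q p \<noteq> 0" by (auto simp: A_def)
    then have "exp (Ln (s p) / of_nat m) = q p" using m by (simp add: Ln_s[OF p])
    then show ?thesis using nz by (simp add: q_def)
  qed
  have s_cont: "continuous_on C s"
    unfolding s_def using smooth_map_imp_continuous_on[OF \<sigma>] root p0 nz by (intro continuous_intros) auto
  have "openin (top_of_set C) (C \<inter> s -` (- \<real>\<^sub>\<le>\<^sub>0))"
    using s_cont by (rule continuous_openin_preimage_gen) (simp add: open_Compl)
  then obtain V' where V': "open V'" "C \<inter> s -` (- \<real>\<^sub>\<le>\<^sub>0) = C \<inter> V'" unfolding openin_open by blast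
  have "smooth_map (C \<inter> (V \<inter> V')) \<rho>"
  proof (rule smooth_map_cong)
    have op: "open (- \<real>\<^sub>\<le>\<^sub>0 :: complex set)" by (simp add: open_Compl)
    have "smooth_on (- \<real>\<^sub>\<le>\<^sub>0) (\<lambda>z. \<rho> p0 * exp (Ln z / of_nat m))"
      by (intro smooth_on_mult smooth_on_const smooth_on_exp' smooth_on_divide smooth_on_Ln op) (use m in auto)
    then have 1: "smooth_map (- \<real>\<^sub>\<le>\<^sub>0) (\<lambda>z. \<rho> p0 * exp (Ln z / of_nat m))" by (rule smooth_mapI[OF op subset_refl])
    have "smooth_map UNIV (\<lambda>z. z / \<sigma> p0)"
      using root p0 nz by (intro smooth_mapI[OF open_UNIV] smooth_on_divide smooth_on_id smooth_on_const) auto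
    from smooth_map_compose[OF smooth_map_subset[OF \<sigma>] this, of "C \<inter> (V \<inter> V')"]
    have 2: "smooth_map (C \<inter> (V \<inter> V')) s" unfolding s_def by auto
    have "s ` (C \<inter> (V \<inter> V')) \<subseteq> - \<real>\<^sub>\<le>\<^sub>0" using V'(2) by blast
    then show "smooth_map (C \<inter> (V \<inter> V')) (\<lambda>p. \<rho> p0 * exp (Ln (s p) / of_nat m))"
      by (rule smooth_map_compose[OF 2 1])
  qed (use formula in auto)
  moreover have "p0 \<in> V" using V(2) p0 q0 \<open>1 \<in> A\<close> by simp
  moreover have "p0 \<in> V'" using V'(2) p0 s_q[OF p0] q0 by auto
  ultimately show "\<exists>V. open V \<and> p0 \<in> V \<and> smooth_map (C \<inter> V) \<rho>"
    using V(1) V'(1) by (intro exI[of _ "V \<inter> V'"]) auto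
qed

text \<open>A collision at time \<open>t\<close> balances the separation \<open>x - x'\<close>,
  weighted by \<open>(1 - t) + t * l\<close>, against the difference of the errors
  \<open>a - x\<close> and \<open>a' - x'\<close>, weighted by \<open>t * l\<close>. The second
  weight is at most the first, so the bound is independent of the contraction factor
  \<open>l\<close>; this permits different factors in the two fibre directions.\<close>

lemma interpolation_bound:
  fixes x x' a a' e t l :: real
  assumes t: "0 \<le> t" "t \<le> 1" and l: "l > 0" and a: "\<bar>a - x\<bar> < e" "\<bar>a' - x'\<bar> < e"
    and eq: "(1 - t) * x + t * (l * a) = (1 - t) * x' + t * (l * a')"
  shows "\<bar>x - x'\<bar> < 2 * e"
proof -
  have "t * l * ((a - x) - (a' - x')) = - ((1 - t) + t * l) * (x - x')"
    using eq by (simp add: algebra_simps)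
  then have "\<bar>t * l * ((a - x) - (a' - x'))\<bar> = \<bar>((1 - t) + t * l) * (x - x')\<bar>"
    by (simp only: mult_minus_left abs_minus_cancel)
  then have 1: "t * l * \<bar>(a - x) - (a' - x')\<bar> = ((1 - t) + t * l) * \<bar>x - x'\<bar>"
    using t l by (simp add: abs_mult)
  have 2: "\<bar>(a - x) - (a' - x')\<bar> < 2 * e" using a by linarith
  show ?thesis
  proof (cases "t = 0")
    case True
    then show ?thesis using 1 2 by simp
  next
    case False
    then have tl: "t * l > 0" using t l by simp
    have "t * l * \<bar>x - x'\<bar> \<le> ((1 - t) + t * l) * \<bar>x - x'\<bar>"
      using t by (intro mult_right_mono) auto
    then have "t * l * \<bar>x - x'\<bar> \<le> t * l * \<bar>(a - x) - (a' - x')\<bar>" using 1 by simp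
    then have "\<bar>x - x'\<bar> \<le> \<bar>(a - x) - (a' - x')\<bar>" using mult_le_cancel_left_pos[OF tl] by blast
    then show ?thesis using 2 by linarith
  qed
qed

text \<open>Maximality is transferred forward: a connected set containing the image of
  \<open>C\<close> under \<open>g\<close> maps under \<open>f\<close> to a connected set containing
  \<open>C\<close>, hence to \<open>C\<close> itself.\<close>

lemma homeomorphism_components:
  assumes h: "homeomorphism S T f g" and C: "C \<in> components T"
  shows "g ` C \<in> components S"
proof -
  have h1: "\<forall>x\<in>S. g (f x) = x" "f ` S = T" "continuous_on S f" "\<forall>y\<in>T. f (g y) = y" "g ` T = S" "continuous_on T g"
    using h by (simp_all add: homeomorphism_def)
  have CC: "C \<noteq> {} \<and> C \<subseteq> T \<and> connected C \<and> (\<forall>D. D \<noteq> {} \<and> C \<subseteq> D \<and> D \<subseteq> T \<and> connected D \<longrightarrow> D = C)"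
    using C by (rule iffD1[OF in_components_maximal])
  then have C1: "C \<noteq> {}" "C \<subseteq> T" "connected C" by - ((elim conjE, assumption)+)
  have max: "\<forall>D. D \<noteq> {} \<and> C \<subseteq> D \<and> D \<subseteq> T \<and> connected D \<longrightarrow> D = C"
    using CC by (elim conjE)
  have fg: "f ` g ` C = C" using h1(4) C1(2) by (force simp: image_image)
  show ?thesis
    unfolding in_components_maximal
  proof (intro conjI allI impI)
    show "g ` C \<noteq> {}" using C1 by simp
    show "g ` C \<subseteq> S" using C1 h1(5) by blast
    show "connected (g ` C)" using connected_continuous_image[OF continuous_on_subset[OF h1(6) C1(2)] C1(3)] .
    fix D assume D: "D \<noteq> {} \<and> g ` C \<subseteq> D \<and> D \<subseteq> S \<and> connected D"
    then have "connected (f ` D)" using connected_continuous_image[OF continuous_on_subset[OF h1(3)]] by blast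
    moreover have "C \<subseteq> f ` D" using fg D by (metis image_mono)
    moreover have "f ` D \<subseteq> T" "f ` D \<noteq> {}" using D h1(2) by blast+
    ultimately have "f ` D = C" by (intro max[rule_format] conjI)
    have "\<forall>x\<in>D. g (f x) = x" using h1(1) D by blast
    then have "g ` f ` D = D" by (simp add: image_image cong: image_cong)
    with \<open>f ` D = C\<close> show "D = g ` C" by simp
  qed
qed

section \<open>Assembling the disks and the isotopy\<close>

theorem mainTheorem1:
  fixes N n :: nat
    and K :: "(complex \<times> complex) set"
    and C :: "nat \<Rightarrow> (complex \<times> complex) set"
  assumes "N \<ge> 1" and "n \<ge> 1"
    and "S3_braid N K"
    and "bij_betw C {1..n} (components K)"
  shows "\<exists>f :: nat \<Rightarrow> complex \<Rightarrow> complex \<times> complex. \<exists>L.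
           (\<forall>j\<in>{1..n}. proper_lagrangian_disk (f j)) \<and>
           L = (\<Union>j\<in>{1..n}. f j ` unit_disk) \<and>
           (\<exists>R0>0. \<forall>R\<ge>R0.
              (\<forall>j\<in>{1..n}. transverse_to_sphere (f j) R) \<and>
              S3_braid N (rescaled_slice L R) \<and>
              (\<exists>\<Phi>. braid_isotopy N \<Phi> K (rescaled_slice L R) \<and>
                   (\<forall>j\<in>{1..n}. \<Phi> 1 ` C j = rescaled_slice (f j ` unit_disk) R))) \<and>
           (connected K \<longrightarrow> (\<exists>g. proper_lagrangian_disk g \<and> L = g ` unit_disk))"
proof -
  obtain B where B: "solid_torus_braid N B" and K: "K = torus_to_S3 ` B"
    using assms(3) by (auto simp: S3_braid_def)
  have B_sub: "B \<subseteq> sphere 0 1 \<times> UNIV" using B by (simp add: solid_torus_braid_def)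
  have fst_B: "fst p \<in> sphere 0 1" "norm (fst p) = 1" if "p \<in> B" for p using that B_sub by auto
  have dT: "diffeomorphism B K torus_to_S3 S3_to_torus"
    unfolding K by (rule diffeomorphism_torus_to_S3[OF B_sub])
  have KB: "S3_to_torus ` K = B" "\<forall>x\<in>K. torus_to_S3 (S3_to_torus x) = x" "\<forall>p\<in>B. S3_to_torus (torus_to_S3 p) = p" "smooth_map K S3_to_torus"
    using dT by (simp_all add: diffeomorphism_def)
  obtain d where d: "d > 0" "\<forall>\<zeta> z z'. (\<zeta>, z) \<in> B \<longrightarrow> (\<zeta>, z') \<in> B \<longrightarrow> z \<noteq> z' \<longrightarrow> d \<le> dist z z'"
    by (rule braid_strand_separation[OF B])
  \<comment> \<open>If two strands collided, their real and imaginary parts would each differ by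
    less than \<open>2 * (5 * \<epsilon>) = d / 2\<close>, so their distance would be less than
    \<open>d\<close>.\<close>
  define \<epsilon> where "\<epsilon> = d / 20"
  have \<epsilon>: "\<epsilon> > 0" using d(1) by (simp add: \<epsilon>_def)
  obtain b where b: "0 \<le> b" "b < 1" and nf:
    "\<forall>C\<in>components B. \<exists>m \<rho> E. m \<ge> 1 \<and> homeomorphism C (sphere 0 1) \<rho> E \<and>
       (\<forall>p\<in>C. \<rho> p ^ m = disk_moebius b (fst p)) \<and>
       \<bar>integral {0..2 * pi} (\<lambda>t. Re (cis t ^ m * snd (E (cis t))))\<bar> < \<epsilon>"
    by (rule braid_normal_form[OF B assms(1) \<epsilon>])
  define I where "I = {1..n}"
  have C_comp: "C j \<in> components K" if "j \<in> I" for j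
    using assms(4) that unfolding I_def by (rule bij_betw_apply)
  have C_sub: "C j \<subseteq> K" if "j \<in> I" for j using in_components_subset[OF C_comp[OF that]] .
  have C_Un: "(\<Union>j\<in>I. C j) = K"
    using bij_betw_imp_surj_on[OF assms(4)] Union_components[of K] unfolding I_def by simp
  define D where "D j = S3_to_torus ` C j" for j
  have D_comp: "D j \<in> components B" if "j \<in> I" for j
    unfolding D_def by (rule homeomorphism_components[OF diffeomorphism_imp_homeomorphism[OF dT] C_comp[OF that]])
  have D_sub: "D j \<subseteq> B" if "j \<in> I" for j using in_components_subset[OF D_comp[OF that]] .
  have D_Un: "(\<Union>j\<in>I. D j) = B"
    unfolding D_def KB(1)[symmetric] C_Un[symmetric] by blast
  have C_D: "torus_to_S3 ` D j = C j" if "j \<in> I" for j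
    unfolding D_def using KB(2) C_sub[OF that] by (force simp: image_image)
  have D_disj: "D i \<inter> D j = {}" if "i \<in> I" "j \<in> I" "i \<noteq> j" for i j
  proof (rule ccontr)
    assume "D i \<inter> D j \<noteq> {}"
    then have "D i = D j" using components_eq[OF D_comp[OF that(1)] D_comp[OF that(2)]] by blast
    then have "C i = C j" using C_D[OF that(1)] C_D[OF that(2)] by simp
    then show False using bij_betw_imp_inj_on[OF assms(4)] that unfolding I_def inj_on_def by blast
  qed
  have D_closed: "closed (D j)" if "j \<in> I" for j
    using closed_components[OF _ D_comp[OF that]] B by (simp add: solid_torus_braid_def compact_imp_closed)
  \<comment> \<open>All data of one component are bundled so that they can be chosen for every index
    at once. The parametrisation \<open>\<psi>\<close> stays existential inside, since it depends on
    the radius \<open>R\<close>.\<close>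
  define Q where "Q j m \<rho> E F r \<longleftrightarrow> m \<ge> 1 \<and> homeomorphism (D j) (sphere 0 1) \<rho> E \<and>
    (\<forall>p\<in>D j. \<rho> p ^ m = disk_moebius b (fst p)) \<and> r > 0 \<and> lagrangian_plane F \<and>
    (\<forall>R\<ge>r. \<forall>w. norm (F w) = R \<longrightarrow> frechet_derivative F (at w) w \<bullet> F w \<noteq> 0) \<and>
    (\<forall>R\<ge>r. \<exists>\<psi>. braid_slice F m (\<lambda>\<omega>. \<omega> ^ m * snd (E \<omega>)) (5 * \<epsilon>) R \<psi>)"
    for j and m :: nat and \<rho> E and F :: "complex \<Rightarrow> complex \<times> complex" and r :: real
  have "\<exists>m \<rho> E F r. Q j m \<rho> E F r" if j: "j \<in> I" for j
  proof -
    from bspec[OF nf D_comp[OF j]] obtain m \<rho> E where m: "m \<ge> 1" and h: "homeomorphism (D j) (sphere 0 1) \<rho> E"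
      and root: "\<forall>p\<in>D j. \<rho> p ^ m = disk_moebius b (fst p)"
      and mean: "\<bar>integral {0..2 * pi} (\<lambda>t. Re (cis t ^ m * snd (E (cis t))))\<bar> < \<epsilon>"
      by (elim exE conjE)
    have "continuous_on (sphere 0 1) E" using h by (simp add: homeomorphism_def)
    then have Y: "continuous_on (sphere 0 1) (\<lambda>\<omega>. \<omega> ^ m * snd (E \<omega>))" by (intro continuous_intros)
    show ?thesis
      by (rule lagrangian_plane_asymptotics[OF m Y \<epsilon> mean], rule exI[of _ m], rule exI[of _ \<rho>], rule exI[of _ E],
          intro exI, unfold Q_def, intro conjI m h root)
  qed
  then have "\<forall>j. \<exists>m \<rho> E F r. j \<in> I \<longrightarrow> Q j m \<rho> E F r" by blast
  then obtain m \<rho> E F r where Q: "\<forall>j. j \<in> I \<longrightarrow> Q j (m j) (\<rho> j) (E j) (F j) (r j)" by metis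
  have q1: "homeomorphism (D j) (sphere 0 1) (\<rho> j) (E j)" "\<forall>p\<in>D j. \<rho> j p ^ m j = disk_moebius b (fst p)"
      "m j \<ge> 1" "r j > 0" "lagrangian_plane (F j)"
      "\<forall>R\<ge>r j. \<forall>w. norm (F j w) = R \<longrightarrow> frechet_derivative (F j) (at w) w \<bullet> F j w \<noteq> 0"
    if j: "j \<in> I" for j
    using Q[rule_format, OF j] unfolding Q_def by - ((elim conjE, assumption)+)
  have sF: "smooth_on UNIV (F j)" if "j \<in> I" for j
    using q1(5)[OF that] by (simp add: lagrangian_plane_def)
  have q2: "\<forall>R\<ge>r j. \<exists>\<psi>. braid_slice (F j) (m j) (\<lambda>\<omega>. \<omega> ^ m j * snd (E j \<omega>)) (5 * \<epsilon>) R \<psi>"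
    if j: "j \<in> I" for j
    using Q[rule_format, OF j] unfolding Q_def by (elim conjE)
  define f where "f j = plane_disk (F j)" for j
  define L where "L = (\<Union>j\<in>{1..n}. f j ` unit_disk)"
  have proper: "proper_lagrangian_disk (f j)" if "j \<in> I" for j
    unfolding f_def by (rule plane_disk_proper_lagrangian[OF q1(5)[OF that]])
  define R0 where "R0 = Max (r ` I)"
  have fin: "finite I" "I \<noteq> {}" using assms(2) by (auto simp: I_def)
  have R0: "r j \<le> R0" if "j \<in> I" for j unfolding R0_def using fin that by simp
  have "R0 > 0" using fin(2) R0 q1(4) by (metis ex_in_conv less_le_trans)
  have slices: "(\<forall>j\<in>{1..n}. transverse_to_sphere (f j) R) \<and> S3_braid N (rescaled_slice L R) \<and>
      (\<exists>\<Phi>. braid_isotopy N \<Phi> K (rescaled_slice L R) \<and> (\<forall>j\<in>{1..n}. \<Phi> 1 ` C j = rescaled_slice (f j ` unit_disk) R))"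
    if R: "R \<ge> R0" for R
  proof -
    have Rpos: "R > 0" using R \<open>R0 > 0\<close> by linarith
    have Rr: "R \<ge> r j" if "j \<in> I" for j using R R0[OF that] by linarith
    have trans: "transverse_to_sphere (f j) R" if "j \<in> I" for j
      unfolding f_def using plane_disk_transverse[OF sF[OF that]] q1(6)[OF that] Rr[OF that] by blast
    have "\<forall>j. \<exists>\<psi>. j \<in> I \<longrightarrow> braid_slice (F j) (m j) (\<lambda>\<omega>. \<omega> ^ m j * snd (E j \<omega>)) (5 * \<epsilon>) R \<psi>"
      using q2 Rr by blast
    then obtain \<psi> where P: "\<forall>j. j \<in> I \<longrightarrow> braid_slice (F j) (m j) (\<lambda>\<omega>. \<omega> ^ m j * snd (E j \<omega>)) (5 * \<epsilon>) R (\<psi> j)" by metis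
    have p1: "smooth_map (sphere 0 1) (\<psi> j)" "{w. norm (F j w) = R} = \<psi> j ` sphere 0 1" if j: "j \<in> I" for j
      using P[rule_format, OF j] unfolding braid_slice_def by - ((elim conjE, assumption)+)
    have p2: "fst (F j (\<psi> j \<omega>)) \<noteq> 0 \<and> sgn (fst (F j (\<psi> j \<omega>))) = \<omega> ^ m j \<and>
         (\<exists>a b. \<bar>a - Re (\<omega> ^ m j * snd (E j \<omega>))\<bar> < 5 * \<epsilon> \<and> \<bar>b - Im (\<omega> ^ m j * snd (E j \<omega>))\<bar> < 5 * \<epsilon> \<and>
           \<omega> ^ m j * (snd (F j (\<psi> j \<omega>)) / of_real (norm (fst (F j (\<psi> j \<omega>))))) = Complex (a / R\<^sup>2) (2 * b / R ^ 4))"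
      if j: "j \<in> I" and \<omega>: "\<omega> \<in> sphere 0 1" for j \<omega>
      using P[rule_format, OF j] \<omega> unfolding braid_slice_def by (elim conjE) (rule bspec)
    have \<rho>1: "\<rho> j ` D j = sphere 0 1" "\<forall>p\<in>D j. E j (\<rho> j p) = p" "continuous_on (D j) (\<rho> j)" if "j \<in> I" for j
      using q1(1)[OF that] by (simp_all add: homeomorphism_def)
    \<comment> \<open>The components are disjoint, so \<open>ix\<close> recovers the index of the
      component through a point, and the separate constructions glue to maps on all of
      \<open>B\<close>.\<close>
    define ix where "ix p = (SOME j. j \<in> I \<and> p \<in> D j)" for p
    have ix: "ix p = j" if j: "j \<in> I" "p \<in> D j" for j p
    proof -
      have "ix p \<in> I \<and> p \<in> D (ix p)" unfolding ix_def by (rule someI[of _ j]) (use j in blast)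
      then show ?thesis using D_disj[of "ix p" j] j by blast
    qed
    \<comment> \<open>The point of radius \<open>R\<close>, in rotated coordinates, that is matched
      with the point \<open>p\<close> of the braid.\<close>
    define G where "G p = F (ix p) (\<psi> (ix p) (\<rho> (ix p) p))" for p
    have G: "G p = F j (\<psi> j (\<rho> j p))" if "j \<in> I" "p \<in> D j" for j p unfolding G_def ix[OF that] ..
    define Z where "Z p = snd (S3_to_torus (G p))" for p
    have G_facts: "fst (G p) \<noteq> 0 \<and> sgn (fst (G p)) = disk_moebius b (fst p) \<and> norm (G p) = R \<and>
      (\<exists>a c. \<bar>a - Re (disk_moebius b (fst p) * snd p)\<bar> < 5 * \<epsilon> \<and> \<bar>c - Im (disk_moebius b (fst p) * snd p)\<bar> < 5 * \<epsilon> \<and>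
        disk_moebius b (fst p) * Z p = Complex (a / R\<^sup>2) (2 * c / R ^ 4))" if p: "p \<in> B" for p
    proof -
      obtain j where j: "j \<in> I" "p \<in> D j" using p unfolding D_Un[symmetric] by blast
      have \<omega>: "\<rho> j p \<in> sphere 0 1" using \<rho>1(1)[OF j(1)] j(2) by blast
      have mo: "\<rho> j p ^ m j = disk_moebius b (fst p)" using q1(2)[OF j(1)] j(2) by blast
      have "E j (\<rho> j p) = p" using \<rho>1(2)[OF j(1)] j(2) by blast
      \<comment> \<open>Since \<open>\<rho> j p ^ m j = disk_moebius b (fst p)\<close> and
        \<open>E j (\<rho> j p) = p\<close>, the target becomes
        \<open>disk_moebius b (fst p) * snd p\<close>. The component no longer occurs in it, so
        strands of different components are compared on the same footing.\<close>
      note facts = p2[OF j(1) \<omega>, unfolded this mo, folded G[OF j]]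
      have "\<psi> j (\<rho> j p) \<in> {w. norm (F j w) = R}" using p1(2)[OF j(1)] \<omega> by blast
      then have "norm (G p) = R" using G[OF j] by simp
      then show ?thesis using facts by (simp add: Z_def S3_to_torus_def)
    qed
    have moeb_smooth: "smooth_map (sphere 0 1) (disk_moebius b)"
      using disk_moebius_circle[OF b] by (simp add: diffeomorphism_def)
    have smZ: "smooth_map B Z"
    proof (rule smooth_map_local)
      fix p assume "p \<in> B"
      then obtain j where j: "j \<in> I" "p \<in> D j" unfolding D_Un[symmetric] by blast
      \<comment> \<open>The components are closed and finite in number, so removing the others
        leaves an open set that meets \<open>B\<close> exactly in \<open>D j\<close>; smoothness can
        be tested there.\<close>
      define V where "V = - (\<Union>i\<in>I - {j}. D i)"
      have "open V" unfolding V_def using fin(1) D_closed by (intro open_Compl closed_UN) auto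
      moreover have BV: "B \<inter> V = D j"
        unfolding V_def D_Un[symmetric] using D_disj[OF _ j(1)] j(1) by blast
      moreover have "smooth_map (D j) Z"
      proof (rule smooth_map_cong)
        have "smooth_map (D j) (\<lambda>p. disk_moebius b (fst p))"
          by (rule smooth_map_compose[OF smooth_map_fst moeb_smooth]) (use D_sub[OF j(1)] fst_B in blast)
        moreover have "\<forall>p\<in>D j. \<rho> j p \<noteq> 0"
        proof
          fix p assume "p \<in> D j"
          then have "\<rho> j p \<in> sphere 0 1" using \<rho>1(1)[OF j(1)] by blast
          then show "\<rho> j p \<noteq> 0" by auto
        qed
        ultimately have "smooth_map (D j) (\<rho> j)"
          using smooth_map_root[OF q1(3)[OF j(1)] \<rho>1(3)[OF j(1)]] q1(2)[OF j(1)] by blast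
        then have "smooth_map (D j) (\<lambda>p. \<psi> j (\<rho> j p))"
          by (rule smooth_map_compose[OF _ p1(1)[OF j(1)]]) (use \<rho>1(1)[OF j(1)] in blast)
        then have "smooth_map (D j) (\<lambda>p. F j (\<psi> j (\<rho> j p)))"
          by (rule smooth_map_compose[OF _ smooth_mapI[OF open_UNIV subset_UNIV sF[OF j(1)]]]) (rule subset_UNIV)
        then have "smooth_map (D j) (\<lambda>p. S3_to_torus (F j (\<psi> j (\<rho> j p))))"
        proof (rule smooth_map_compose[OF _ smooth_mapI[OF open_fst_nonzero subset_refl smooth_on_S3_to_torus]])
          show "(\<lambda>p. F j (\<psi> j (\<rho> j p))) ` D j \<subseteq> {a. fst a \<noteq> 0}"
            using p2[OF j(1)] \<rho>1(1)[OF j(1)] by blast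
        qed
        then show "smooth_map (D j) (\<lambda>p. snd (S3_to_torus (F j (\<psi> j (\<rho> j p)))))"
          by (rule smooth_map_compose[OF _ smooth_map_snd]) (rule subset_UNIV)
      qed (simp add: Z_def G[OF j(1)])
      ultimately show "\<exists>V. open V \<and> p \<in> V \<and> smooth_map (B \<inter> V) Z"
        using j(2) by (intro exI[of _ V]) auto
    qed
    \<comment> \<open>The base is moved by the path of transformations with parameter
      \<open>t * b\<close>, while the fibre coordinate is interpolated linearly towards the slice.
      Time 0 is the identity and time 1 sends \<open>p\<close> to
      \<open>S3_to_torus (G p)\<close>.\<close>
    define \<Theta> where "\<Theta> t p = (disk_moebius (t * b) (fst p), (1 - t) *\<^sub>R snd p + t *\<^sub>R Z p)" for t p
    have tb: "0 \<le> t * b" "t * b < 1" if "t \<in> {0..1}" for t :: real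
      using that b mult_left_le_one_le[of b t] by auto
    have joint: "smooth_map ({0..1} \<times> B) (\<lambda>x. \<Theta> (fst x) (snd x))"
    proof -
      \<comment> \<open>Joint smoothness in time and position is obtained by substituting
        \<open>t\<close>, \<open>fst p\<close>, \<open>snd p\<close> and \<open>Z p\<close> into one
        explicit formula that is smooth wherever its denominator does not vanish.\<close>
      let ?U = "{y :: real \<times> complex \<times> complex \<times> complex. 1 + of_real (fst y * b) * fst (snd y) \<noteq> 0}"
      let ?H = "\<lambda>y :: real \<times> complex \<times> complex \<times> complex.
        ((fst (snd y) + of_real (fst y * b)) / (1 + of_real (fst y * b) * fst (snd y)),
         (1 - fst y) *\<^sub>R fst (snd (snd y)) + fst y *\<^sub>R snd (snd (snd y)))"
      let ?X = "{0..1::real} \<times> B"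
      have op: "open ?U" by (intro open_Collect_neq continuous_intros)
      have H: "smooth_on ?U ?H"
        by (intro smooth_on_Pair smooth_on_divide smooth_on_add smooth_on_mult smooth_on_scaleR smooth_on_diff smooth_on_of_real
            smooth_on_fst smooth_on_snd smooth_on_const smooth_on_id op) auto
      have s2: "smooth_map ?X (\<lambda>x. fst (snd x))" "smooth_map ?X (\<lambda>x. snd (snd x))"
        by (rule smooth_map_compose[OF smooth_map_snd smooth_map_fst subset_UNIV],
            rule smooth_map_compose[OF smooth_map_snd smooth_map_snd subset_UNIV])
      have s3: "smooth_map ?X (\<lambda>x. Z (snd x))"
        by (rule smooth_map_compose[OF smooth_map_snd smZ]) auto
      have g: "smooth_map ?X (\<lambda>x. (fst x, fst (snd x), snd (snd x), Z (snd x)))"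
        by (intro smooth_map_Pair smooth_map_fst s2 s3)
      have gU: "(\<lambda>x. (fst x, fst (snd x), snd (snd x), Z (snd x))) ` ?X \<subseteq> ?U"
      proof
        fix y assume "y \<in> (\<lambda>x. (fst x, fst (snd x), snd (snd x), Z (snd x))) ` ?X"
        then obtain t p where tp: "t \<in> {0..1}" "p \<in> B" "y = (t, fst p, snd p, Z p)" by auto
        have "Re (1 + of_real (t * b) * fst p) > 0"
          using Re_one_pm_pos(2)[OF tb[OF tp(1)] fst_B(2)[OF tp(2)]] .
        then have "1 + of_real (t * b) * fst p \<noteq> 0" by (metis less_irrefl zero_complex.sel(1))
        then show "y \<in> ?U" by (simp only: tp(3) mem_Collect_eq fst_conv snd_conv not_False_eq_True)
      qed
      show ?thesis
        using smooth_map_compose[OF g smooth_mapI[OF op subset_refl H] gU]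
        by (simp add: \<Theta>_def disk_moebius_def)
    qed
    have sm\<Theta>: "smooth_map B (\<Theta> t)" if t: "t \<in> {0..1}" for t
    proof -
      have "smooth_map B (\<lambda>p. (t, p))"
        by (rule smooth_mapI[OF open_UNIV subset_UNIV]) (intro smooth_on_Pair smooth_on_const smooth_on_id open_UNIV)
      moreover have "Pair t ` B \<subseteq> {0..1} \<times> B" using t by auto
      ultimately have "smooth_map B (\<lambda>p. \<Theta> (fst (t, p)) (snd (t, p)))" by (rule smooth_map_compose[OF _ joint])
      then show ?thesis by simp
    qed
    have inj\<Theta>: "inj_on (\<Theta> t) B" if t: "t \<in> {0..1}" for t
    proof (rule inj_onI)
      fix p p' assume p: "p \<in> B" and p': "p' \<in> B" and eq: "\<Theta> t p = \<Theta> t p'"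
      let ?u = "disk_moebius b (fst p)"
      have "disk_moebius (t * b) (fst p) = disk_moebius (t * b) (fst p')" using eq by (simp add: \<Theta>_def)
      then have f: "fst p = fst p'"
        using diffeomorphism_inj[OF disk_moebius_circle[OF tb[OF t]] fst_B(1)[OF p] fst_B(1)[OF p']] by blast
      obtain a c where ac: "\<bar>a - Re (?u * snd p)\<bar> < 5 * \<epsilon>" "\<bar>c - Im (?u * snd p)\<bar> < 5 * \<epsilon>"
        "?u * Z p = Complex (a / R\<^sup>2) (2 * c / R ^ 4)"
        using G_facts[OF p] by blast
      obtain a' c' where ac': "\<bar>a' - Re (?u * snd p')\<bar> < 5 * \<epsilon>" "\<bar>c' - Im (?u * snd p')\<bar> < 5 * \<epsilon>"
        "?u * Z p' = Complex (a' / R\<^sup>2) (2 * c' / R ^ 4)"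
        using G_facts[OF p'] unfolding f by blast
      have "(1 - t) *\<^sub>R snd p + t *\<^sub>R Z p = (1 - t) *\<^sub>R snd p' + t *\<^sub>R Z p'" using eq by (simp add: \<Theta>_def)
      \<comment> \<open>The two points lie over the same base point, so the same factor
        \<open>?u\<close> of norm 1 applies to both. It aligns the fibre with the two contracted
        directions and preserves distances, so the real and the imaginary part can be treated
        separately.\<close>
      then have "?u * ((1 - t) *\<^sub>R snd p + t *\<^sub>R Z p) = ?u * ((1 - t) *\<^sub>R snd p' + t *\<^sub>R Z p')" by (simp only:)
      then have e: "(1 - t) *\<^sub>R (?u * snd p) + t *\<^sub>R (?u * Z p) = (1 - t) *\<^sub>R (?u * snd p') + t *\<^sub>R (?u * Z p')"
        by (simp only: distrib_left mult_scaleR_right)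
      have eR: "(1 - t) * Re (?u * snd p) + t * (1 / R\<^sup>2 * a) = (1 - t) * Re (?u * snd p') + t * (1 / R\<^sup>2 * a')"
        using arg_cong[OF e, of Re] unfolding ac(3) ac'(3) by (simp del: times_complex.sel)
      have eI: "(1 - t) * Im (?u * snd p) + t * (2 / R ^ 4 * c) = (1 - t) * Im (?u * snd p') + t * (2 / R ^ 4 * c')"
        using arg_cong[OF e, of Im] unfolding ac(3) ac'(3) by (simp del: times_complex.sel)
      have t01: "0 \<le> t" "t \<le> 1" using t by auto
      have "\<bar>Re (?u * snd p) - Re (?u * snd p')\<bar> < 2 * (5 * \<epsilon>)"
        by (rule interpolation_bound[OF t01 _ ac(1) ac'(1) eR]) (use Rpos in simp)
      moreover have "\<bar>Im (?u * snd p) - Im (?u * snd p')\<bar> < 2 * (5 * \<epsilon>)"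
        by (rule interpolation_bound[OF t01 _ ac(2) ac'(2) eI]) (use Rpos in simp)
      moreover have "norm (?u * snd p - ?u * snd p') \<le> \<bar>Re (?u * snd p - ?u * snd p')\<bar> + \<bar>Im (?u * snd p - ?u * snd p')\<bar>"
        by (rule cmod_le)
      ultimately have "norm (?u * snd p - ?u * snd p') < d" unfolding \<epsilon>_def minus_complex.sel by linarith
      moreover have "norm ?u = 1"
        using disk_moebius_circle[OF b] fst_B(1)[OF p] by (auto simp: diffeomorphism_def)
      ultimately have lt: "dist (snd p) (snd p') < d"
        by (simp add: dist_norm right_diff_distrib[symmetric] norm_mult)
      have "(fst p, snd p) \<in> B" using p by simp
      moreover have "(fst p, snd p') \<in> B" unfolding f using p' by simp
      ultimately have "snd p = snd p'" using d(2) lt by (meson not_less)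
      then show "p = p'" using f by (simp add: prod_eq_iff)
    qed
    have braid: "solid_torus_braid N (\<Theta> t ` B)" "diffeomorphism B (\<Theta> t ` B) (\<Theta> t) (inv_into B (\<Theta> t))"
      if t: "t \<in> {0..1}" for t
      by (rule braid_image[OF B sm\<Theta>[OF t] inj\<Theta>[OF t] disk_moebius_circle[OF tb[OF t]]], simp add: \<Theta>_def)+
    define \<Phi> where "\<Phi> t x = torus_to_S3 (\<Theta> t (S3_to_torus x))" for t x
    have \<Phi>_img: "\<Phi> t ` K = torus_to_S3 ` \<Theta> t ` B" for t
      unfolding \<Phi>_def KB(1)[symmetric] by (simp add: image_image)
    have iso: "S3_braid N (\<Phi> t ` K) \<and> (\<exists>\<Psi>. diffeomorphism K (\<Phi> t ` K) (\<Phi> t) \<Psi>)" if t: "t \<in> {0..1}" for t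
    proof
      show "S3_braid N (\<Phi> t ` K)" unfolding \<Phi>_img S3_braid_def using braid(1)[OF t] by blast
      have "\<Theta> t ` B \<subseteq> sphere 0 1 \<times> UNIV" using braid(1)[OF t] by (simp add: solid_torus_braid_def)
      from diffeomorphism_trans[OF diffeomorphism_trans[OF diffeomorphism_sym[OF dT] braid(2)[OF t]] diffeomorphism_torus_to_S3[OF this]]
      show "\<exists>\<Psi>. diffeomorphism K (\<Phi> t ` K) (\<Phi> t) \<Psi>" unfolding \<Phi>_img unfolding \<Phi>_def[abs_def] by blast
    qed
    have \<Phi>1: "\<Phi> 1 ` C j = rescaled_slice (f j ` unit_disk) R" if j: "j \<in> I" for j
    proof -
      have "torus_to_S3 (\<Theta> 1 p) = (1 / R) *\<^sub>R F j (\<psi> j (\<rho> j p))" if p: "p \<in> D j" for p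
      proof -
        have pB: "p \<in> B" using D_sub[OF j] p by blast
        note gf = G_facts[OF pB]
        have "\<Theta> 1 p = S3_to_torus (G p)" using gf by (simp add: \<Theta>_def Z_def S3_to_torus_def)
        \<comment> \<open>Passing to the solid torus and back is radial projection to the unit
          sphere, and \<open>norm (G p) = R\<close> makes it the required rescaling.\<close>
        then have "torus_to_S3 (\<Theta> 1 p) = (1 / norm (G p)) *\<^sub>R G p" using torus_to_S3_S3_to_torus gf by simp
        then show ?thesis using gf G[OF j p] by simp
      qed
      then have "(\<lambda>p. torus_to_S3 (\<Theta> 1 p)) ` D j = (\<lambda>p. (1 / R) *\<^sub>R F j (\<psi> j (\<rho> j p))) ` D j"
        by (rule image_cong[OF refl])
      also have "\<dots> = (\<lambda>w. (1 / R) *\<^sub>R F j w) ` \<psi> j ` \<rho> j ` D j" by (simp add: image_image)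
      also have "\<dots> = rescaled_slice (f j ` unit_disk) R"
        unfolding f_def rescaled_slice_plane_disk p1(2)[OF j] \<rho>1(1)[OF j] ..
      finally show ?thesis unfolding \<Phi>_def D_def by (simp add: image_image)
    qed
    have \<Phi>1K: "\<Phi> 1 ` K = rescaled_slice L R"
      unfolding L_def rescaled_slice_UN C_Un[symmetric] image_UN using \<Phi>1 unfolding I_def by simp
    have "braid_isotopy N \<Phi> K (rescaled_slice L R)"
      unfolding braid_isotopy_def
    proof (intro conjI)
      have "smooth_map ({0..1} \<times> K) (\<lambda>x. S3_to_torus (snd x))"
        by (rule smooth_map_compose[OF smooth_map_snd KB(4)]) auto
      then have "smooth_map ({0..1} \<times> K) (\<lambda>x. (fst x, S3_to_torus (snd x)))"
        by (intro smooth_map_Pair smooth_map_fst)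
      from smooth_map_compose[OF this joint]
      have "smooth_map ({0..1} \<times> K) (\<lambda>x. \<Theta> (fst x) (S3_to_torus (snd x)))"
        using KB(1) by force
      from smooth_map_compose[OF this smooth_mapI[OF open_UNIV subset_UNIV smooth_on_torus_to_S3] subset_UNIV]
      show "smooth_map ({0..1} \<times> K) (\<lambda>(t, x). \<Phi> t x)"
        by (simp add: \<Phi>_def case_prod_unfold)
      show "\<forall>x\<in>K. \<Phi> 0 x = x" using KB(2) by (simp add: \<Phi>_def \<Theta>_def disk_moebius_def)
      show "\<Phi> 1 ` K = rescaled_slice L R" by (rule \<Phi>1K)
      show "\<forall>t\<in>{0..1}. S3_braid N (\<Phi> t ` K) \<and> (\<exists>\<Psi>. diffeomorphism K (\<Phi> t ` K) (\<Phi> t) \<Psi>)"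
        using iso by blast
    qed
    moreover have "S3_braid N (rescaled_slice L R)" using iso[of 1] \<Phi>1K by simp
    ultimately show ?thesis using trans \<Phi>1 unfolding I_def by blast
  qed
  have conn: "\<exists>g. proper_lagrangian_disk g \<and> L = g ` unit_disk" if "connected K"
  proof -
    obtain j where j: "j \<in> I" using fin(2) by blast
    have "K \<noteq> {}" using in_components_nonempty[OF C_comp[OF j]] C_sub[OF j] by blast
    \<comment> \<open>A nonempty connected set is its own only component, and the bijection with
      \<open>{1..n}\<close> then forces \<open>n = 1\<close>.\<close>
    then have "components K = {K}" using that components_eq_sing_iff by blast
    then have "card {1..n} = 1" using bij_betw_same_card[OF assms(4)] by simp
    then have "n = 1" by simp
    then have "1 \<in> I" "L = f 1 ` unit_disk" by (simp_all add: L_def I_def)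
    then show ?thesis using proper by blast
  qed
  show ?thesis
  proof (intro exI conjI)
    show "\<forall>j\<in>{1..n}. proper_lagrangian_disk (f j)" using proper unfolding I_def by blast
    show "L = (\<Union>j\<in>{1..n}. f j ` unit_disk)" by (rule L_def)
    show "R0 > 0" by fact
    show "\<forall>R\<ge>R0. (\<forall>j\<in>{1..n}. transverse_to_sphere (f j) R) \<and> S3_braid N (rescaled_slice L R) \<and>
      (\<exists>\<Phi>. braid_isotopy N \<Phi> K (rescaled_slice L R) \<and> (\<forall>j\<in>{1..n}. \<Phi> 1 ` C j = rescaled_slice (f j ` unit_disk) R))"
      using slices by blast
    show "connected K \<longrightarrow> (\<exists>g. proper_lagrangian_disk g \<and> L = g ` unit_disk)" using conn by blast
  qed
qed

end
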